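(* Let $(\Sigma^2,\langle\,,\rangle)$ be a connected, non-flat, parabolic Riemannian surface with non-negative Gaussian curvature. Then there exists no codimension two weakly trapped immersion $\psi:\Sigma^2\to\Lambda^+\subset\mathbb{L}^4$ with image in the future component $\Lambda^+$ of the light cone for which $\psi^*(\langle\,,\rangle_{\mathbb{L}^4})=\lambda^2\langle\,,\rangle$ with conformal factor $\lambda>0$ a smooth function bounded from above. In particular, this holds if $(\Sigma^2,\langle\,,\rangle)$ is a non-flat complete Riemannian surface with non-negative Gaussian curvature.
   Context: A (not necessarily complete) Riemannian manifold is parabolic if the only subharmonic functions on it which are bounded from above are the constants. $\mathbb{L}^{n+2}$ is $\mathbb{R}^{n+2}$ with metric $-dx_1^2+dx_2^2+\cdots+dx_{n+2}^2$, standard basis $\mathbf{e}_1,\dots,\mathbf{e}_{n+2}$, and time orientation given by $\mathbf{e}_1$; $\Lambda^+=\{x\in\mathbb{L}^{n+2}:\langle x,x\rangle=0,\ x_1>0\}$ (here $n=2$). For a spacelike immersion $\psi:\Sigma^n\to\Lambda^+\subset\mathbb{L}^{n+2}$ (with $\Sigma$ given the induced metric), put $u=-\langle\psi,\mathbf{e}_1\rangle>0$. There is a globally defined future-pointing null normal frame $\xi=\psi$, $\eta=-\frac{1+\|\nabla u\|^2}{2u^2}\xi+\frac1u\mathbf{e}_1^\perp$ with $\langle\xi,\eta\rangle=-1$, where $\nabla u$, $\|\cdot\|$ refer to the induced metric and $\perp$ denotes the component normal to $\Sigma$. For a normal field $\zeta$ set $A_\zeta X=(\overline\nabla_X\zeta)^\top$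 ($\overline\nabla$ the Levi-Civita connection of $\mathbb{L}^{n+2}$, $\top$ the tangential component) and $\theta_\zeta=\frac1n\operatorname{tr}A_\zeta$. The immersion is weakly trapped if, on $\Sigma$, either both $\theta_\xi\le0$ and $\theta_\eta\le0$ with $\theta_\xi^2+\theta_\eta^2>0$, or both $\theta_\xi\ge0$ and $\theta_\eta\ge0$ with $\theta_\xi^2+\theta_\eta^2>0$. *)

theory Defs
  imports "HOL-Analysis.Analysis"
begin

section \<open>Functions of class \<open>C\<^sup>k\<close> on open subsets of the coordinate plane\<close>

definition pdiff :: "2 \<Rightarrow> (real^2 \<Rightarrow> 'b::real_normed_vector) \<Rightarrow> real^2 \<Rightarrow> 'b" where
  "pdiff i f x = frechet_derivative f (at x) (axis i 1)"

fun Ck_on :: "nat \<Rightarrow> (real^2) set \<Rightarrow> (real^2 \<Rightarrow> 'b::real_normed_vector) \<Rightarrow> bool" where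
  "Ck_on 0 S f \<longleftrightarrow> continuous_on S f"
| "Ck_on (Suc k) S f \<longleftrightarrow> (\<forall>x\<in>S. f differentiable (at x)) \<and> (\<forall>i. Ck_on k S (pdiff i f))"

definition smooth_on :: "(real^2) set \<Rightarrow> (real^2 \<Rightarrow> 'b::real_normed_vector) \<Rightarrow> bool" where
  "smooth_on S f \<longleftrightarrow> (\<forall>k. Ck_on k S f)"


section \<open>Smooth surfaces\<close>

text \<open>
  A surface is a whole topological type, Hausdorff and second countable by its type class,
  together with an atlas (not necessarily maximal). A chart is a pair of a domain and a
  coordinate map; only the values of the coordinate map on the domain are relevant.
\<close>

type_synonym 'a chart = "'a set \<times> ('a \<Rightarrow> real^2)"

abbreviation chart_dom :: "'a chart \<Rightarrow> 'a set" where
  "chart_dom c \<equiv> fst c"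

abbreviation chart_map :: "'a chart \<Rightarrow> 'a \<Rightarrow> real^2" where
  "chart_map c \<equiv> snd c"

definition chart_img :: "'a chart \<Rightarrow> (real^2) set" where
  "chart_img c = chart_map c ` chart_dom c"

definition chart_inv :: "'a chart \<Rightarrow> real^2 \<Rightarrow> 'a" where
  "chart_inv c = inv_into (chart_dom c) (chart_map c)"

definition transition :: "'a chart \<Rightarrow> 'a chart \<Rightarrow> real^2 \<Rightarrow> real^2" where
  "transition c d = chart_map d \<circ> chart_inv c"

definition overlap :: "'a chart \<Rightarrow> 'a chart \<Rightarrow> (real^2) set" where
  "overlap c d = chart_map c ` (chart_dom c \<inter> chart_dom d)"

definition smooth_surface ::
    "('a::{t2_space,second_countable_topology}) chart set \<Rightarrow> bool" where
  "smooth_surface A \<longleftrightarrow>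
     (\<Union>c\<in>A. chart_dom c) = UNIV \<and>
     (\<forall>c\<in>A. open (chart_dom c) \<and> open (chart_img c) \<and>
        homeomorphism (chart_dom c) (chart_img c) (chart_map c) (chart_inv c)) \<and>
     (\<forall>c\<in>A. \<forall>d\<in>A. smooth_on (overlap c d) (transition c d))"

definition surface_Ck :: "'a chart set \<Rightarrow> nat \<Rightarrow> ('a \<Rightarrow> 'b::real_normed_vector) \<Rightarrow> bool" where
  "surface_Ck A k f \<longleftrightarrow> (\<forall>c\<in>A. Ck_on k (chart_img c) (f \<circ> chart_inv c))"

definition surface_smooth :: "'a chart set \<Rightarrow> ('a \<Rightarrow> 'b::real_normed_vector) \<Rightarrow> bool" where
  "surface_smooth A f \<longleftrightarrow> (\<forall>c\<in>A. smooth_on (chart_img c) (f \<circ> chart_inv c))"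


section \<open>Metrics in coordinates\<close>

text \<open>
  In this section \<open>G\<close> is the Gram matrix of a metric with respect to the coordinate
  fields \<open>\<partial>\<^sub>1, \<partial>\<^sub>2\<close>, as a function of the coordinates.
\<close>

definition metric_inner :: "real^2^2 \<Rightarrow> real^2 \<Rightarrow> real^2 \<Rightarrow> real" where
  "metric_inner M v w = v \<bullet> (M *v w)"

definition gradient :: "(real^2 \<Rightarrow> real^2^2) \<Rightarrow> (real^2 \<Rightarrow> real) \<Rightarrow> real^2 \<Rightarrow> real^2" where
  "gradient G f x = matrix_inv (G x) *v (\<chi> j. pdiff j f x)"

text \<open>\<open>christoffel G k i j\<close> is the Christoffel symbol with upper index \<open>k\<close> and lower indices \<open>i, j\<close>.\<close>

definition christoffel :: "(real^2 \<Rightarrow> real^2^2) \<Rightarrow> 2 \<Rightarrow> 2 \<Rightarrow> 2 \<Rightarrow> real^2 \<Rightarrow> real" where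
  "christoffel G k i j x = (\<Sum>l\<in>UNIV. matrix_inv (G x) $ k $ l *
     (pdiff i (\<lambda>y. G y $ j $ l) x + pdiff j (\<lambda>y. G y $ i $ l) x
        - pdiff l (\<lambda>y. G y $ i $ j) x)) / 2"

text \<open>
  \<open>riemann G l k i j\<close> is the coefficient of \<open>\<partial>\<^sub>l\<close> in \<open>R(\<partial>\<^sub>i, \<partial>\<^sub>j) \<partial>\<^sub>k\<close>, with the convention
  \<open>R(X, Y) Z = \<nabla>\<^sub>X \<nabla>\<^sub>Y Z - \<nabla>\<^sub>Y \<nabla>\<^sub>X Z - \<nabla>\<^bsub>[X, Y]\<^esub> Z\<close>.
\<close>

definition riemann :: "(real^2 \<Rightarrow> real^2^2) \<Rightarrow> 2 \<Rightarrow> 2 \<Rightarrow> 2 \<Rightarrow> 2 \<Rightarrow> real^2 \<Rightarrow> real" where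
  "riemann G l k i j x =
     pdiff i (christoffel G l j k) x - pdiff j (christoffel G l i k) x
     + (\<Sum>m\<in>UNIV. christoffel G m j k x * christoffel G l i m x
                  - christoffel G m i k x * christoffel G l j m x)"

text \<open>
  \<open>\<langle>R(\<partial>\<^sub>1, \<partial>\<^sub>2) \<partial>\<^sub>2, \<partial>\<^sub>1\<rangle>\<close> divided by the squared area of the parallelogram spanned by
  \<open>\<partial>\<^sub>1, \<partial>\<^sub>2\<close>; the curvature of the round sphere is positive.
\<close>

definition gauss_curvature :: "(real^2 \<Rightarrow> real^2^2) \<Rightarrow> real^2 \<Rightarrow> real" where
  "gauss_curvature G x = (\<Sum>l\<in>UNIV. G x $ 1 $ l * riemann G l 2 1 2 x) / det (G x)"

definition laplacian :: "(real^2 \<Rightarrow> real^2^2) \<Rightarrow> (real^2 \<Rightarrow> real) \<Rightarrow> real^2 \<Rightarrow> real" where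
  "laplacian G f x = (\<Sum>i\<in>UNIV. \<Sum>j\<in>UNIV. matrix_inv (G x) $ i $ j *
     (pdiff i (pdiff j f) x - (\<Sum>k\<in>UNIV. christoffel G k i j x * pdiff k f x)))"


section \<open>Riemannian surfaces\<close>

text \<open>
  A Riemannian metric is given by its Gram matrices \<open>g c\<close> in the charts \<open>c\<close> of the atlas.
\<close>

definition riemannian_surface ::
    "('a::{t2_space,second_countable_topology}) chart set
       \<Rightarrow> ('a chart \<Rightarrow> real^2 \<Rightarrow> real^2^2) \<Rightarrow> bool" where
  "riemannian_surface A g \<longleftrightarrow> smooth_surface A \<and>
     (\<forall>c\<in>A. smooth_on (chart_img c) (g c)) \<and>
     (\<forall>c\<in>A. \<forall>x\<in>chart_img c. transpose (g c x) = g c x \<and>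
        (\<forall>v. v \<noteq> 0 \<longrightarrow> 0 < metric_inner (g c x) v v)) \<and>
     (\<forall>c\<in>A. \<forall>d\<in>A. \<forall>x\<in>overlap c d. \<forall>v w.
        let D = frechet_derivative (transition c d) (at x)
        in metric_inner (g c x) v w = metric_inner (g d (transition c d x)) (D v) (D w))"

definition nonneg_curvature ::
    "'a chart set \<Rightarrow> ('a chart \<Rightarrow> real^2 \<Rightarrow> real^2^2) \<Rightarrow> bool" where
  "nonneg_curvature A g \<longleftrightarrow> (\<forall>c\<in>A. \<forall>x\<in>chart_img c. 0 \<le> gauss_curvature (g c) x)"

definition flat_surface ::
    "'a chart set \<Rightarrow> ('a chart \<Rightarrow> real^2 \<Rightarrow> real^2^2) \<Rightarrow> bool" where
  "flat_surface A g \<longleftrightarrow> (\<forall>c\<in>A. \<forall>x\<in>chart_img c. gauss_curvature (g c) x = 0)"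

definition subharmonic ::
    "'a chart set \<Rightarrow> ('a chart \<Rightarrow> real^2 \<Rightarrow> real^2^2) \<Rightarrow> ('a \<Rightarrow> real) \<Rightarrow> bool" where
  "subharmonic A g f \<longleftrightarrow> surface_Ck A 2 f \<and>
     (\<forall>c\<in>A. \<forall>x\<in>chart_img c. 0 \<le> laplacian (g c) (f \<circ> chart_inv c) x)"

definition parabolic_surface ::
    "'a chart set \<Rightarrow> ('a chart \<Rightarrow> real^2 \<Rightarrow> real^2^2) \<Rightarrow> bool" where
  "parabolic_surface A g \<longleftrightarrow>
     (\<forall>f. subharmonic A g f \<and> bdd_above (range f) \<longrightarrow> f constant_on UNIV)"

text \<open>
  \<open>path_length A g p q L\<close>: some piecewise \<open>C\<^sup>1\<close> curve from \<open>p\<close> to \<open>q\<close> has length \<open>L\<close>. Such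
  a curve is a finite concatenation of \<open>C\<^sup>1\<close> arcs, which by the Lebesgue number lemma can be
  taken so short that each of them lies in a single chart.
\<close>

inductive path_length ::
    "'a chart set \<Rightarrow> ('a chart \<Rightarrow> real^2 \<Rightarrow> real^2^2) \<Rightarrow> 'a \<Rightarrow> 'a \<Rightarrow> real \<Rightarrow> bool"
  for A g where
  refl: "path_length A g p p 0"
| step: "\<lbrakk> path_length A g p (chart_inv c (\<gamma> 0)) L; c \<in> A;
           \<gamma> C1_differentiable_on {0..1}; \<gamma> ` {0..1} \<subseteq> chart_img c \<rbrakk>
         \<Longrightarrow> path_length A g p (chart_inv c (\<gamma> 1))
               (L + integral {0..1} (\<lambda>t.
                  let v = vector_derivative \<gamma> (at t) in sqrt (metric_inner (g c (\<gamma> t)) v v)))"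

definition riemannian_dist ::
    "'a chart set \<Rightarrow> ('a chart \<Rightarrow> real^2 \<Rightarrow> real^2^2) \<Rightarrow> 'a \<Rightarrow> 'a \<Rightarrow> real" where
  "riemannian_dist A g p q = Inf {L. path_length A g p q L}"

text \<open>Only used for connected surfaces, on which the Riemannian distance is finite.\<close>

definition complete_surface ::
    "'a chart set \<Rightarrow> ('a chart \<Rightarrow> real^2 \<Rightarrow> real^2^2) \<Rightarrow> bool" where
  "complete_surface A g \<longleftrightarrow> Metric_space.mcomplete UNIV (riemannian_dist A g)"


section \<open>The Lorentz-Minkowski space and its light cone\<close>

definition lorentz :: "real^4 \<Rightarrow> real^4 \<Rightarrow> real" where
  "lorentz x y = - (x $ 1 * y $ 1) + x $ 2 * y $ 2 + x $ 3 * y $ 3 + x $ 4 * y $ 4"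

definition e1 :: "real^4" where
  "e1 = axis 1 1"

definition future_light_cone :: "(real^4) set" where
  "future_light_cone = {x. lorentz x x = 0 \<and> 0 < x $ 1}"


section \<open>Spacelike surfaces in coordinates\<close>

text \<open>
  In this section \<open>F\<close> is an immersion expressed in the coordinates of a chart. The tangent
  plane of the surface at the point with coordinates \<open>x\<close> is the range of the differential
  of \<open>F\<close> at \<open>x\<close>, and is identified with the coordinate plane by this differential. Normal
  fields are functions of the coordinates; as the Levi-Civita connection of the ambient space
  is flat, they are differentiated componentwise.
\<close>

definition induced_metric :: "(real^2 \<Rightarrow> real^4) \<Rightarrow> real^2 \<Rightarrow> real^2^2" where
  "induced_metric F x = (\<chi> i j. lorentz (pdiff i F x) (pdiff j F x))"

definition tangent_plane :: "(real^2 \<Rightarrow> real^4) \<Rightarrow> real^2 \<Rightarrow> (real^4) set" where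
  "tangent_plane F x = range (frechet_derivative F (at x))"

definition tangent_part :: "(real^2 \<Rightarrow> real^4) \<Rightarrow> real^2 \<Rightarrow> real^4 \<Rightarrow> real^4" where
  "tangent_part F x w =
     (THE t. t \<in> tangent_plane F x \<and> (\<forall>s\<in>tangent_plane F x. lorentz (w - t) s = 0))"

definition normal_part :: "(real^2 \<Rightarrow> real^4) \<Rightarrow> real^2 \<Rightarrow> real^4 \<Rightarrow> real^4" where
  "normal_part F x w = w - tangent_part F x w"

text \<open>The operator \<open>A\<^sub>\<zeta>\<close>, read in the coordinate plane.\<close>

definition weingarten :: "(real^2 \<Rightarrow> real^4) \<Rightarrow> (real^2 \<Rightarrow> real^4) \<Rightarrow> real^2 \<Rightarrow> real^2 \<Rightarrow> real^2" where
  "weingarten F \<zeta> x v =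
     (THE w. frechet_derivative F (at x) w
               = tangent_part F x (frechet_derivative \<zeta> (at x) v))"

definition null_expansion :: "(real^2 \<Rightarrow> real^4) \<Rightarrow> (real^2 \<Rightarrow> real^4) \<Rightarrow> real^2 \<Rightarrow> real" where
  "null_expansion F \<zeta> x = trace (matrix (weingarten F \<zeta> x)) / 2"

definition height :: "(real^2 \<Rightarrow> real^4) \<Rightarrow> real^2 \<Rightarrow> real" where
  "height F x = - lorentz (F x) e1"

text \<open>
  For a surface in the light cone, the position vector \<open>F\<close> and \<open>null_eta F\<close> are the
  future-pointing null normal frame.
\<close>

definition null_eta :: "(real^2 \<Rightarrow> real^4) \<Rightarrow> real^2 \<Rightarrow> real^4" where
  "null_eta F x =
     (let u = height F x;
          grad_u = gradient (induced_metric F) (height F) x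
      in (- (1 + metric_inner (induced_metric F x) grad_u grad_u) / (2 * u\<^sup>2)) *\<^sub>R F x
         + (1 / u) *\<^sub>R normal_part F x e1)"


section \<open>Weakly trapped immersions into the light cone\<close>

definition spacelike_immersion :: "'a chart set \<Rightarrow> ('a \<Rightarrow> real^4) \<Rightarrow> bool" where
  "spacelike_immersion A \<psi> \<longleftrightarrow> surface_smooth A \<psi> \<and>
     (\<forall>c\<in>A. \<forall>x\<in>chart_img c.
        inj (frechet_derivative (\<psi> \<circ> chart_inv c) (at x)) \<and>
        (\<forall>w\<in>tangent_plane (\<psi> \<circ> chart_inv c) x. w \<noteq> 0 \<longrightarrow> 0 < lorentz w w))"

definition weakly_trapped :: "'a chart set \<Rightarrow> ('a \<Rightarrow> real^4) \<Rightarrow> bool" where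
  "weakly_trapped A \<psi> \<longleftrightarrow>
     (\<forall>c\<in>A. \<forall>x\<in>chart_img c.
        let F = \<psi> \<circ> chart_inv c;
            \<theta>\<^sub>\<xi> = null_expansion F F x;
            \<theta>\<^sub>\<eta> = null_expansion F (null_eta F) x
        in \<theta>\<^sub>\<xi> \<le> 0 \<and> \<theta>\<^sub>\<eta> \<le> 0 \<and> 0 < \<theta>\<^sub>\<xi>\<^sup>2 + \<theta>\<^sub>\<eta>\<^sup>2) \<or>
     (\<forall>c\<in>A. \<forall>x\<in>chart_img c.
        let F = \<psi> \<circ> chart_inv c;
            \<theta>\<^sub>\<xi> = null_expansion F F x;
            \<theta>\<^sub>\<eta> = null_expansion F (null_eta F) x
        in 0 \<le> \<theta>\<^sub>\<xi> \<and> 0 \<le> \<theta>\<^sub>\<eta> \<and> 0 < \<theta>\<^sub>\<xi>\<^sup>2 + \<theta>\<^sub>\<eta>\<^sup>2)"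

text \<open>\<open>\<psi>\<^sup>*\<langle>,\<rangle> = \<lambda>\<^sup>2 g\<close>, where \<open>lam\<close> is the function \<open>\<lambda>\<close>.\<close>

definition conformal_with_factor ::
    "'a chart set \<Rightarrow> ('a chart \<Rightarrow> real^2 \<Rightarrow> real^2^2) \<Rightarrow> ('a \<Rightarrow> real^4) \<Rightarrow> ('a \<Rightarrow> real) \<Rightarrow> bool" where
  "conformal_with_factor A g \<psi> lam \<longleftrightarrow>
     (\<forall>c\<in>A. \<forall>x\<in>chart_img c.
        induced_metric (\<psi> \<circ> chart_inv c) x = (lam (chart_inv c x))\<^sup>2 *\<^sub>R g c x)"

end

theory Submission
  imports Defs
begin

text \<open>
  For an immersion \<open>\<psi>\<close> into the light cone, \<open>A\<^sub>\<xi>\<close> is the identity, so \<open>\<theta>\<^sub>\<xi> = 1\<close>, and the Gauss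
  equation reads \<open>K = - 2 \<theta>\<^sub>\<eta>\<close> for the curvature of the induced metric. Weak trappedness therefore
  forces this curvature to be nonpositive. The rescaled map \<open>\<Psi> = \<psi> / \<lambda>\<close> is again an immersion into
  the cone, and its induced metric is \<open>g\<close>. For a constant null vector \<open>\<nu>\<close> the function
  \<open>ln (- \<langle>\<psi>, \<nu>\<rangle>)\<close> has Laplacian \<open>- K\<close>, because stereographic projection of the null directions from
  \<open>\<nu>\<close> exhibits the metric as \<open>\<langle>\<psi>, \<nu>\<rangle>\<^sup>2 |dz|\<^sup>2\<close>. Comparing \<open>\<psi>\<close> with \<open>\<Psi>\<close> gives
  \<open>\<Delta> (ln \<lambda>) \<ge> K \<ge> 0\<close> for the metric \<open>g\<close>. On a parabolic surface \<open>ln \<lambda>\<close> is then constant, so that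
  \<open>K = 0\<close> (\<open>trapped_light_cone_surface\<close>, \<open>parabolic_imp_flat\<close>).

  On a complete surface the classical argument is that \<open>ln r\<close> is superharmonic for the distance \<open>r\<close>
  from a point, since \<open>K \<ge> 0\<close>, and tends to infinity; subtracting a small multiple of it from
  \<open>f = ln \<lambda>\<close> produces an interior maximum that cannot exist. Here \<open>r\<^sup>2\<close> is replaced by the
  energy \<open>N (e(x\<^sub>0, x\<^sub>1) + \<dots> + e(x\<^bsub>N-1\<^esub>, x\<^sub>N))\<close> of a chain of points starting at \<open>x\<^sub>0 = p\<close>, where
  \<open>e(x, y) = - 2 \<langle>\<Psi> x, \<Psi> y\<rangle>\<close> is the squared chord in the cone. It is a globally defined smooth function
  that agrees with the squared distance to leading order, which makes the variational problem finite
  dimensional. In stereographic coordinates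
  \<open>e(x, y) = \<rho>(x) \<rho>(y) |z(x) - z(y)|\<^sup>2\<close> with \<open>\<rho> = - \<langle>\<Psi>, \<nu>\<rangle>\<close> and \<open>ln \<rho>\<close> superharmonic. If the nodes
  move as \<open>z(x\<^sub>i) + \<zeta> a\<^sub>i\<close> with a complex parameter \<open>\<zeta>\<close>, each \<open>ln e(x\<^sub>i, x\<^bsub>i+1\<^esub>)\<close> is superharmonic
  in \<open>\<zeta>\<close>. The velocities \<open>a\<^sub>i\<close> can be chosen recursively from \<open>a\<^sub>0 = 0\<close> so that all these logarithms
  have the same \<open>\<zeta>\<close>-derivative; then the logarithm of the energy is itself superharmonic, with
  gradient of constant length (\<open>edge_variation\<close>, \<open>chain_no_interior_maximum\<close>).

  The maximum over chains exists because bounded closed sets are compact (\<open>hopf_rinow\<close>) and because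
  short chords control the Riemannian distance (\<open>uniform_good_edge\<close>, \<open>chain_distance\<close>). If the initial
  point has positive curvature, then \<open>\<Delta> f \<ge> K > 0\<close> there, so \<open>\<Delta> f > 0\<close> on a small disc around it, and
  \<open>max_principle\<close> yields a global maximum of \<open>f\<close> in this disc, which is absurd (\<open>complete_imp_flat\<close>).
\<close>

section \<open>Calculus of smooth functions in the coordinate plane\<close>

lemma sum_2: "(\<Sum>i\<in>UNIV. f (i::2)) = f 1 + f 2"
  by (simp add: UNIV_2)

lemma pdiff_eqI: "(f has_derivative f') (at x) \<Longrightarrow> pdiff i f x = f' (axis i 1)"
  unfolding pdiff_def by (metis frechet_derivative_at)

lemma pdiff_cong:
  assumes "open S" "x \<in> S" "\<And>y. y \<in> S \<Longrightarrow> f y = g y"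
  shows "pdiff i f x = pdiff i g x"
proof -
  have "(f has_derivative f') (at x) \<longleftrightarrow> (g has_derivative f') (at x)" for f'
    using has_derivative_transform_within_open[OF _ assms(1,2)] assms(3) by metis
  then show ?thesis unfolding pdiff_def frechet_derivative_def by simp
qed

lemma differentiable_cong_open:
  assumes "open S" "x \<in> S" "\<And>y. y \<in> S \<Longrightarrow> f y = g y"
  shows "f differentiable at x \<longleftrightarrow> g differentiable at x"
  using has_derivative_transform_within_open[OF _ assms(1,2)] assms(3)
  unfolding differentiable_def by metis

lemma Ck_on_cong:
  assumes "open S" "\<And>y. y \<in> S \<Longrightarrow> f y = g y"
  shows "Ck_on k S f \<longleftrightarrow> Ck_on k S g"
  using assms(2)
proof (induction k arbitrary: f g)
  case 0
  then show ?case unfolding Ck_on.simps by (rule continuous_on_cong[OF HOL.refl])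
next
  case (Suc k)
  have "Ck_on k S (pdiff i f) = Ck_on k S (pdiff i g)" for i
    by (rule Suc.IH) (rule pdiff_cong[OF assms(1) _ Suc.prems])
  moreover have "f differentiable at x \<longleftrightarrow> g differentiable at x" if "x \<in> S" for x
    by (rule differentiable_cong_open[OF assms(1) that Suc.prems])
  ultimately show ?case unfolding Ck_on.simps by blast
qed

lemma Ck_on_Suc_imp: "Ck_on (Suc k) S f \<Longrightarrow> Ck_on k S f"
proof (induction k arbitrary: f)
  case 0
  then show ?case
    by (auto intro!: continuous_at_imp_continuous_on differentiable_imp_continuous_within)
next
  case (Suc k)
  then show ?case by (metis Ck_on.simps(2))
qed

lemma frechet_derivative_pdiff:
  assumes "f differentiable at x"
  shows "frechet_derivative f (at x) v = (\<Sum>i\<in>UNIV. v $ i *\<^sub>R pdiff i f x)"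
proof -
  interpret linear "frechet_derivative f (at x)"
    by (rule linear_frechet_derivative[OF assms])
  have "v = (\<Sum>i\<in>UNIV. v $ i *\<^sub>R axis i 1)"
    by (simp add: vec_eq_iff axis_def if_distrib cong: if_cong)
  then have "frechet_derivative f (at x) v = frechet_derivative f (at x) (\<Sum>i\<in>UNIV. v $ i *\<^sub>R axis i 1)"
    by simp
  then show ?thesis by (simp add: sum scale pdiff_def)
qed

lemma has_derivative_pdiff:
  assumes "f differentiable at x"
  shows "(f has_derivative (\<lambda>v. \<Sum>i\<in>UNIV. v $ i *\<^sub>R pdiff i f x)) (at x)"
proof -
  have "frechet_derivative f (at x) = (\<lambda>v. \<Sum>i\<in>UNIV. v $ i *\<^sub>R pdiff i f x)"
    by (rule ext) (rule frechet_derivative_pdiff[OF assms])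
  then show ?thesis
    using frechet_derivative_works[THEN iffD1, OF assms] by metis
qed

lemma pdiff_bilinear:
  assumes "bounded_bilinear p" "f differentiable at x" "g differentiable at x"
  shows "pdiff i (\<lambda>y. p (f y) (g y)) x = p (f x) (pdiff i g x) + p (pdiff i f x) (g x)"
    and "(\<lambda>y. p (f y) (g y)) differentiable at x"
proof -
  note fw = frechet_derivative_works[THEN iffD1, OF assms(2)]
    and gw = frechet_derivative_works[THEN iffD1, OF assms(3)]
  note h = bounded_bilinear.FDERIV[OF assms(1) fw gw]
  show "pdiff i (\<lambda>y. p (f y) (g y)) x = p (f x) (pdiff i g x) + p (pdiff i f x) (g x)"
    using pdiff_eqI[OF h] by (simp add: pdiff_def)
  show "(\<lambda>y. p (f y) (g y)) differentiable at x"
    using h by (rule differentiableI)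
qed

lemma pdiff_linear:
  assumes "bounded_linear h" "f differentiable at x"
  shows "pdiff i (\<lambda>y. h (f y)) x = h (pdiff i f x)"
    and "(\<lambda>y. h (f y)) differentiable at x"
proof -
  note fw = frechet_derivative_works[THEN iffD1, OF assms(2)]
  note d = bounded_linear.has_derivative[OF assms(1) fw]
  show "pdiff i (\<lambda>y. h (f y)) x = h (pdiff i f x)"
    using pdiff_eqI[OF d] by (simp add: pdiff_def)
  show "(\<lambda>y. h (f y)) differentiable at x"
    using d by (rule differentiableI)
qed

lemma pdiff_add:
  assumes "f differentiable at x" "g differentiable at x"
  shows "pdiff i (\<lambda>y. f y + g y) x = pdiff i f x + pdiff i g x"
  using pdiff_eqI[OF has_derivative_add[OF frechet_derivative_works[THEN iffD1, OF assms(1)]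
      frechet_derivative_works[THEN iffD1, OF assms(2)]]] by (simp add: pdiff_def)

lemma pdiff_const: "pdiff i (\<lambda>y. c) x = 0"
  by (simp add: pdiff_def)

lemma pdiff_real_chain:
  fixes f :: "real^2 \<Rightarrow> real"
  assumes "f differentiable at x" "(h has_real_derivative h') (at (f x))"
  shows "pdiff i (\<lambda>y. h (f y)) x = h' * pdiff i f x"
    and "(\<lambda>y. h (f y)) differentiable at x"
proof -
  note fw = frechet_derivative_works[THEN iffD1, OF assms(1)]
  have h: "(h has_derivative (*) h') (at (f x))"
    using assms(2) by (simp add: has_field_derivative_def)
  note d = diff_chain_at[OF fw h]
  show "pdiff i (\<lambda>y. h (f y)) x = h' * pdiff i f x"
    using pdiff_eqI[OF d] by (simp add: pdiff_def o_def)
  show "(\<lambda>y. h (f y)) differentiable at x"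
    using d differentiableI by (fastforce simp: o_def)
qed

lemma Ck_on_const [simp]: "Ck_on k S (\<lambda>x. c)"
proof (induction k arbitrary: c)
  case (Suc k)
  have "pdiff i (\<lambda>x. c) = (\<lambda>x. 0)" for i :: 2 by (simp add: fun_eq_iff pdiff_const)
  then show ?case using Suc by simp
qed simp

lemma Ck_on_add:
  assumes "open S" "Ck_on k S f" "Ck_on k S g"
  shows "Ck_on k S (\<lambda>x. f x + g x)"
  using assms(2,3)
proof (induction k arbitrary: f g)
  case 0
  then show ?case by (simp add: continuous_on_add)
next
  case (Suc k)
  have "Ck_on k S (pdiff i (\<lambda>x. f x + g x))" for i
    using Suc by (subst Ck_on_cong[OF assms(1), where g = "\<lambda>x. pdiff i f x + pdiff i g x"])
      (auto simp: pdiff_add)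
  then show ?case using Suc.prems by (simp add: differentiable_add)
qed

lemma Ck_on_linear:
  assumes "open S" "bounded_linear h" "Ck_on k S f"
  shows "Ck_on k S (\<lambda>x. h (f x))"
  using assms(3)
proof (induction k arbitrary: f)
  case 0
  then show ?case
    by (simp add: bounded_linear.continuous_on[OF assms(2)])
next
  case (Suc k)
  have "Ck_on k S (pdiff i (\<lambda>x. h (f x)))" for i
    using Suc by (subst Ck_on_cong[OF assms(1), where g = "\<lambda>x. h (pdiff i f x)"])
      (auto simp: pdiff_linear[OF assms(2)])
  then show ?case using Suc.prems by (simp add: pdiff_linear[OF assms(2)])
qed

lemma Ck_on_bilinear:
  assumes "open S" "bounded_bilinear p" "Ck_on k S f" "Ck_on k S g"
  shows "Ck_on k S (\<lambda>x. p (f x) (g x))"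
  using assms(3,4)
proof (induction k arbitrary: f g)
  case 0
  then show ?case by (simp add: bounded_bilinear.continuous_on[OF assms(2)])
next
  case (Suc k)
  have k: "Ck_on k S f" "Ck_on k S g"
    using Suc.prems Ck_on_Suc_imp by blast+
  have "Ck_on k S (pdiff i (\<lambda>x. p (f x) (g x)))" for i
    using Suc k
    by (subst Ck_on_cong[OF assms(1),
          where g = "\<lambda>x. p (f x) (pdiff i g x) + p (pdiff i f x) (g x)"])
      (auto simp: pdiff_bilinear[OF assms(2)] intro!: Ck_on_add[OF assms(1)])
  then show ?case using Suc.prems by (simp add: pdiff_bilinear[OF assms(2)])
qed

lemma Ck_on_inverse:
  fixes f :: "real^2 \<Rightarrow> real"
  assumes "open S" "Ck_on k S f" "\<And>x. x \<in> S \<Longrightarrow> f x \<noteq> 0"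
  shows "Ck_on k S (\<lambda>x. inverse (f x))"
  using assms(2,3)
proof (induction k)
  case 0
  then show ?case by (auto intro!: continuous_on_inverse)
next
  case (Suc k)
  note h = pdiff_real_chain[where h = inverse, OF _ DERIV_inverse]
  have k: "Ck_on k S (\<lambda>x. inverse (f x))" using Suc Ck_on_Suc_imp by blast
  have "Ck_on k S (pdiff i (\<lambda>x. inverse (f x)))" for i
    using Suc.prems k
    by (subst Ck_on_cong[OF assms(1),
          where g = "\<lambda>x. - (inverse (f x) * inverse (f x) * pdiff i f x)"])
      (auto simp: h power2_eq_square numeral_2_eq_2
        intro!: Ck_on_bilinear[OF assms(1) bounded_bilinear_mult]
          Ck_on_linear[OF assms(1) bounded_linear_minus[OF bounded_linear_ident]])
  then show ?case using Suc.prems h by simp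
qed

lemma Ck_on_ln:
  fixes f :: "real^2 \<Rightarrow> real"
  assumes "open S" "Ck_on k S f" "\<And>x. x \<in> S \<Longrightarrow> 0 < f x"
  shows "Ck_on k S (\<lambda>x. ln (f x))"
proof (cases k)
  case 0
  then show ?thesis using assms by (force intro!: continuous_on_ln)
next
  case (Suc j)
  note h = pdiff_real_chain[where h = ln, OF _ DERIV_ln]
  have f: "Ck_on j S f" using assms(2) Suc Ck_on_Suc_imp by blast
  have "f x \<noteq> 0" if "x \<in> S" for x using assms(3)[OF that] by simp
  with assms(1) f have inv: "Ck_on j S (\<lambda>x. inverse (f x))" by (intro Ck_on_inverse)
  have "Ck_on j S (pdiff i (\<lambda>x. ln (f x)))" for i
    using assms Suc inv
    by (subst Ck_on_cong[OF assms(1), where g = "\<lambda>x. inverse (f x) * pdiff i f x"])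
      (auto simp: h intro!: Ck_on_bilinear[OF assms(1) bounded_bilinear_mult])
  then show ?thesis using assms Suc h by simp
qed

lemma smooth_on_pdiff: "smooth_on S f \<Longrightarrow> smooth_on S (pdiff i f)"
  unfolding smooth_on_def by (metis Ck_on.simps(2))

lemma smooth_on_differentiable: "smooth_on S f \<Longrightarrow> x \<in> S \<Longrightarrow> f differentiable at x"
  unfolding smooth_on_def by (metis Ck_on.simps(2))

lemma smooth_on_continuous: "smooth_on S f \<Longrightarrow> continuous_on S f"
  unfolding smooth_on_def by (metis Ck_on.simps(1))

lemma smooth_on_cong:
  "open S \<Longrightarrow> (\<And>y. y \<in> S \<Longrightarrow> f y = g y) \<Longrightarrow> smooth_on S f \<longleftrightarrow> smooth_on S g"
  unfolding smooth_on_def using Ck_on_cong by blast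

lemma smooth_on_const: "smooth_on S (\<lambda>x. c)"
  by (simp add: smooth_on_def)

lemma smooth_on_add:
  "open S \<Longrightarrow> smooth_on S f \<Longrightarrow> smooth_on S g \<Longrightarrow> smooth_on S (\<lambda>x. f x + g x)"
  by (simp add: smooth_on_def Ck_on_add)

lemma smooth_on_linear:
  "open S \<Longrightarrow> bounded_linear h \<Longrightarrow> smooth_on S f \<Longrightarrow> smooth_on S (\<lambda>x. h (f x))"
  by (simp add: smooth_on_def Ck_on_linear)

lemma smooth_on_minus:
  "open S \<Longrightarrow> smooth_on S f \<Longrightarrow> smooth_on S (\<lambda>x. - f x)"
  using smooth_on_linear[OF _ bounded_linear_minus[OF bounded_linear_ident]] .

lemma smooth_on_diff:
  "open S \<Longrightarrow> smooth_on S f \<Longrightarrow> smooth_on S g \<Longrightarrow> smooth_on S (\<lambda>x. f x - g x)"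
  using smooth_on_add[OF _ _ smooth_on_minus, of S f g] by simp

lemma smooth_on_bilinear:
  "open S \<Longrightarrow> bounded_bilinear p \<Longrightarrow> smooth_on S f \<Longrightarrow> smooth_on S g
    \<Longrightarrow> smooth_on S (\<lambda>x. p (f x) (g x))"
  by (simp add: smooth_on_def Ck_on_bilinear)

lemmas smooth_on_mult = smooth_on_bilinear[OF _ bounded_bilinear_mult]
lemmas smooth_on_scaleR = smooth_on_bilinear[OF _ bounded_bilinear_scaleR]

lemma smooth_on_inverse:
  fixes f :: "real^2 \<Rightarrow> real"
  shows "open S \<Longrightarrow> smooth_on S f \<Longrightarrow> (\<And>x. x \<in> S \<Longrightarrow> f x \<noteq> 0) \<Longrightarrow> smooth_on S (\<lambda>x. inverse (f x))"
  by (simp add: smooth_on_def Ck_on_inverse)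

lemma smooth_on_divide:
  fixes f g :: "real^2 \<Rightarrow> real"
  shows "open S \<Longrightarrow> smooth_on S f \<Longrightarrow> smooth_on S g \<Longrightarrow> (\<And>x. x \<in> S \<Longrightarrow> g x \<noteq> 0)
    \<Longrightarrow> smooth_on S (\<lambda>x. f x / g x)"
  unfolding divide_inverse by (intro smooth_on_mult smooth_on_inverse)

lemma smooth_on_ln:
  fixes f :: "real^2 \<Rightarrow> real"
  shows "open S \<Longrightarrow> smooth_on S f \<Longrightarrow> (\<And>x. x \<in> S \<Longrightarrow> 0 < f x) \<Longrightarrow> smooth_on S (\<lambda>x. ln (f x))"
  by (simp add: smooth_on_def Ck_on_ln)

lemma smooth_on_sum_2:
  fixes f :: "2 \<Rightarrow> real^2 \<Rightarrow> 'b::real_normed_vector"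
  shows "open S \<Longrightarrow> (\<And>i. smooth_on S (f i)) \<Longrightarrow> smooth_on S (\<lambda>x. \<Sum>i\<in>UNIV. f i x)"
  by (simp add: sum_2 smooth_on_add)

text \<open>
  The mean value theorem is applied in one coordinate direction and then in the other. The second
  difference is symmetric in \<open>i\<close> and \<open>j\<close>, so it ties both mixed derivatives together.
\<close>

lemma second_difference:
  fixes f :: "real^2 \<Rightarrow> real"
  assumes S: "open S" and f: "smooth_on S f" and b: "cball x (2 * h) \<subseteq> S" and h: "0 < h"
  shows "\<exists>y\<in>cball x (2 * h). f (x + h *\<^sub>R axis i 1 + h *\<^sub>R axis j 1) - f (x + h *\<^sub>R axis i 1)
            - f (x + h *\<^sub>R axis j 1) + f x = h\<^sup>2 * pdiff j (pdiff i f) y"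
proof -
  have inS: "x + s *\<^sub>R axis i 1 + t *\<^sub>R axis j 1 \<in> cball x (2 * h)"
    if "0 \<le> s" "s \<le> h" "0 \<le> t" "t \<le> h" for s t
  proof -
    have "norm (s *\<^sub>R axis i (1::real) + t *\<^sub>R axis j 1) \<le> s + t"
      using norm_triangle_ineq[of "s *\<^sub>R axis i (1::real)" "t *\<^sub>R axis j 1"] that by simp
    moreover have "dist x (x + u) = norm u" for u :: "real^2" by (simp add: dist_norm)
    ultimately show ?thesis using that by (simp add: add.assoc)
  qed
  have line: "((\<lambda>s. q (y + s *\<^sub>R axis k 1)) has_real_derivative pdiff k q (y + s *\<^sub>R axis k 1)) (at s)"
    if "y + s *\<^sub>R axis k 1 \<in> S" "smooth_on S q" for q y s and k :: 2
  proof -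
    have q: "(q has_derivative frechet_derivative q (at (y + s *\<^sub>R axis k 1))) (at (y + s *\<^sub>R axis k 1))"
      using smooth_on_differentiable[OF that(2,1)] frechet_derivative_works by blast
    have l: "((\<lambda>s. y + s *\<^sub>R axis k (1::real)) has_derivative (\<lambda>s. s *\<^sub>R axis k 1)) (at s)"
      by (auto intro!: derivative_eq_intros)
    note d = diff_chain_at[OF l q]
    have "(frechet_derivative q (at (y + s *\<^sub>R axis k 1)) \<circ> (\<lambda>s. s *\<^sub>R axis k 1))
        = (*) (pdiff k q (y + s *\<^sub>R axis k 1))"
      using linear_frechet_derivative[OF smooth_on_differentiable[OF that(2,1)]]
      by (simp add: fun_eq_iff pdiff_def linear_cmul)
    then show ?thesis using d by (simp add: has_field_derivative_def o_def)
  qed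
  let ?P = "\<lambda>s. f (x + h *\<^sub>R axis j 1 + s *\<^sub>R axis i 1) - f (x + s *\<^sub>R axis i 1)"
  have "\<exists>s. 0 < s \<and> s < h \<and> ?P h - ?P 0 = (h - 0) *
     (pdiff i f (x + h *\<^sub>R axis j 1 + s *\<^sub>R axis i 1) - pdiff i f (x + s *\<^sub>R axis i 1))"
  proof (rule MVT2[OF h], intro DERIV_diff line f)
    fix s assume s: "0 \<le> s" "s \<le> h"
    show "x + h *\<^sub>R axis j 1 + s *\<^sub>R axis i 1 \<in> S" "x + s *\<^sub>R axis i 1 \<in> S"
      using inS[of s h] inS[of s 0] s h b by (auto simp: algebra_simps)
  qed
  then obtain s where s: "0 < s" "s < h" "?P h - ?P 0 = h *
     (pdiff i f (x + h *\<^sub>R axis j 1 + s *\<^sub>R axis i 1) - pdiff i f (x + s *\<^sub>R axis i 1))"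
    by auto
  let ?Q = "\<lambda>t. pdiff i f (x + s *\<^sub>R axis i 1 + t *\<^sub>R axis j 1)"
  have "\<exists>t. 0 < t \<and> t < h \<and> ?Q h - ?Q 0 = (h - 0) *
     (pdiff j (pdiff i f) (x + s *\<^sub>R axis i 1 + t *\<^sub>R axis j 1))"
  proof (rule MVT2[OF h], intro line smooth_on_pdiff f)
    fix t assume t: "0 \<le> t" "t \<le> h"
    show "x + s *\<^sub>R axis i 1 + t *\<^sub>R axis j 1 \<in> S"
      using inS[of s t] s t h b by (auto simp: algebra_simps)
  qed
  then obtain t where t: "0 < t" "t < h"
    "?Q h - ?Q 0 = h * (pdiff j (pdiff i f) (x + s *\<^sub>R axis i 1 + t *\<^sub>R axis j 1))"
    by auto
  show ?thesis
  proof
    show "x + s *\<^sub>R axis i 1 + t *\<^sub>R axis j 1 \<in> cball x (2 * h)" using inS s t by simp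
    show "f (x + h *\<^sub>R axis i 1 + h *\<^sub>R axis j 1) - f (x + h *\<^sub>R axis i 1)
            - f (x + h *\<^sub>R axis j 1) + f x
        = h\<^sup>2 * pdiff j (pdiff i f) (x + s *\<^sub>R axis i 1 + t *\<^sub>R axis j 1)"
      using s(3) t(3) by (simp add: power2_eq_square algebra_simps)
  qed
qed

lemma pdiff_commute_real:
  fixes f :: "real^2 \<Rightarrow> real"
  assumes S: "open S" and f: "smooth_on S f" and x: "x \<in> S"
  shows "pdiff i (pdiff j f) x = pdiff j (pdiff i f) x"
proof -
  have "continuous_on S (pdiff i (pdiff j f))" "continuous_on S (pdiff j (pdiff i f))"
    using f by (auto intro!: smooth_on_continuous smooth_on_pdiff)
  then have c: "isCont (pdiff i (pdiff j f)) x" "isCont (pdiff j (pdiff i f)) x"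
    using S x continuous_on_eq_continuous_at by blast+
  obtain r where r: "r > 0" "cball x r \<subseteq> S" using S x open_contains_cball by metis
  show ?thesis
  proof (rule ccontr)
    assume ne: "\<not> ?thesis"
    define e where "e = \<bar>pdiff i (pdiff j f) x - pdiff j (pdiff i f) x\<bar> / 2"
    have e: "e > 0" using ne by (simp add: e_def)
    obtain d1 where d1: "d1 > 0" "\<And>y. dist y x < d1 \<Longrightarrow> \<bar>pdiff i (pdiff j f) y - pdiff i (pdiff j f) x\<bar> < e"
      using c(1) e unfolding continuous_at_eps_delta by (metis dist_real_def)
    obtain d2 where d2: "d2 > 0" "\<And>y. dist y x < d2 \<Longrightarrow> \<bar>pdiff j (pdiff i f) y - pdiff j (pdiff i f) x\<bar> < e"
      using c(2) e unfolding continuous_at_eps_delta by (metis dist_real_def)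
    define h where "h = min r (min d1 d2) / 4"
    have h: "h > 0" "2 * h < d1" "2 * h < d2" "2 * h \<le> r" using r d1 d2 by (auto simp: h_def)
    have b: "cball x (2 * h) \<subseteq> S" using r(2) subset_cball[OF h(4)] by blast
    obtain y where y: "y \<in> cball x (2 * h)" "f (x + h *\<^sub>R axis i 1 + h *\<^sub>R axis j 1) - f (x + h *\<^sub>R axis i 1)
            - f (x + h *\<^sub>R axis j 1) + f x = h\<^sup>2 * pdiff j (pdiff i f) y"
      using second_difference[OF S f b h(1), of i j] by blast
    obtain z where z: "z \<in> cball x (2 * h)" "f (x + h *\<^sub>R axis j 1 + h *\<^sub>R axis i 1) - f (x + h *\<^sub>R axis j 1)
            - f (x + h *\<^sub>R axis i 1) + f x = h\<^sup>2 * pdiff i (pdiff j f) z"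
      using second_difference[OF S f b h(1), of j i] by blast
    have "h\<^sup>2 * pdiff j (pdiff i f) y = h\<^sup>2 * pdiff i (pdiff j f) z"
      using y(2) z(2) by (simp add: algebra_simps)
    then have "pdiff j (pdiff i f) y = pdiff i (pdiff j f) z" using h(1) by simp
    moreover have "\<bar>pdiff j (pdiff i f) y - pdiff j (pdiff i f) x\<bar> < e"
      using d2(2)[of y] y(1) h by (simp add: dist_commute)
    moreover have "\<bar>pdiff i (pdiff j f) z - pdiff i (pdiff j f) x\<bar> < e"
      using d1(2)[of z] z(1) h by (simp add: dist_commute)
    ultimately have "\<bar>pdiff i (pdiff j f) x - pdiff j (pdiff i f) x\<bar> < e + e" by linarith
    then show False by (simp add: e_def)
  qed
qed

lemma pdiff_commute:
  fixes f :: "real^2 \<Rightarrow> 'b::real_inner"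
  assumes S: "open S" and f: "smooth_on S f" and x: "x \<in> S"
  shows "pdiff i (pdiff j f) x = pdiff j (pdiff i f) x"
proof -
  have "pdiff i (pdiff j f) x \<bullet> b = pdiff j (pdiff i f) x \<bullet> b" for b
  proof -
    have lin: "bounded_linear (\<lambda>u. u \<bullet> b)" by (rule bounded_linear_inner_left)
    have p: "pdiff k (\<lambda>y. q y \<bullet> b) y = pdiff k q y \<bullet> b" if "smooth_on S q" "y \<in> S" for k q y
      using pdiff_linear(1)[OF lin smooth_on_differentiable[OF that]] .
    have eq: "pdiff k (pdiff l (\<lambda>y. f y \<bullet> b)) x = pdiff k (pdiff l f) x \<bullet> b" for k l
    proof -
      have "pdiff k (pdiff l (\<lambda>y. f y \<bullet> b)) x = pdiff k (\<lambda>y. pdiff l f y \<bullet> b) x"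
        by (rule pdiff_cong[OF S x]) (rule p[OF f])
      also have "\<dots> = pdiff k (pdiff l f) x \<bullet> b"
        by (rule p[OF smooth_on_pdiff[OF f] x])
      finally show ?thesis .
    qed
    show ?thesis
      by (rule pdiff_commute_real[OF S smooth_on_linear[OF S lin f] x, of i j, unfolded eq])
  qed
  then show ?thesis using vector_eq_rdot by blast
qed

section \<open>Surfaces in the light cone\<close>

lemma lorentz_bound: "\<bar>lorentz x y\<bar> \<le> 4 * (norm x * norm y)"
proof -
  have m: "\<bar>x $ i * y $ i\<bar> \<le> norm x * norm y" for i
    using mult_mono[OF component_le_norm_cart component_le_norm_cart] by (simp add: abs_mult)
  show ?thesis
    using m[of 1] m[of 2] m[of 3] m[of 4] unfolding lorentz_def by linarith
qed

lemma bounded_bilinear_lorentz: "bounded_bilinear lorentz"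
proof unfold_locales
  show "\<exists>K. \<forall>a b. norm (lorentz a b) \<le> norm a * norm b * K"
    using lorentz_bound by (intro exI[of _ 4]) (simp add: mult.commute)
qed (simp_all add: lorentz_def algebra_simps)

interpretation lorentz: bounded_bilinear lorentz
  by (rule bounded_bilinear_lorentz)

lemma lorentz_sym: "lorentz x y = lorentz y x"
  by (simp add: lorentz_def mult.commute)

lemmas lorentz_simps = lorentz.add_left lorentz.add_right lorentz.scaleR_left lorentz.scaleR_right
  lorentz.diff_left lorentz.diff_right lorentz.minus_left lorentz.minus_right
  lorentz.zero_left lorentz.zero_right

text \<open>
  A spacelike pair together with a null pair of the complementary Lorentzian plane is a basis, so
  that the products with these four vectors determine a vector.
\<close>

lemma lorentz_frame_complete:
  assumes det: "lorentz a a * lorentz b b - lorentz a b * lorentz a b \<noteq> 0"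
    and orth: "lorentz a f = 0" "lorentz b f = 0" "lorentz a n = 0" "lorentz b n = 0"
    and null: "lorentz f f = 0" "lorentz n n = 0" "lorentz f n = -1"
    and w: "lorentz w a = 0" "lorentz w b = 0" "lorentz w f = 0" "lorentz w n = 0"
  shows "w = 0"
proof -
  define L :: "real^4 \<Rightarrow> real^4"
    where "L y = (\<chi> i. lorentz y (if i = 1 then a else if i = 2 then b else if i = 3 then f else n))" for y
  have L: "linear L"
    by (rule linearI) (simp_all add: L_def vec_eq_iff lorentz_simps)
  have "t \<in> range L" for t
  proof -
    define d where "d = lorentz a a * lorentz b b - lorentz a b * lorentz a b"
    define p where "p = (t $ 1 * lorentz b b - t $ 2 * lorentz a b) / d"
    define q where "q = (t $ 2 * lorentz a a - t $ 1 * lorentz a b) / d"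
    have d: "d \<noteq> 0" using det by (simp add: d_def)
    have "p * lorentz a a + q * lorentz b a = t $ 1 * d / d"
      unfolding p_def q_def lorentz_sym[of b a] add_divide_distrib[symmetric] times_divide_eq_left
      by (simp add: d_def algebra_simps diff_divide_distrib add_divide_distrib)
    moreover have "p * lorentz a b + q * lorentz b b = t $ 2 * d / d"
      unfolding p_def q_def lorentz_sym[of b a] add_divide_distrib[symmetric] times_divide_eq_left
      by (simp add: d_def algebra_simps diff_divide_distrib add_divide_distrib)
    ultimately have "t = L (p *\<^sub>R a + q *\<^sub>R b - t $ 4 *\<^sub>R f - t $ 3 *\<^sub>R n)"
      using d orth null lorentz_sym[of n f] lorentz_sym[of f a] lorentz_sym[of f b] lorentz_sym[of n a] lorentz_sym[of n b]
      by (simp add: L_def vec_eq_iff forall_4 lorentz_simps)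
    then show ?thesis by (rule image_eqI) simp
  qed
  then have "surj L" by blast
  then have "inj L" by (rule linear_surjective_imp_injective[OF L]) simp_all
  moreover have "L w = L 0" using w by (simp add: L_def vec_eq_iff lorentz_simps)
  ultimately show ?thesis by (rule injD)
qed

lemma metric_inner_2: "metric_inner M v w = (\<Sum>i\<in>UNIV. \<Sum>j\<in>UNIV. v $ i * M $ i $ j * w $ j)"
  by (simp add: metric_inner_def inner_vec_def matrix_vector_mult_def sum_distrib_left mult.assoc)

lemma metric_inner_posdef_det:
  fixes M :: "real^2^2"
  assumes sym: "transpose M = M" and pos: "\<And>v. v \<noteq> 0 \<Longrightarrow> 0 < metric_inner M v v"
  shows "0 < det M"
proof -
  have s: "M $ 2 $ 1 = M $ 1 $ 2" using arg_cong[OF sym, of "\<lambda>N. N $ 1 $ 2"] by (simp add: transpose_def)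
  have "0 < metric_inner M (axis 1 1) (axis 1 1)" by (rule pos) (simp add: axis_eq_0_iff)
  then have p: "0 < M $ 1 $ 1" by (simp add: metric_inner_2 sum_2 axis_def)
  define v :: "real^2" where "v = (\<chi> i. if i = 1 then - M $ 1 $ 2 else M $ 1 $ 1)"
  have "v $ 2 \<noteq> 0" using p by (simp add: v_def)
  then have "v \<noteq> 0" by auto
  then have "0 < metric_inner M v v" by (rule pos)
  also have "metric_inner M v v = M $ 1 $ 1 * det M"
    by (simp add: metric_inner_2 sum_2 v_def det_2 s algebra_simps)
  finally show ?thesis using p by (simp add: zero_less_mult_iff)
qed

lemma matrix_inv_mult:
  fixes M :: "real^2^2"
  assumes "det M \<noteq> 0"
  shows "M ** matrix_inv M = mat 1" "matrix_inv M ** M = mat 1"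
proof -
  have "\<exists>N. M ** N = mat 1 \<and> N ** M = mat 1"
    using assms by (simp add: invertible_det_nz[symmetric] invertible_def)
  then have "M ** matrix_inv M = mat 1 \<and> matrix_inv M ** M = mat 1"
    unfolding matrix_inv_def by (rule someI_ex)
  then show "M ** matrix_inv M = mat 1" "matrix_inv M ** M = mat 1" by auto
qed

lemma matrix_inv_2:
  fixes M :: "real^2^2"
  assumes "det M \<noteq> 0"
  shows "matrix_inv M $ 1 $ 1 = M $ 2 $ 2 / det M" "matrix_inv M $ 1 $ 2 = - M $ 1 $ 2 / det M"
    "matrix_inv M $ 2 $ 1 = - M $ 2 $ 1 / det M" "matrix_inv M $ 2 $ 2 = M $ 1 $ 1 / det M"
proof -
  define N :: "real^2^2" where "N = (\<chi> i j. (if i = 1 then (if j = 1 then M $ 2 $ 2 else - M $ 1 $ 2)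
     else (if j = 1 then - M $ 2 $ 1 else M $ 1 $ 1)) / det M)"
  have d: "M $ 1 $ 1 * M $ 2 $ 2 - M $ 1 $ 2 * M $ 2 $ 1 = det M" by (simp add: det_2)
  have "M ** N = mat 1"
    using assms d
    by (auto simp: vec_eq_iff forall_2 matrix_matrix_mult_def sum_2 N_def mat_def
        add_divide_distrib[symmetric] diff_divide_distrib[symmetric] algebra_simps)
  moreover have "matrix_inv M ** M = mat 1"
    by (rule matrix_inv_mult[OF assms])
  ultimately have "matrix_inv M = N"
    by (metis matrix_mul_assoc matrix_mul_lid matrix_mul_rid)
  then show "matrix_inv M $ 1 $ 1 = M $ 2 $ 2 / det M" "matrix_inv M $ 1 $ 2 = - M $ 1 $ 2 / det M"
    "matrix_inv M $ 2 $ 1 = - M $ 2 $ 1 / det M" "matrix_inv M $ 2 $ 2 = M $ 1 $ 1 / det M"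
    by (simp_all add: N_def)
qed

lemma matrix_inv_contract:
  fixes M :: "real^2^2"
  assumes "det M \<noteq> 0"
  shows "(\<Sum>j\<in>UNIV. matrix_inv M $ i $ j * M $ j $ k) = (if i = k then 1 else 0)"
  using arg_cong[OF matrix_inv_mult(2)[OF assms], of "\<lambda>N. N $ i $ k"]
  by (simp add: matrix_matrix_mult_def mat_def)

lemma kronecker_2: "(\<Sum>m\<in>UNIV. (if m = l then 1 else 0) * f m) = f (l::2)" for f :: "2 \<Rightarrow> real"
  using exhaust_2[of l] by (auto simp: sum_2)

locale null_cone_patch =
  fixes F :: "real^2 \<Rightarrow> real^4" and S :: "(real^2) set"
  assumes open_S: "open S" and smooth: "smooth_on S F"
    and cone: "x \<in> S \<Longrightarrow> F x \<in> future_light_cone"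
    and posdef: "x \<in> S \<Longrightarrow> v \<noteq> 0 \<Longrightarrow> 0 < metric_inner (induced_metric F x) v v"
begin

abbreviation "G \<equiv> induced_metric F"
abbreviation "D i \<equiv> pdiff i F"
abbreviation "DD i j \<equiv> pdiff i (pdiff j F)"
abbreviation "gi i j x \<equiv> matrix_inv (G x) $ i $ j"
abbreviation "\<Gamma> \<equiv> christoffel G"

lemmas smooth_D = smooth_on_pdiff[OF smooth]
lemmas smooth_DD = smooth_on_pdiff[OF smooth_D]
lemmas smooth_lorentz = smooth_on_bilinear[OF open_S bounded_bilinear_lorentz]
lemmas diff_F = smooth_on_differentiable[OF smooth]
lemmas diff_D = smooth_on_differentiable[OF smooth_D]
lemmas diff_DD = smooth_on_differentiable[OF smooth_DD]
lemmas pdiff_lorentz = pdiff_bilinear(1)[OF bounded_bilinear_lorentz]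

lemma DD_sym: "x \<in> S \<Longrightarrow> DD i j x = DD j i x"
  by (rule pdiff_commute[OF open_S smooth])

lemma G_nth: "G x $ i $ j = lorentz (D i x) (D j x)"
  by (simp add: induced_metric_def)

lemma G_sym: "G x $ i $ j = G x $ j $ i"
  by (simp add: G_nth lorentz_sym)

lemma G_transpose: "transpose (G x) = G x"
  by (simp add: vec_eq_iff transpose_def G_sym)

lemma det_pos: "x \<in> S \<Longrightarrow> 0 < det (G x)"
  using metric_inner_posdef_det[OF G_transpose] posdef by blast

lemma det_nz: "x \<in> S \<Longrightarrow> det (G x) \<noteq> 0"
  using det_pos by fastforce

lemmas gi_G = matrix_inv_contract[OF det_nz]

lemma gi_sym: "x \<in> S \<Longrightarrow> gi i j x = gi j i x"
  using matrix_inv_2[OF det_nz] G_sym[of x 1 2] exhaust_2[of i] exhaust_2[of j] by auto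

lemma smooth_G: "smooth_on S (\<lambda>x. G x $ i $ j)"
  unfolding G_nth by (intro smooth_lorentz smooth_D)

lemma smooth_gi: "smooth_on S (gi i j)"
proof -
  have d: "smooth_on S (\<lambda>x. det (G x))"
    unfolding det_2 by (intro smooth_on_diff smooth_on_mult smooth_G open_S)
  have "smooth_on S (\<lambda>x. (if i = 1 then (if j = 1 then G x $ 2 $ 2 else - G x $ 1 $ 2)
     else (if j = 1 then - G x $ 2 $ 1 else G x $ 1 $ 1)) / det (G x))"
    by (intro smooth_on_divide open_S d det_nz)
       (cases "i = 1"; cases "j = 1"; simp add: smooth_G smooth_on_minus open_S)
  then show ?thesis
    by (rule iffD1[OF smooth_on_cong[OF open_S], rotated])
       (use matrix_inv_2[OF det_nz] exhaust_2[of i] exhaust_2[of j] in auto)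
qed

lemma pdiff_G:
  assumes "x \<in> S"
  shows "pdiff k (\<lambda>y. G y $ i $ j) x = lorentz (DD k i x) (D j x) + lorentz (D i x) (DD k j x)"
  unfolding G_nth by (simp add: pdiff_lorentz diff_D assms)

lemma christoffel_eq:
  assumes x: "x \<in> S"
  shows "\<Gamma> k i j x = (\<Sum>l\<in>UNIV. gi k l x * lorentz (DD i j x) (D l x))"
proof -
  have "pdiff i (\<lambda>y. G y $ j $ l) x + pdiff j (\<lambda>y. G y $ i $ l) x - pdiff l (\<lambda>y. G y $ i $ j) x
      = 2 * lorentz (DD i j x) (D l x)" for l
    using DD_sym[OF x, of j i] DD_sym[OF x, of l i] DD_sym[OF x, of l j]
    by (simp add: pdiff_G[OF x] lorentz_sym)
  then show ?thesis
    by (simp add: christoffel_def sum_divide_distrib)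
qed

lemma smooth_christoffel: "smooth_on S (\<Gamma> k i j)"
proof -
  have "smooth_on S (\<lambda>x. \<Sum>l\<in>UNIV. gi k l x * lorentz (DD i j x) (D l x))"
    by (intro smooth_on_sum_2 smooth_on_mult open_S smooth_gi smooth_lorentz smooth_DD smooth_D)
  then show ?thesis
    by (rule iffD1[OF smooth_on_cong[OF open_S], rotated]) (simp add: christoffel_eq)
qed

lemma christoffel_lower:
  assumes x: "x \<in> S"
  shows "(\<Sum>k\<in>UNIV. \<Gamma> k i j x * G x $ k $ l) = lorentz (DD i j x) (D l x)"
proof -
  have "(\<Sum>k\<in>UNIV. \<Gamma> k i j x * G x $ k $ l)
      = (\<Sum>m\<in>UNIV. (\<Sum>k\<in>UNIV. gi m k x * G x $ k $ l) * lorentz (DD i j x) (D m x))"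
    by (simp add: christoffel_eq[OF x] sum_2 gi_sym[OF x, of 2 1] algebra_simps)
  then show ?thesis by (simp only: gi_G[OF x] kronecker_2)
qed

lemma F_null: "x \<in> S \<Longrightarrow> lorentz (F x) (F x) = 0"
  using cone by (simp add: future_light_cone_def)

lemma D_F: assumes "x \<in> S" shows "lorentz (D i x) (F x) = 0"
proof -
  have "pdiff i (\<lambda>y. lorentz (F y) (F y)) x = pdiff i (\<lambda>y. 0) x"
    by (rule pdiff_cong[OF open_S assms]) (rule F_null)
  then show ?thesis
    using assms by (simp add: pdiff_lorentz diff_F pdiff_const lorentz_sym)
qed

lemma DD_F: assumes "x \<in> S" shows "lorentz (DD i j x) (F x) = - G x $ i $ j"
proof -
  have "pdiff i (\<lambda>y. lorentz (D j y) (F y)) x = pdiff i (\<lambda>y. 0) x"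
    by (rule pdiff_cong[OF open_S assms]) (rule D_F)
  then show ?thesis
    using assms by (simp add: pdiff_lorentz diff_F diff_D pdiff_const G_nth lorentz_sym)
qed

lemma frechet_F: "x \<in> S \<Longrightarrow> frechet_derivative F (at x) v = (\<Sum>i\<in>UNIV. v $ i *\<^sub>R D i x)"
  by (rule frechet_derivative_pdiff[OF diff_F])

lemma metric_inner_G:
  assumes "x \<in> S"
  shows "metric_inner (G x) v w
     = lorentz (frechet_derivative F (at x) v) (frechet_derivative F (at x) w)"
  by (simp add: frechet_F[OF assms] metric_inner_2 sum_2 G_nth lorentz_simps algebra_simps)

lemma frechet_F_orth_imp:
  assumes x: "x \<in> S" and o: "\<And>i. lorentz (frechet_derivative F (at x) v) (D i x) = 0"
  shows "v = 0"
proof (rule ccontr)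
  assume "v \<noteq> 0"
  then have "0 < metric_inner (G x) v v" using posdef x by blast
  also have "metric_inner (G x) v v = 0"
    unfolding metric_inner_G[OF x]
    using o by (simp add: frechet_F[OF x, of v] sum_2 lorentz_simps)
  finally show False by simp
qed

lemma tangent_part_eq:
  assumes x: "x \<in> S"
  shows "tangent_part F x u
     = frechet_derivative F (at x) (\<chi> j. \<Sum>i\<in>UNIV. gi j i x * lorentz u (D i x))"
    (is "_ = frechet_derivative F (at x) ?c")
proof -
  have lin: "linear (frechet_derivative F (at x))"
    by (rule linear_frechet_derivative[OF diff_F[OF x]])
  have *: "lorentz (frechet_derivative F (at x) ?c) (D l x) = lorentz u (D l x)" for l
  proof -
    have "lorentz (frechet_derivative F (at x) ?c) (D l x)
        = (\<Sum>i\<in>UNIV. (\<Sum>j\<in>UNIV. gi i j x * G x $ j $ l) * lorentz u (D i x))"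
      by (simp add: frechet_F[OF x] sum_2 lorentz_simps G_nth gi_sym[OF x, of 2 1] algebra_simps)
    then show ?thesis by (simp only: gi_G[OF x] kronecker_2)
  qed
  have o: "(\<forall>s\<in>tangent_plane F x. lorentz w s = 0) \<longleftrightarrow> (\<forall>l. lorentz w (D l x) = 0)" for w
  proof
    assume a: "\<forall>s\<in>tangent_plane F x. lorentz w s = 0"
    have "D l x \<in> tangent_plane F x" for l
      unfolding tangent_plane_def pdiff_def by blast
    then show "\<forall>l. lorentz w (D l x) = 0" using a by blast
  next
    assume "\<forall>l. lorentz w (D l x) = 0"
    then show "\<forall>s\<in>tangent_plane F x. lorentz w s = 0"
      by (auto simp: tangent_plane_def frechet_F[OF x] sum_2 lorentz_simps)
  qed
  show ?thesis
    unfolding tangent_part_def o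
  proof (rule the_equality)
    show "frechet_derivative F (at x) ?c \<in> tangent_plane F x \<and>
      (\<forall>l. lorentz (u - frechet_derivative F (at x) ?c) (D l x) = 0)"
      using * by (simp add: tangent_plane_def lorentz_simps)
  next
    fix t assume t: "t \<in> tangent_plane F x \<and> (\<forall>l. lorentz (u - t) (D l x) = 0)"
    then obtain c where c: "t = frechet_derivative F (at x) c" by (auto simp: tangent_plane_def)
    have d: "frechet_derivative F (at x) (c - ?c) = t - frechet_derivative F (at x) ?c"
      using c linear_diff[OF lin, of c ?c] by simp
    have "c - ?c = 0"
    proof (rule frechet_F_orth_imp[OF x])
      fix i
      show "lorentz (frechet_derivative F (at x) (c - ?c)) (D i x) = 0"
        using t *[of i] unfolding d by (simp add: lorentz_simps)
    qed
    then show "t = frechet_derivative F (at x) ?c" using c by simp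
  qed
qed

lemma null_expansion_eq:
  assumes x: "x \<in> S"
  shows "null_expansion F \<zeta> x
    = (\<Sum>j\<in>UNIV. \<Sum>i\<in>UNIV. gi j i x * lorentz (pdiff j \<zeta> x) (D i x)) / 2"
proof -
  have lin: "linear (frechet_derivative F (at x))"
    by (rule linear_frechet_derivative[OF diff_F[OF x]])
  have inj: "a = b" if "frechet_derivative F (at x) a = frechet_derivative F (at x) b" for a b
  proof -
    have "a - b = 0"
      by (rule frechet_F_orth_imp[OF x]) (simp add: linear_diff[OF lin] that lorentz_simps)
    then show ?thesis by simp
  qed
  have "weingarten F \<zeta> x v = (\<chi> j. \<Sum>i\<in>UNIV. gi j i x * lorentz (frechet_derivative \<zeta> (at x) v) (D i x))" for v
    unfolding weingarten_def tangent_part_eq[OF x] by (rule the_equality) (auto intro: inj)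
  then show ?thesis
    by (simp add: null_expansion_def trace_def matrix_def pdiff_def)
qed

lemma null_expansion_position: "x \<in> S \<Longrightarrow> null_expansion F F x = 1"
proof -
  assume x: "x \<in> S"
  have "(\<Sum>i\<in>UNIV. gi j i x * lorentz (D j x) (D i x)) = 1" for j
    using gi_G[OF x, of j j] by (simp add: G_nth lorentz_sym[of "D j x"])
  then show ?thesis by (simp add: null_expansion_eq[OF x])
qed


lemma normal_part_orth:
  assumes x: "x \<in> S"
  shows "lorentz (normal_part F x u) (D l x) = 0"
proof -
  have "lorentz (tangent_part F x u) (D l x)
      = (\<Sum>i\<in>UNIV. (\<Sum>j\<in>UNIV. gi i j x * G x $ j $ l) * lorentz u (D i x))"
    by (simp add: tangent_part_eq[OF x] frechet_F[OF x] sum_2 lorentz_simps G_nth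
        gi_sym[OF x, of 2 1] algebra_simps)
  also have "\<dots> = lorentz u (D l x)" by (simp only: gi_G[OF x] kronecker_2)
  finally show ?thesis by (simp add: normal_part_def lorentz_simps)
qed

abbreviation "\<eta> \<equiv> null_eta F"
abbreviation "u \<equiv> height F"

lemma height_pos: "x \<in> S \<Longrightarrow> 0 < u x"
  using cone[of x] by (simp add: future_light_cone_def height_def e1_def lorentz_def axis_def)

lemma smooth_height: "smooth_on S u"
  unfolding height_def by (intro smooth_on_minus smooth_lorentz smooth smooth_on_const open_S)

text \<open>The differential of the height \<open>- \<langle>F, e1\<rangle>\<close> is the product with \<open>- e1\<close>.\<close>

lemma tangent_e1_gradient:
  assumes x: "x \<in> S"
  shows "tangent_part F x e1 = - frechet_derivative F (at x) (gradient G u x)"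
proof -
  have "pdiff i u x = - lorentz e1 (D i x)" for i
  proof -
    have "pdiff i (\<lambda>y. - lorentz (F y) e1) x = - lorentz (D i x) e1"
      by (rule pdiff_linear(1)[OF bounded_linear_minus[OF lorentz.bounded_linear_left] diff_F[OF x]])
    then show ?thesis
      by (simp add: height_def[abs_def] lorentz_sym)
  qed
  then have "(\<chi> j. \<Sum>i\<in>UNIV. gi j i x * lorentz e1 (D i x)) = - gradient G u x"
    by (simp add: gradient_def matrix_vector_mult_def vec_eq_iff sum_2)
  then show ?thesis
    unfolding tangent_part_eq[OF x]
    using linear_neg[OF linear_frechet_derivative[OF diff_F[OF x]]] by simp
qed

lemma null_eta_eq:
  assumes x: "x \<in> S"
  shows "\<eta> x = (- (1 + lorentz (tangent_part F x e1) (tangent_part F x e1)) / (2 * (u x)\<^sup>2)) *\<^sub>R F x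
     + (1 / u x) *\<^sub>R normal_part F x e1"
  by (simp add: null_eta_def Let_def metric_inner_G[OF x] tangent_e1_gradient[OF x] lorentz_simps)

lemma smooth_null_eta: "smooth_on S \<eta>"
proof -
  have t: "smooth_on S (\<lambda>x. tangent_part F x e1)"
  proof -
    have "smooth_on S (\<lambda>x. \<Sum>j\<in>UNIV. (\<Sum>i\<in>UNIV. gi j i x * lorentz e1 (D i x)) *\<^sub>R D j x)"
      by (intro smooth_on_sum_2 smooth_on_scaleR smooth_on_mult smooth_gi smooth_lorentz
          smooth_on_const smooth_D open_S)
    then show ?thesis
      by (rule iffD1[OF smooth_on_cong[OF open_S], rotated])
        (simp add: tangent_part_eq frechet_F)
  qed
  have "smooth_on S (\<lambda>x. (- (1 + lorentz (tangent_part F x e1) (tangent_part F x e1))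
        / (2 * (u x * u x))) *\<^sub>R F x + (1 / u x) *\<^sub>R (e1 - tangent_part F x e1))"
    by (intro smooth_on_add smooth_on_scaleR smooth_on_divide smooth_on_minus smooth_on_mult
        smooth_on_diff smooth_lorentz smooth_on_const t smooth smooth_height open_S)
      (use height_pos in force)+
  then show ?thesis
    by (rule iffD1[OF smooth_on_cong[OF open_S], rotated])
      (simp add: null_eta_eq normal_part_def power2_eq_square)
qed

text \<open>
  The normal part \<open>n\<close> of \<open>e1\<close> satisfies \<open>\<langle>n, n\<rangle> = - 1 - |\<nabla>u|\<^sup>2\<close> and \<open>\<langle>n, F\<rangle> = - u\<close>; the coefficient of
  \<open>F\<close> in the definition of \<open>\<eta>\<close> is the one that makes the combination null.
\<close>

lemma null_eta_frame:
  assumes x: "x \<in> S"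
  shows eta_D: "lorentz (D i x) (\<eta> x) = 0"
    and F_eta: "lorentz (F x) (\<eta> x) = -1"
    and eta_null: "lorentz (\<eta> x) (\<eta> x) = 0"
proof -
  define t where "t = tangent_part F x e1"
  define n where "n = normal_part F x e1"
  have n: "n = e1 - t" by (simp add: n_def t_def normal_part_def)
  have u0: "u x \<noteq> 0" using height_pos[OF x] by simp
  have tD: "t = (\<Sum>j\<in>UNIV. (\<Sum>i\<in>UNIV. gi j i x * lorentz e1 (D i x)) *\<^sub>R D j x)"
    by (simp add: t_def tangent_part_eq[OF x] frechet_F[OF x])
  have nD: "lorentz n (D i x) = 0" for i
    unfolding n_def by (rule normal_part_orth[OF x])
  have nt: "lorentz n t = 0" unfolding tD using nD by (simp add: sum_2 lorentz_simps)
  have tF: "lorentz t (F x) = 0" unfolding tD using D_F[OF x] by (simp add: sum_2 lorentz_simps)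
  have nF: "lorentz n (F x) = - u x"
    using tF by (simp add: n lorentz_simps height_def lorentz_sym)
  have "lorentz e1 e1 = -1" by (simp add: lorentz_def e1_def axis_def)
  then have nn: "lorentz n n = -1 - lorentz t t"
    using nt by (simp add: n lorentz_simps lorentz_sym[of t e1])
  define c where "c = - (1 + lorentz t t) / (2 * (u x)\<^sup>2)"
  have eta: "\<eta> x = c *\<^sub>R F x + (1 / u x) *\<^sub>R n"
    by (simp add: null_eta_eq[OF x] c_def t_def n_def)
  show "lorentz (D i x) (\<eta> x) = 0"
    using nD[of i] D_F[OF x, of i] by (simp add: eta lorentz_simps lorentz_sym[of _ n])
  show "lorentz (F x) (\<eta> x) = -1"
    using nF F_null[OF x] u0 by (simp add: eta lorentz_simps lorentz_sym[of _ n])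
  have "lorentz (\<eta> x) (\<eta> x) = - 2 * c + lorentz n n / (u x)\<^sup>2"
    using nF F_null[OF x] u0
    by (simp add: eta lorentz_simps lorentz_sym[of "F x" n] power2_eq_square diff_divide_distrib)
  also have "\<dots> = 0" unfolding nn c_def using u0 by (simp add: divide_simps)
  finally show "lorentz (\<eta> x) (\<eta> x) = 0" .
qed

abbreviation "h i j x \<equiv> - lorentz (DD i j x) (\<eta> x)"
abbreviation "trh x \<equiv> \<Sum>i\<in>UNIV. \<Sum>j\<in>UNIV. gi i j x * h i j x"

lemma frame_complete:
  assumes x: "x \<in> S" and "\<And>i. lorentz w (D i x) = 0" "lorentz w (F x) = 0" "lorentz w (\<eta> x) = 0"
  shows "w = 0"
proof (rule lorentz_frame_complete[where a = "D 1 x" and b = "D 2 x" and f = "F x" and n = "\<eta> x"])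
  show "lorentz (D 1 x) (D 1 x) * lorentz (D 2 x) (D 2 x) - lorentz (D 1 x) (D 2 x) * lorentz (D 1 x) (D 2 x) \<noteq> 0"
    using det_nz[OF x] by (simp add: det_2 G_nth lorentz_sym)
qed (use assms D_F[OF x] null_eta_frame[OF x] F_null[OF x] in auto)

text \<open>
  Both sides have the same products with the frame. Differentiating \<open>\<langle>D j, F\<rangle> = 0\<close> gives
  \<open>\<langle>DD i j, F\<rangle> = - G\<^sub>i\<^sub>j\<close>, which is why the coefficient of \<open>\<eta>\<close> is the metric itself.
\<close>

lemma gauss_formula:
  assumes x: "x \<in> S"
  shows "DD i j x = (\<Sum>k\<in>UNIV. \<Gamma> k i j x *\<^sub>R D k x) + h i j x *\<^sub>R F x + G x $ i $ j *\<^sub>R \<eta> x"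
proof -
  have "DD i j x - ((\<Sum>k\<in>UNIV. \<Gamma> k i j x *\<^sub>R D k x) + h i j x *\<^sub>R F x + G x $ i $ j *\<^sub>R \<eta> x) = 0"
  proof (rule frame_complete[OF x])
    show "lorentz (DD i j x - ((\<Sum>k\<in>UNIV. \<Gamma> k i j x *\<^sub>R D k x) + h i j x *\<^sub>R F x + G x $ i $ j *\<^sub>R \<eta> x)) (D l x) = 0" for l
      using christoffel_lower[OF x, of i j l, symmetric] D_F[OF x, of l] eta_D[OF x, of l]
      by (simp add: sum_2 lorentz_simps G_nth lorentz_sym[of "F x"] lorentz_sym[of "\<eta> x"])
    show "lorentz (DD i j x - ((\<Sum>k\<in>UNIV. \<Gamma> k i j x *\<^sub>R D k x) + h i j x *\<^sub>R F x + G x $ i $ j *\<^sub>R \<eta> x)) (F x) = 0"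
      using DD_F[OF x] D_F[OF x] F_eta[OF x] F_null[OF x]
      by (simp add: sum_2 lorentz_simps lorentz_sym[of "\<eta> x"])
    show "lorentz (DD i j x - ((\<Sum>k\<in>UNIV. \<Gamma> k i j x *\<^sub>R D k x) + h i j x *\<^sub>R F x + G x $ i $ j *\<^sub>R \<eta> x)) (\<eta> x) = 0"
      using eta_D[OF x] eta_null[OF x] F_eta[OF x] by (simp add: sum_2 lorentz_simps)
  qed
  then show ?thesis by simp
qed

lemma null_expansion_eta: "x \<in> S \<Longrightarrow> null_expansion F \<eta> x = trh x / 2"
proof -
  assume x: "x \<in> S"
  have "lorentz (pdiff j \<eta> x) (D i x) = h j i x" for i j
  proof -
    have "pdiff j (\<lambda>y. lorentz (D i y) (\<eta> y)) x = pdiff j (\<lambda>y. 0) x"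
      by (rule pdiff_cong[OF open_S x]) (rule eta_D)
    then show ?thesis
      using x smooth_on_differentiable[OF smooth_null_eta x]
      by (simp add: pdiff_lorentz diff_D pdiff_const lorentz_sym)
  qed
  then show ?thesis by (simp add: null_expansion_eq[OF x])
qed

text \<open>
  Differentiating \<open>\<Gamma>\<^sup>l\<^sub>i\<^sub>j G\<^sub>l\<^sub>1 = \<langle>DD i j, D 1\<rangle>\<close> expresses the derivatives of the Christoffel symbols by
  third derivatives of \<open>F\<close>, which cancel in the curvature by symmetry. What remains is
  \<open>\<langle>II\<^sub>1\<^sub>1, II\<^sub>2\<^sub>2\<rangle> - \<langle>II\<^sub>1\<^sub>2, II\<^sub>1\<^sub>2\<rangle>\<close> for the normal parts \<open>II\<^sub>i\<^sub>j = h\<^sub>i\<^sub>j F + G\<^sub>i\<^sub>j \<eta>\<close>.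
\<close>

lemma gauss_curvature_eq:
  assumes x: "x \<in> S"
  shows "gauss_curvature G x = - trh x"
proof -
  have dG: "(\<lambda>y. G y $ i $ j) differentiable at x" "\<Gamma> k i j differentiable at x" for i j k
    using smooth_on_differentiable[OF smooth_G x] smooth_on_differentiable[OF smooth_christoffel x] by auto
  have *: "(\<Sum>l\<in>UNIV. G x $ 1 $ l * pdiff a (\<Gamma> l i j) x)
      = lorentz (pdiff a (DD i j) x) (D 1 x) + lorentz (DD i j x) (DD a 1 x)
        - (\<Sum>l\<in>UNIV. \<Gamma> l i j x * (lorentz (DD a l x) (D 1 x) + lorentz (D l x) (DD a 1 x)))" for a i j
  proof -
    have "pdiff a (\<lambda>y. \<Gamma> 1 i j y * G y $ 1 $ 1 + \<Gamma> 2 i j y * G y $ 2 $ 1) x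
        = pdiff a (\<lambda>y. lorentz (DD i j y) (D 1 y)) x"
      by (rule pdiff_cong[OF open_S x]) (use christoffel_lower[of _ i j 1] in \<open>simp add: sum_2\<close>)
    then show ?thesis
      using dG x G_sym[of x 1 2]
      by (simp add: pdiff_lorentz diff_DD diff_D pdiff_add pdiff_bilinear[OF bounded_bilinear_mult]
          pdiff_G[OF x] sum_2 algebra_simps)
  qed
  have D3: "pdiff 1 (DD 2 2) x = pdiff 2 (DD 1 2) x"
    by (rule pdiff_commute[OF open_S smooth_D x])
  have low: "lorentz (DD i j x) (D 1 x) = \<Gamma> 1 i j x * G x $ 1 $ 1 + \<Gamma> 2 i j x * G x $ 1 $ 2" for i j
    using christoffel_lower[OF x, of i j 1] G_sym[of x 2 1] by (simp add: sum_2)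
  have II: "lorentz (DD i j x) (DD k l x) = (\<Sum>m\<in>UNIV. \<Gamma> m i j x * lorentz (D m x) (DD k l x))
       - h i j x * G x $ k $ l - G x $ i $ j * h k l x" for i j k l
  proof -
    have "lorentz (DD i j x) (DD k l x) = lorentz ((\<Sum>k\<in>UNIV. \<Gamma> k i j x *\<^sub>R D k x)
          + h i j x *\<^sub>R F x + G x $ i $ j *\<^sub>R \<eta> x) (DD k l x)"
      using gauss_formula[OF x, of i j] by simp
    then show ?thesis
      using DD_F[OF x, of k l] by (simp add: sum_2 lorentz_simps lorentz_sym[of "F x"] lorentz_sym[of "\<eta> x"])
  qed
  have sy: "DD 2 1 x = DD 1 2 x" "G x $ 2 $ 1 = G x $ 1 $ 2"
    using DD_sym[OF x] G_sym by auto
  have "(\<Sum>l\<in>UNIV. G x $ 1 $ l * riemann G l 2 1 2 x)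
     = (\<Sum>l\<in>UNIV. G x $ 1 $ l * pdiff 1 (\<Gamma> l 2 2) x) - (\<Sum>l\<in>UNIV. G x $ 1 $ l * pdiff 2 (\<Gamma> l 1 2) x)
      + (\<Sum>m\<in>UNIV. \<Gamma> m 2 2 x * lorentz (DD 1 m x) (D 1 x) - \<Gamma> m 1 2 x * lorentz (DD 2 m x) (D 1 x))"
    unfolding low by (simp add: riemann_def sum_2 algebra_simps)
  also have "\<dots> = - (h 2 2 x * G x $ 1 $ 1 + h 1 1 x * G x $ 2 $ 2 - 2 * h 1 2 x * G x $ 1 $ 2)"
    unfolding * D3 by (simp add: II sy sum_2 algebra_simps)
  also have "\<dots> = - trh x * det (G x)"
    using det_nz[OF x] sy
    by (simp add: sum_2 matrix_inv_2 field_simps)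
  finally show ?thesis
    using det_nz[OF x] by (simp add: gauss_curvature_def)
qed

end

section \<open>Stereographic coordinates are harmonic\<close>

definition hess :: "(real^2 \<Rightarrow> real^2^2) \<Rightarrow> 2 \<Rightarrow> 2 \<Rightarrow> (real^2 \<Rightarrow> real) \<Rightarrow> real^2 \<Rightarrow> real" where
  "hess M i j f x = pdiff i (pdiff j f) x - (\<Sum>k\<in>UNIV. christoffel M k i j x * pdiff k f x)"

definition grad_inner :: "(real^2 \<Rightarrow> real^2^2) \<Rightarrow> (real^2 \<Rightarrow> real) \<Rightarrow> (real^2 \<Rightarrow> real) \<Rightarrow> real^2 \<Rightarrow> real" where
  "grad_inner M f k x = (\<Sum>i\<in>UNIV. \<Sum>j\<in>UNIV. matrix_inv (M x) $ i $ j * (pdiff i f x * pdiff j k x))"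

lemma laplacian_hess: "laplacian M f x = (\<Sum>i\<in>UNIV. \<Sum>j\<in>UNIV. matrix_inv (M x) $ i $ j * hess M i j f x)"
  by (simp add: laplacian_def hess_def)

lemma pdiff2_mult:
  fixes f k :: "real^2 \<Rightarrow> real"
  assumes S: "open S" "x \<in> S" and f: "smooth_on S f" and k: "smooth_on S k"
  shows "pdiff i (pdiff j (\<lambda>y. f y * k y)) x = f x * pdiff i (pdiff j k) x + pdiff i f x * pdiff j k x
     + pdiff j f x * pdiff i k x + pdiff i (pdiff j f) x * k x"
proof -
  note d = smooth_on_differentiable
  have "pdiff i (pdiff j (\<lambda>y. f y * k y)) x = pdiff i (\<lambda>y. f y * pdiff j k y + pdiff j f y * k y) x"
    by (rule pdiff_cong[OF S])
      (simp add: pdiff_bilinear(1)[OF bounded_bilinear_mult d[OF f] d[OF k]])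
  also have "\<dots> = pdiff i (\<lambda>y. f y * pdiff j k y) x + pdiff i (\<lambda>y. pdiff j f y * k y) x"
    using S(2) f k
    by (intro pdiff_add pdiff_bilinear(2)[OF bounded_bilinear_mult] d smooth_on_pdiff)
  also have "pdiff i (\<lambda>y. f y * pdiff j k y) x = f x * pdiff i (pdiff j k) x + pdiff i f x * pdiff j k x"
    using S(2) f k by (intro pdiff_bilinear(1)[OF bounded_bilinear_mult] d smooth_on_pdiff)
  also have "pdiff i (\<lambda>y. pdiff j f y * k y) x = pdiff j f x * pdiff i k x + pdiff i (pdiff j f) x * k x"
    using S(2) f k by (intro pdiff_bilinear(1)[OF bounded_bilinear_mult] d smooth_on_pdiff)
  finally show ?thesis by simp
qed

lemma pdiff_mult:
  fixes f k :: "real^2 \<Rightarrow> real"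
  assumes "x \<in> S" "smooth_on S f" "smooth_on S k"
  shows "pdiff i (\<lambda>y. f y * k y) x = f x * pdiff i k x + pdiff i f x * k x"
  using assms by (intro pdiff_bilinear(1)[OF bounded_bilinear_mult] smooth_on_differentiable)

context null_cone_patch
begin

lemma laplacian_mult:
  assumes x: "x \<in> S" and f: "smooth_on S f" and k: "smooth_on S k"
  shows "laplacian G (\<lambda>y. f y * k y) x = f x * laplacian G k x + 2 * grad_inner G f k x + k x * laplacian G f x"
  unfolding laplacian_def grad_inner_def
  by (simp add: pdiff2_mult[OF open_S x f k] pdiff_mult[OF x f k] sum_2 gi_sym[OF x, of 2 1] algebra_simps)

lemma grad_inner_mult:
  assumes x: "x \<in> S" and f: "smooth_on S f" and k: "smooth_on S k"
  shows "grad_inner G (\<lambda>y. f y * k y) q x = f x * grad_inner G k q x + k x * grad_inner G f q x"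
  unfolding grad_inner_def
  by (simp add: pdiff_mult[OF x f k] sum_2 algebra_simps)

lemma smooth_coordinate: "smooth_on S (\<lambda>y. lorentz (F y) \<nu>)"
  by (intro smooth_lorentz smooth smooth_on_const)

lemma pdiff_coordinate: "x \<in> S \<Longrightarrow> pdiff i (\<lambda>y. lorentz (F y) \<nu>) x = lorentz (D i x) \<nu>"
  by (simp add: pdiff_lorentz diff_F pdiff_const lorentz_simps)

lemma pdiff2_coordinate:
  assumes x: "x \<in> S"
  shows "pdiff i (pdiff j (\<lambda>y. lorentz (F y) \<nu>)) x = lorentz (DD i j x) \<nu>"
proof -
  have "pdiff i (pdiff j (\<lambda>y. lorentz (F y) \<nu>)) x = pdiff i (\<lambda>y. lorentz (D j y) \<nu>) x"
    by (rule pdiff_cong[OF open_S x]) (rule pdiff_coordinate)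
  then show ?thesis using x by (simp add: pdiff_lorentz diff_D pdiff_const lorentz_simps)
qed

lemma laplacian_coordinate:
  assumes x: "x \<in> S"
  shows "laplacian G (\<lambda>y. lorentz (F y) \<nu>) x = trh x * lorentz (F x) \<nu> + 2 * lorentz (\<eta> x) \<nu>"
proof -
  have *: "hess G i j (\<lambda>y. lorentz (F y) \<nu>) x = h i j x * lorentz (F x) \<nu> + G x $ i $ j * lorentz (\<eta> x) \<nu>" for i j
    unfolding hess_def pdiff2_coordinate[OF x] pdiff_coordinate[OF x]
    by (subst gauss_formula[OF x]) (simp add: sum_2 lorentz_simps)
  have "laplacian G (\<lambda>y. lorentz (F y) \<nu>) x = trh x * lorentz (F x) \<nu>
     + (\<Sum>i\<in>UNIV. \<Sum>j\<in>UNIV. gi i j x * G x $ j $ i) * lorentz (\<eta> x) \<nu>"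
    unfolding laplacian_hess * by (simp add: sum_2 G_sym[of x 2 1] algebra_simps)
  then show ?thesis by (simp add: gi_G[OF x])
qed

text \<open>
  The tangential part of \<open>\<nu>\<close> is \<open>\<nu> + \<langle>F, \<nu>\<rangle> \<eta> + \<langle>\<eta>, \<nu>\<rangle> F\<close>, since \<open>F\<close> and \<open>\<eta>\<close> are null with product \<open>- 1\<close>.
\<close>

lemma grad_inner_coordinates:
  assumes x: "x \<in> S"
  shows "grad_inner G (\<lambda>y. lorentz (F y) \<nu>) (\<lambda>y. lorentz (F y) \<rho>) x
     = lorentz \<nu> \<rho> + lorentz (F x) \<nu> * lorentz (\<eta> x) \<rho> + lorentz (F x) \<rho> * lorentz (\<eta> x) \<nu>"
proof -
  define w where "w = \<nu> + lorentz (F x) \<nu> *\<^sub>R \<eta> x + lorentz (\<eta> x) \<nu> *\<^sub>R F x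
     - (\<Sum>i\<in>UNIV. (\<Sum>j\<in>UNIV. gi i j x * lorentz (D j x) \<nu>) *\<^sub>R D i x)"
  note ortho = D_F[OF x] eta_D[OF x] F_eta[OF x] eta_null[OF x] F_null[OF x]
  have "w = 0"
  proof (rule frame_complete[OF x])
    show "lorentz w (D l x) = 0" for l
    proof -
      have "lorentz (\<Sum>i\<in>UNIV. (\<Sum>j\<in>UNIV. gi i j x * lorentz (D j x) \<nu>) *\<^sub>R D i x) (D l x)
        = (\<Sum>j\<in>UNIV. (\<Sum>i\<in>UNIV. gi j i x * G x $ i $ l) * lorentz (D j x) \<nu>)"
        by (simp add: sum_2 lorentz_simps G_nth gi_sym[OF x, of 2 1] algebra_simps)
      also have "\<dots> = lorentz (D l x) \<nu>" by (simp only: gi_G[OF x] kronecker_2)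
      finally show ?thesis
        using ortho by (simp add: w_def lorentz_simps lorentz_sym[of "F x" "D l x"]
            lorentz_sym[of "\<eta> x" "D l x"] lorentz_sym[of \<nu> "D l x"])
    qed
    show "lorentz w (F x) = 0" "lorentz w (\<eta> x) = 0"
      using ortho by (simp_all add: w_def sum_2 lorentz_simps lorentz_sym[of "\<eta> x" "F x"]
          lorentz_sym[of \<nu> "F x"] lorentz_sym[of \<nu> "\<eta> x"])
  qed
  then have "lorentz w \<rho> = 0" by (simp add: lorentz_simps)
  then show ?thesis
    unfolding grad_inner_def pdiff_coordinate[OF x]
    by (simp add: w_def sum_2 lorentz_simps gi_sym[OF x, of 2 1] algebra_simps)
qed

text \<open>
  With \<open>P = \<langle>F, p\<rangle>\<close>, \<open>Q = \<langle>F, \<nu>\<rangle>\<close>, the product rule for \<open>P = (P / Q) Q\<close> reduces the claim to the known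
  Laplacians and gradients of \<open>P\<close> and \<open>Q\<close>. The geometric reason is that \<open>P / Q\<close> is a stereographic
  coordinate on the sphere of null directions, hence part of a conformal coordinate system.
\<close>

lemma laplacian_stereographic:
  assumes x: "x \<in> S" and nz: "\<And>y. y \<in> S \<Longrightarrow> lorentz (F y) \<nu> \<noteq> 0"
    and \<nu>: "lorentz \<nu> \<nu> = 0" "lorentz p \<nu> = 0"
  shows "laplacian G (\<lambda>y. lorentz (F y) p / lorentz (F y) \<nu>) x = 0"
proof -
  let ?P = "\<lambda>y. lorentz (F y) p" and ?Q = "\<lambda>y. lorentz (F y) \<nu>" and ?e = "lorentz (\<eta> x)"
  define Z where "Z = (\<lambda>y. ?P y / ?Q y)"
  have sZ: "smooth_on S Z"
    unfolding Z_def by (intro smooth_on_divide smooth_coordinate open_S nz)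
  have PZ: "?P y = Z y * ?Q y" if "y \<in> S" for y using nz[OF that] by (simp add: Z_def)
  have dPZ: "pdiff i ?P y = pdiff i (\<lambda>y. Z y * ?Q y) y" if "y \<in> S" for i y
    by (rule pdiff_cong[OF open_S that PZ])
  have ddPZ: "pdiff i (pdiff j ?P) x = pdiff i (pdiff j (\<lambda>y. Z y * ?Q y)) x" for i j
    by (rule pdiff_cong[OF open_S x dPZ])
  have lP: "laplacian G ?P x = laplacian G (\<lambda>y. Z y * ?Q y) x"
    unfolding laplacian_def dPZ[OF x] ddPZ by (rule HOL.refl)
  have gP: "grad_inner G ?P ?Q x = grad_inner G (\<lambda>y. Z y * ?Q y) ?Q x"
    unfolding grad_inner_def dPZ[OF x] by (rule HOL.refl)
  have 1: "trh x * ?P x + 2 * ?e p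
      = Z x * (trh x * ?Q x + 2 * ?e \<nu>) + 2 * grad_inner G Z ?Q x + ?Q x * laplacian G Z x"
    using lP unfolding laplacian_mult[OF x sZ smooth_coordinate] laplacian_coordinate[OF x] .
  have 2: "?P x * ?e \<nu> + ?Q x * ?e p = Z x * (2 * ?Q x * ?e \<nu>) + ?Q x * grad_inner G Z ?Q x"
    using gP \<nu> unfolding grad_inner_mult[OF x sZ smooth_coordinate] grad_inner_coordinates[OF x]
    by (simp add: algebra_simps)
  have "?Q x * grad_inner G Z ?Q x = ?Q x * (?e p - Z x * ?e \<nu>)"
    using 2 unfolding PZ[OF x] by (simp add: algebra_simps)
  then have g: "grad_inner G Z ?Q x = ?e p - Z x * ?e \<nu>" using nz[OF x] by simp
  define T where "T = trh x"
  have "?Q x * laplacian G Z x = 0"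
    using 1 unfolding PZ[OF x] g T_def[symmetric] by (simp add: algebra_simps)
  then show ?thesis using nz[OF x] by (simp add: Z_def)
qed

text \<open>
  This is the Liouville equation: in stereographic coordinates the metric is \<open>\<langle>F, \<nu>\<rangle>\<^sup>2\<close> times the
  flat metric, and its curvature is \<open>- trh\<close> by \<open>gauss_curvature_eq\<close>.
\<close>

lemma laplacian_ln_height:
  assumes x: "x \<in> S" and pos: "\<And>y. y \<in> S \<Longrightarrow> lorentz (F y) \<nu> < 0"
    and \<nu>: "lorentz \<nu> \<nu> = 0"
  shows "laplacian G (\<lambda>y. ln (- lorentz (F y) \<nu>)) x = trh x"
proof -
  let ?Q = "\<lambda>y. lorentz (F y) \<nu>" and ?L = "\<lambda>y. ln (- lorentz (F y) \<nu>)"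
  let ?e = "lorentz (\<eta> x) \<nu>"
  have Q0: "?Q y \<noteq> 0" if "y \<in> S" for y using pos[OF that] by simp
  have sL: "smooth_on S ?L"
    by (intro smooth_on_ln smooth_on_minus smooth_coordinate open_S) (use pos in force)
  have dL: "pdiff j ?Q y = ?Q y * pdiff j ?L y" if "y \<in> S" for y j
  proof -
    have "pdiff j (\<lambda>y. ln (- ?Q y)) y = (1 / (- ?Q y)) * pdiff j (\<lambda>y. - ?Q y) y"
      using pos[OF that] smooth_on_differentiable[OF smooth_on_minus[OF open_S smooth_coordinate] that]
      by (intro pdiff_real_chain(1)) (auto intro!: derivative_eq_intros)
    moreover have "pdiff j (\<lambda>y. - ?Q y) y = - pdiff j ?Q y"
      using pdiff_linear(1)[OF bounded_linear_minus[OF bounded_linear_ident]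
          smooth_on_differentiable[OF smooth_coordinate that]] .
    ultimately show ?thesis using Q0[OF that] by simp
  qed
  have ddL: "pdiff i (pdiff j ?Q) x = ?Q x * pdiff i (pdiff j ?L) x + ?Q x * (pdiff i ?L x * pdiff j ?L x)" for i j
  proof -
    have "pdiff i (pdiff j ?Q) x = pdiff i (\<lambda>y. ?Q y * pdiff j ?L y) x"
      by (rule pdiff_cong[OF open_S x]) (rule dL)
    also have "\<dots> = ?Q x * pdiff i (pdiff j ?L) x + pdiff i ?Q x * pdiff j ?L x"
      by (rule pdiff_mult[OF x smooth_coordinate smooth_on_pdiff[OF sL]])
    finally show ?thesis by (simp add: dL[OF x])
  qed
  have "laplacian G ?Q x = ?Q x * laplacian G ?L x + ?Q x * grad_inner G ?L ?L x"
    unfolding laplacian_def grad_inner_def ddL by (simp add: sum_2 dL[OF x] algebra_simps)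
  then have 1: "trh x * ?Q x + 2 * ?e = ?Q x * laplacian G ?L x + ?Q x * grad_inner G ?L ?L x"
    unfolding laplacian_coordinate[OF x] .
  have "grad_inner G ?Q ?Q x = ?Q x * (?Q x * grad_inner G ?L ?L x)"
    unfolding grad_inner_def by (simp add: sum_2 dL[OF x] algebra_simps)
  then have "?Q x * (2 * ?e) = ?Q x * (?Q x * grad_inner G ?L ?L x)"
    using \<nu> unfolding grad_inner_coordinates[OF x] by simp
  then have "2 * ?e = ?Q x * grad_inner G ?L ?L x" using Q0[OF x] by simp
  then have "?Q x * trh x = ?Q x * laplacian G ?L x" using 1 by (simp add: mult.commute)
  then show ?thesis using Q0[OF x] by simp
qed

end

section \<open>Second-order jets of real functions\<close>

text \<open>
  Second variations only involve the first two derivatives at the parameter 0.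
\<close>

definition has_jet2 :: "(real \<Rightarrow> real) \<Rightarrow> real \<Rightarrow> real \<Rightarrow> bool" where
  "has_jet2 k a b \<longleftrightarrow> (\<exists>k'. (\<forall>\<^sub>F s in nhds 0. (k has_real_derivative k' s) (at s)) \<and> k' 0 = a \<and>
     (k' has_real_derivative b) (at 0))"

lemma has_jet2I:
  assumes "\<forall>\<^sub>F s in nhds 0. (k has_real_derivative k' s) (at s)" "k' 0 = a"
    "(k' has_real_derivative b) (at 0)"
  shows "has_jet2 k a b"
  using assms unfolding has_jet2_def by blast

lemma has_jet2_DERIV: "has_jet2 k a b \<Longrightarrow> (k has_real_derivative a) (at 0)"
  unfolding has_jet2_def using eventually_nhds_x_imp_x by blast

lemma has_jet2_isCont: "has_jet2 k a b \<Longrightarrow> isCont k 0"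
  using has_jet2_DERIV DERIV_isCont by blast

lemma has_jet2_const: "has_jet2 (\<lambda>s. c) 0 0"
  by (rule has_jet2I[where k' = "\<lambda>s. 0"]) auto

lemma has_jet2_add:
  assumes "has_jet2 f a b" "has_jet2 k c d"
  shows "has_jet2 (\<lambda>s. f s + k s) (a + c) (b + d)"
proof -
  obtain f' k' where f: "\<forall>\<^sub>F s in nhds 0. (f has_real_derivative f' s) (at s)" "f' 0 = a"
      "(f' has_real_derivative b) (at 0)"
    and k: "\<forall>\<^sub>F s in nhds 0. (k has_real_derivative k' s) (at s)" "k' 0 = c"
      "(k' has_real_derivative d) (at 0)"
    using assms unfolding has_jet2_def by blast
  show ?thesis
  proof (rule has_jet2I[where k' = "\<lambda>s. f' s + k' s"])
    show "\<forall>\<^sub>F s in nhds 0. ((\<lambda>s. f s + k s) has_real_derivative f' s + k' s) (at s)"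
      using f(1) k(1) by eventually_elim (rule DERIV_add)
  qed (use f k in \<open>auto intro!: DERIV_add\<close>)
qed

lemma has_jet2_mult:
  assumes "has_jet2 f a b" "has_jet2 k c d"
  shows "has_jet2 (\<lambda>s. f s * k s) (a * k 0 + f 0 * c) (b * k 0 + 2 * a * c + f 0 * d)"
proof -
  obtain f' k' where f: "\<forall>\<^sub>F s in nhds 0. (f has_real_derivative f' s) (at s)" "f' 0 = a"
      "(f' has_real_derivative b) (at 0)"
    and k: "\<forall>\<^sub>F s in nhds 0. (k has_real_derivative k' s) (at s)" "k' 0 = c"
      "(k' has_real_derivative d) (at 0)"
    using assms unfolding has_jet2_def by blast
  show ?thesis
  proof (rule has_jet2I[where k' = "\<lambda>s. f' s * k s + f s * k' s"])
    show "\<forall>\<^sub>F s in nhds 0. ((\<lambda>s. f s * k s) has_real_derivative f' s * k s + f s * k' s) (at s)"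
      using f(1) k(1) by eventually_elim (auto intro!: derivative_eq_intros)
    show "((\<lambda>s. f' s * k s + f s * k' s) has_real_derivative b * k 0 + 2 * a * c + f 0 * d) (at 0)"
      using f(2,3) k(2,3) has_jet2_DERIV[OF assms(1)] has_jet2_DERIV[OF assms(2)]
      by (auto intro!: derivative_eq_intros)
  qed (use f k in auto)
qed

lemma isCont_eventually_mem:
  fixes k :: "'b::t2_space \<Rightarrow> 'c::topological_space"
  assumes "isCont k s" "open T" "k s \<in> T"
  shows "\<forall>\<^sub>F r in nhds s. k r \<in> T"
proof -
  have "(k \<longlongrightarrow> k s) (nhds s)"
    using assms(1) unfolding isCont_def tendsto_at_iff_tendsto_nhds .
  then show ?thesis by (rule topological_tendstoD[OF _ assms(2,3)])
qed

lemma has_jet2_compose: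
  assumes k: "has_jet2 k a b" and f: "\<And>y. y \<in> T \<Longrightarrow> (f has_real_derivative f' y) (at y)"
    and f': "(f' has_real_derivative c) (at (k 0))" and T: "open T" "k 0 \<in> T"
  shows "has_jet2 (\<lambda>s. f (k s)) (f' (k 0) * a) (c * a\<^sup>2 + f' (k 0) * b)"
proof -
  obtain k' where k': "\<forall>\<^sub>F s in nhds 0. (k has_real_derivative k' s) (at s)" "k' 0 = a"
      "(k' has_real_derivative b) (at 0)"
    using assms unfolding has_jet2_def by blast
  have inT: "\<forall>\<^sub>F s in nhds 0. k s \<in> T"
    by (rule isCont_eventually_mem[OF has_jet2_isCont[OF k] T])
  show ?thesis
  proof (rule has_jet2I[where k' = "\<lambda>s. f' (k s) * k' s"])
    show "\<forall>\<^sub>F s in nhds 0. ((\<lambda>s. f (k s)) has_real_derivative f' (k s) * k' s) (at s)"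
      using k'(1) inT by eventually_elim (rule DERIV_chain2[OF f])
    have "((\<lambda>s. f' (k s)) has_real_derivative c * a) (at 0)"
      by (rule DERIV_chain2[OF f' has_jet2_DERIV[OF k]])
    then show "((\<lambda>s. f' (k s) * k' s) has_real_derivative c * a\<^sup>2 + f' (k 0) * b) (at 0)"
      using k'(2,3) by (auto intro!: derivative_eq_intros simp: power2_eq_square)
  qed (use k' in auto)
qed

lemma has_jet2_minus: "has_jet2 f a b \<Longrightarrow> has_jet2 (\<lambda>s. - f s) (- a) (- b)"
  using has_jet2_mult[OF has_jet2_const[of "-1"], of f a b] by simp

lemma has_jet2_cmult: "has_jet2 f a b \<Longrightarrow> has_jet2 (\<lambda>s. c * f s) (c * a) (c * b)"
  using has_jet2_mult[OF has_jet2_const[of c], of f a b] by simp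

lemma has_jet2_diff:
  "has_jet2 f a b \<Longrightarrow> has_jet2 k c d \<Longrightarrow> has_jet2 (\<lambda>s. f s - k s) (a - c) (b - d)"
  using has_jet2_add[OF _ has_jet2_minus, of f a b k c d] by simp

lemma has_jet2_ln:
  assumes "has_jet2 k a b" "0 < k 0"
  shows "has_jet2 (\<lambda>s. ln (k s)) (a / k 0) (b / k 0 - (a / k 0)\<^sup>2)"
proof -
  have d: "((\<lambda>y. 1 / y) has_real_derivative - (1 / k 0 ^ 2)) (at (k 0))"
    using assms(2) by (auto intro!: derivative_eq_intros simp: power2_eq_square)
  have "has_jet2 (\<lambda>s. ln (k s)) (1 / k 0 * a) (- (1 / k 0 ^ 2) * a\<^sup>2 + 1 / k 0 * b)"
    by (rule has_jet2_compose[OF assms(1) _ d, where T = "{0<..}"])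
      (use assms(2) in \<open>auto intro!: derivative_eq_intros\<close>)
  then show ?thesis by (simp add: power_divide)
qed

lemma has_jet2_exp:
  assumes "has_jet2 k a b"
  shows "has_jet2 (\<lambda>s. exp (k s)) (exp (k 0) * a) (exp (k 0) * (a\<^sup>2 + b))"
  using has_jet2_compose[OF assms DERIV_exp DERIV_exp, of UNIV] by (simp add: distrib_left)

lemma has_jet2_sum:
  assumes "\<And>i. i \<in> I \<Longrightarrow> has_jet2 (f i) (a i) (b i)"
  shows "has_jet2 (\<lambda>s. \<Sum>i\<in>I. f i s) (\<Sum>i\<in>I. a i) (\<Sum>i\<in>I. b i)"
proof (cases "finite I")
  case True
  then show ?thesis using assms
    by (induction I) (auto intro!: has_jet2_add has_jet2_const)
next
  case False
  then show ?thesis by (simp add: has_jet2_const)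
qed

lemma has_jet2_cong:
  assumes "has_jet2 f a b" "\<forall>\<^sub>F s in nhds 0. f s = k s"
  shows "has_jet2 k a b"
proof -
  obtain f' where f: "\<forall>\<^sub>F s in nhds 0. (f has_real_derivative f' s) (at s)" "f' 0 = a"
      "(f' has_real_derivative b) (at 0)"
    using assms unfolding has_jet2_def by blast
  have "\<forall>\<^sub>F s in nhds 0. \<forall>\<^sub>F r in nhds s. f r = k r"
    using assms(2) by (simp add: eventually_eventually)
  with f(1) have "\<forall>\<^sub>F s in nhds 0. (k has_real_derivative f' s) (at s)"
    by eventually_elim (use DERIV_cong_ev in blast)
  with f show ?thesis by (intro has_jet2I)
qed

lemma has_jet2_local_max:
  assumes k: "has_jet2 k a b" and mx: "\<forall>\<^sub>F s in nhds 0. k s \<le> k 0"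
  shows "b \<le> 0"
proof (rule ccontr)
  assume "\<not> b \<le> 0"
  then have b: "0 < b" by simp
  obtain k' where k': "\<forall>\<^sub>F s in nhds 0. (k has_real_derivative k' s) (at s)" "k' 0 = a"
      "(k' has_real_derivative b) (at 0)"
    using k unfolding has_jet2_def by blast
  obtain d where d: "d > 0" "\<And>s. \<bar>s\<bar> < d \<Longrightarrow> (k has_real_derivative k' s) (at s) \<and> k s \<le> k 0"
    using eventually_conj[OF k'(1) mx] unfolding eventually_nhds_metric by (auto simp: dist_real_def)
  have "a = 0"
    by (rule DERIV_local_max[OF has_jet2_DERIV[OF k] d(1)]) (use d(2) in auto)
  obtain e where e: "e > 0" "\<And>s. s > 0 \<Longrightarrow> s < e \<Longrightarrow> k' 0 < k' (0 + s)"
    using DERIV_pos_inc_right[OF k'(3) b] by blast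
  define r where "r = min d e / 2"
  have r: "0 < r" "r < d" "r < e" using d(1) e(1) by (auto simp: r_def)
  obtain s where s: "0 < s" "s < r" "k r - k 0 = (r - 0) * k' s"
    using MVT2[OF r(1), of k k'] d(2) r(2) by auto
  have "0 < k' s" using e(2)[of s] s r \<open>a = 0\<close> k'(2) by auto
  then have "0 < k r - k 0" unfolding s(3) using r by simp
  then show False using d(2)[of r] r by auto
qed

text \<open>
  Parabolas realise every second-order jet of curves, so that conditions on the jet of a curve become
  linear equations for its velocity and acceleration.
\<close>

definition jet_curve :: "real^2 \<Rightarrow> real^2 \<Rightarrow> real^2 \<Rightarrow> real \<Rightarrow> real^2" where
  "jet_curve x v q s = x + s *\<^sub>R v + (s\<^sup>2 / 2) *\<^sub>R q"

definition dir1 :: "(real^2 \<Rightarrow> real) \<Rightarrow> real^2 \<Rightarrow> real^2 \<Rightarrow> real" where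
  "dir1 f x v = (\<Sum>i\<in>UNIV. v $ i * pdiff i f x)"

definition dir2 :: "(real^2 \<Rightarrow> real) \<Rightarrow> real^2 \<Rightarrow> real^2 \<Rightarrow> real" where
  "dir2 f x v = (\<Sum>i\<in>UNIV. \<Sum>j\<in>UNIV. v $ i * v $ j * pdiff i (pdiff j f) x)"

lemma jet_curve_0 [simp]: "jet_curve x v q 0 = x"
  by (simp add: jet_curve_def)

lemma continuous_jet_curve: "continuous_on UNIV (jet_curve x v q)"
  unfolding jet_curve_def by (intro continuous_intros) auto

lemma eventually_jet_curve:
  assumes "open S" "x \<in> S"
  shows "\<forall>\<^sub>F s in nhds 0. jet_curve x v q s \<in> S"
proof -
  have "isCont (jet_curve x v q) 0"
    using continuous_jet_curve continuous_on_eq_continuous_at open_UNIV by blast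
  then show ?thesis using assms by (intro isCont_eventually_mem) auto
qed

lemma has_derivative_jet_curve:
  "(jet_curve x v q has_derivative (\<lambda>t. t *\<^sub>R (v + s *\<^sub>R q))) (at s)"
  unfolding jet_curve_def
  by (auto intro!: derivative_eq_intros simp: algebra_simps)

lemma DERIV_along_jet_curve:
  assumes "f differentiable at (jet_curve x v q s)"
  shows "((\<lambda>s. f (jet_curve x v q s)) has_real_derivative dir1 f (jet_curve x v q s) (v + s *\<^sub>R q)) (at s)"
proof -
  note d = diff_chain_at[OF has_derivative_jet_curve has_derivative_pdiff[OF assms]]
  have "(\<lambda>v. \<Sum>i\<in>UNIV. v $ i *\<^sub>R pdiff i f (jet_curve x v' q s)) \<circ> (\<lambda>t. t *\<^sub>R (v' + s *\<^sub>R q))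
      = (*) (dir1 f (jet_curve x v' q s) (v' + s *\<^sub>R q))" for v'
    by (simp add: fun_eq_iff dir1_def sum_2 algebra_simps)
  with d show ?thesis by (simp add: has_field_derivative_def o_def)
qed

lemma has_jet2_jet_curve:
  assumes S: "open S" "x \<in> S" and f: "smooth_on S f"
  shows "has_jet2 (\<lambda>s. f (jet_curve x v q s)) (dir1 f x v) (dir2 f x v + dir1 f x q)"
proof (rule has_jet2I[where k' = "\<lambda>s. dir1 f (jet_curve x v q s) (v + s *\<^sub>R q)"])
  show "\<forall>\<^sub>F s in nhds 0. ((\<lambda>s. f (jet_curve x v q s)) has_real_derivative
      dir1 f (jet_curve x v q s) (v + s *\<^sub>R q)) (at s)"
    using eventually_jet_curve[OF S]
    by eventually_elim (intro DERIV_along_jet_curve smooth_on_differentiable[OF f])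
  have p: "((\<lambda>s. pdiff i f (jet_curve x v q s)) has_real_derivative dir1 (pdiff i f) x v) (at 0)" for i
    using DERIV_along_jet_curve[of "pdiff i f" x v q 0] smooth_on_differentiable[OF smooth_on_pdiff[OF f] S(2)]
    by simp
  have "((\<lambda>s. (v + s *\<^sub>R q) $ i * pdiff i f (jet_curve x v q s)) has_real_derivative
      q $ i * pdiff i f x + v $ i * dir1 (pdiff i f) x v) (at 0)" for i
    using p[of i] by (auto intro!: derivative_eq_intros)
  then have "((\<lambda>s. \<Sum>i\<in>UNIV. (v + s *\<^sub>R q) $ i * pdiff i f (jet_curve x v q s)) has_real_derivative
      (\<Sum>i\<in>UNIV. q $ i * pdiff i f x + v $ i * dir1 (pdiff i f) x v)) (at 0)"
    by (intro DERIV_sum)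
  moreover have "(\<Sum>i\<in>UNIV. q $ i * pdiff i f x + v $ i * dir1 (pdiff i f) x v) = dir2 f x v + dir1 f x q"
    using pdiff_commute[OF S(1) f S(2), of 2 1]
    by (simp add: sum_2 dir1_def dir2_def algebra_simps)
  ultimately show "((\<lambda>s. dir1 f (jet_curve x v q s) (v + s *\<^sub>R q)) has_real_derivative
      dir2 f x v + dir1 f x q) (at 0)"
    by (simp add: dir1_def)
qed simp

section \<open>Isothermal variations\<close>

text \<open>
  The null direction of \<open>pole t\<close> is the centre of a stereographic projection with the coordinates
  \<open>\<langle>X, coax1\<rangle> / \<langle>X, pole t\<rangle>\<close> and \<open>\<langle>X, coax2 t\<rangle> / \<langle>X, pole t\<rangle>\<close>. A one-parameter family of poles is enough to
  avoid the directions of finitely many given points.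
\<close>

definition pole :: "real \<Rightarrow> real^4" where
  "pole t = axis 1 1 + sin t *\<^sub>R axis 3 1 + cos t *\<^sub>R axis 4 1"

definition antipole :: "real \<Rightarrow> real^4" where
  "antipole t = axis 1 1 - sin t *\<^sub>R axis 3 1 - cos t *\<^sub>R axis 4 1"

definition coax1 :: "real^4" where "coax1 = axis 2 1"

definition coax2 :: "real \<Rightarrow> real^4" where
  "coax2 t = cos t *\<^sub>R axis 3 1 - sin t *\<^sub>R axis 4 1"

lemma lorentz_pole: "lorentz X (pole t) = - X $ 1 + sin t * X $ 3 + cos t * X $ 4"
  by (simp add: lorentz_def pole_def axis_def mult.commute)

lemma lorentz_antipole: "lorentz X (antipole t) = - X $ 1 - sin t * X $ 3 - cos t * X $ 4"
  by (simp add: lorentz_def antipole_def axis_def mult.commute)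

lemma lorentz_coax1: "lorentz X coax1 = X $ 2"
  by (simp add: lorentz_def coax1_def axis_def)

lemma lorentz_coax2: "lorentz X (coax2 t) = cos t * X $ 3 - sin t * X $ 4"
  by (simp add: lorentz_def coax2_def axis_def mult.commute)

lemma pole_null: "lorentz (pole t) (pole t) = 0" and coax_pole: "lorentz coax1 (pole t) = 0"
  "lorentz (coax2 t) (pole t) = 0"
  using sin_cos_squared_add[of t] unfolding lorentz_pole
  by (auto simp: pole_def coax1_def coax2_def axis_def power2_eq_square)

lemma lorentz_pole_expansion:
  "lorentz X Y = - (lorentz X (pole t) * lorentz Y (antipole t) + lorentz X (antipole t) * lorentz Y (pole t)) / 2
     + lorentz X coax1 * lorentz Y coax1 + lorentz X (coax2 t) * lorentz Y (coax2 t)"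
proof -
  have "2 * lorentz X Y = - (lorentz X (pole t) * lorentz Y (antipole t) + lorentz X (antipole t) * lorentz Y (pole t))
     + 2 * (lorentz X coax1 * lorentz Y coax1) + 2 * (lorentz X (coax2 t) * lorentz Y (coax2 t))"
    unfolding lorentz_pole lorentz_antipole lorentz_coax1 lorentz_coax2 lorentz_def[of X Y]
    using sin_cos_squared_add[of t] by algebra
  then show ?thesis by (simp add: field_simps)
qed

definition stereo :: "real \<Rightarrow> real^4 \<Rightarrow> complex" where
  "stereo t X = Complex (lorentz X coax1 / lorentz X (pole t)) (lorentz X (coax2 t) / lorentz X (pole t))"

lemma antipole_stereo:
  assumes "lorentz X X = 0" "lorentz X (pole t) \<noteq> 0"
  shows "lorentz X (antipole t) = lorentz X (pole t) * (cmod (stereo t X))\<^sup>2"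
proof -
  have "lorentz X (pole t) * lorentz X (antipole t) = (lorentz X coax1)\<^sup>2 + (lorentz X (coax2 t))\<^sup>2"
    using lorentz_pole_expansion[of X X t] assms(1) by (simp add: power2_eq_square algebra_simps)
  moreover have "lorentz X coax1 = lorentz X (pole t) * Re (stereo t X)"
    "lorentz X (coax2 t) = lorentz X (pole t) * Im (stereo t X)"
    using assms(2) by (simp_all add: stereo_def)
  ultimately have "lorentz X (pole t) * lorentz X (antipole t)
      = lorentz X (pole t) * (lorentz X (pole t) * (cmod (stereo t X))\<^sup>2)"
    unfolding cmod_power2 by (simp add: power2_eq_square algebra_simps)
  then show ?thesis using assms(2) by simp
qed

text \<open>
  On the cone the component along the antipole is determined by the others, and what is left of the
  product is a squared distance in the plane, weighted by the two heights.
\<close>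

lemma chord_stereo:
  assumes "lorentz X X = 0" "lorentz X (pole t) \<noteq> 0" "lorentz Y Y = 0" "lorentz Y (pole t) \<noteq> 0"
  shows "- 2 * lorentz X Y = lorentz X (pole t) * lorentz Y (pole t) * (cmod (stereo t X - stereo t Y))\<^sup>2"
proof -
  define a b where "a = lorentz X (pole t)" and "b = lorentz Y (pole t)"
  define x1 x2 y1 y2 where z: "x1 = Re (stereo t X)" "x2 = Im (stereo t X)" "y1 = Re (stereo t Y)" "y2 = Im (stereo t Y)"
  have c: "lorentz X coax1 = a * x1" "lorentz X (coax2 t) = a * x2"
    "lorentz Y coax1 = b * y1" "lorentz Y (coax2 t) = b * y2"
    using assms(2,4) by (simp_all add: z stereo_def a_def b_def)
  have d: "lorentz X (antipole t) = a * (x1\<^sup>2 + x2\<^sup>2)" "lorentz Y (antipole t) = b * (y1\<^sup>2 + y2\<^sup>2)"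
    unfolding antipole_stereo[OF assms(1,2)] antipole_stereo[OF assms(3,4)] by (simp_all add: cmod_power2 z a_def b_def)
  have e: "(cmod (stereo t X - stereo t Y))\<^sup>2 = (x1 - y1)\<^sup>2 + (x2 - y2)\<^sup>2"
    by (simp add: cmod_power2 z)
  show ?thesis
    unfolding lorentz_pole_expansion[of X Y t] c d e a_def[symmetric] b_def[symmetric]
    by (simp add: power2_eq_square algebra_simps)
qed

context null_cone_patch
begin

abbreviation "A t y \<equiv> lorentz (F y) (pole t)"
abbreviation "Z1 t y \<equiv> lorentz (F y) coax1 / lorentz (F y) (pole t)"
abbreviation "Z2 t y \<equiv> lorentz (F y) (coax2 t) / lorentz (F y) (pole t)"

lemma smooth_Z:
  assumes "\<forall>y\<in>S. A t y \<noteq> 0"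
  shows "smooth_on S (Z1 t)" "smooth_on S (Z2 t)"
  by (intro smooth_on_divide smooth_coordinate open_S bspec[OF assms]; assumption)+

text \<open>
  The infinitesimal version of \<open>chord_stereo\<close>: the derivatives of the heights drop out because \<open>D i\<close> is
  orthogonal to the null vector \<open>F\<close>.
\<close>

lemma metric_stereographic:
  assumes x: "x \<in> S" and nz: "\<forall>y\<in>S. A t y \<noteq> 0"
  shows "G x $ i $ j = (A t x)\<^sup>2 * (pdiff i (Z1 t) x * pdiff j (Z1 t) x + pdiff i (Z2 t) x * pdiff j (Z2 t) x)"
proof -
  define a z1 z2 where "a = A t x" and "z1 = Z1 t x" and "z2 = Z2 t x"
  have d: "lorentz (D k x) coax1 = z1 * lorentz (D k x) (pole t) + pdiff k (Z1 t) x * a"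
    "lorentz (D k x) (coax2 t) = z2 * lorentz (D k x) (pole t) + pdiff k (Z2 t) x * a" for k
  proof -
    have "pdiff k (\<lambda>y. lorentz (F y) coax1) x = pdiff k (\<lambda>y. Z1 t y * A t y) x"
      by (rule pdiff_cong[OF open_S x]) (use nz in simp)
    also have "\<dots> = Z1 t x * pdiff k (A t) x + pdiff k (Z1 t) x * A t x"
      by (rule pdiff_mult[OF x smooth_Z(1)[OF nz] smooth_coordinate])
    finally show "lorentz (D k x) coax1 = z1 * lorentz (D k x) (pole t) + pdiff k (Z1 t) x * a"
      unfolding pdiff_coordinate[OF x] a_def z1_def .
    have "pdiff k (\<lambda>y. lorentz (F y) (coax2 t)) x = pdiff k (\<lambda>y. Z2 t y * A t y) x"
      by (rule pdiff_cong[OF open_S x]) (use nz in simp)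
    also have "\<dots> = Z2 t x * pdiff k (A t) x + pdiff k (Z2 t) x * A t x"
      by (rule pdiff_mult[OF x smooth_Z(2)[OF nz] smooth_coordinate])
    finally show "lorentz (D k x) (coax2 t) = z2 * lorentz (D k x) (pole t) + pdiff k (Z2 t) x * a"
      unfolding pdiff_coordinate[OF x] a_def z2_def .
  qed
  have F: "lorentz (F x) coax1 = z1 * a" "lorentz (F x) (coax2 t) = z2 * a" "A t x = a"
    using bspec[OF nz x] by (simp_all add: a_def z1_def z2_def)
  have FA: "lorentz (F x) (antipole t) = a * (z1\<^sup>2 + z2\<^sup>2)"
    using antipole_stereo[OF F_null[OF x] bspec[OF nz x]]
    by (simp add: stereo_def cmod_power2 a_def z1_def z2_def)
  have a0: "a \<noteq> 0" using bspec[OF nz x] by (simp add: a_def)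
  have DA: "lorentz (D k x) (antipole t) = 2 * (lorentz (D k x) coax1 * z1 + lorentz (D k x) (coax2 t) * z2)
      - lorentz (D k x) (pole t) * (z1\<^sup>2 + z2\<^sup>2)" for k
  proof -
    have "a * lorentz (D k x) (antipole t) = a * (2 * (lorentz (D k x) coax1 * z1 + lorentz (D k x) (coax2 t) * z2)
      - lorentz (D k x) (pole t) * (z1\<^sup>2 + z2\<^sup>2))"
      using lorentz_pole_expansion[of "D k x" "F x" t] unfolding D_F[OF x] F FA
      by (simp add: field_simps)
    then show ?thesis using a0 by simp
  qed
  show ?thesis
    unfolding G_nth lorentz_pole_expansion[of "D i x" "D j x" t] DA d F
    by (simp add: power2_eq_square field_simps)
qed

text \<open>
  Velocity \<open>v\<close> and acceleration \<open>q\<close> of a curve whose stereographic coordinate is \<open>z + s b\<close> up to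
  terms of third order.
\<close>

definition straight_jet :: "real \<Rightarrow> real^2 \<Rightarrow> complex \<Rightarrow> real^2 \<Rightarrow> real^2 \<Rightarrow> bool" where
  "straight_jet t x b v q \<longleftrightarrow> dir1 (Z1 t) x v = Re b \<and> dir1 (Z2 t) x v = Im b \<and>
     dir2 (Z1 t) x v + dir1 (Z1 t) x q = 0 \<and> dir2 (Z2 t) x v + dir1 (Z2 t) x q = 0"

lemma stereographic_jacobian:
  assumes x: "x \<in> S" and nz: "\<forall>y\<in>S. A t y \<noteq> 0"
  shows "pdiff 1 (Z1 t) x * pdiff 2 (Z2 t) x - pdiff 2 (Z1 t) x * pdiff 1 (Z2 t) x \<noteq> 0" (is "?J \<noteq> 0")
    and "det (G x) = (A t x)\<^sup>2 * (A t x)\<^sup>2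
      * (pdiff 1 (Z1 t) x * pdiff 2 (Z2 t) x - pdiff 2 (Z1 t) x * pdiff 1 (Z2 t) x)\<^sup>2"
proof -
  show *: "det (G x) = (A t x)\<^sup>2 * (A t x)\<^sup>2 * ?J\<^sup>2"
    unfolding det_2 metric_stereographic[OF x nz] by (simp add: power2_eq_square algebra_simps)
  show "?J \<noteq> 0"
  proof
    assume "?J = 0"
    then show False using * det_nz[OF x] by (simp del: eq_iff_diff_eq_0)
  qed
qed

lemma dir1_solve:
  assumes x: "x \<in> S" and nz: "\<forall>y\<in>S. A t y \<noteq> 0"
  shows "\<exists>v. dir1 (Z1 t) x v = r1 \<and> dir1 (Z2 t) x v = r2"
proof -
  define a b c d where abcd: "a = pdiff 1 (Z1 t) x" "b = pdiff 2 (Z1 t) x"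
    "c = pdiff 1 (Z2 t) x" "d = pdiff 2 (Z2 t) x"
  define v :: "real^2" where "v = (\<chi> i. (if i = 1 then r1 * d - r2 * b else r2 * a - r1 * c) / (a * d - b * c))"
  have J: "a * d - b * c \<noteq> 0" using stereographic_jacobian(1)[OF x nz] by (simp add: abcd)
  have "a * (r1 * d - r2 * b) + b * (r2 * a - r1 * c) = r1 * (a * d - b * c)"
     "c * (r1 * d - r2 * b) + d * (r2 * a - r1 * c) = r2 * (a * d - b * c)"
    by (simp_all add: algebra_simps)
  then have "dir1 (Z1 t) x v = r1 \<and> dir1 (Z2 t) x v = r2"
    using J unfolding dir1_def sum_2 v_def abcd[symmetric]
    by (simp add: add_divide_distrib[symmetric] mult.commute)
  then show ?thesis by blast
qed

lemma straight_jet_exists: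
  assumes x: "x \<in> S" and nz: "\<forall>y\<in>S. A t y \<noteq> 0"
  shows "\<exists>v q. straight_jet t x b v q"
proof -
  obtain v where v: "dir1 (Z1 t) x v = Re b" "dir1 (Z2 t) x v = Im b"
    using dir1_solve[OF x nz] by blast
  obtain q where "dir1 (Z1 t) x q = - dir2 (Z1 t) x v" "dir1 (Z2 t) x q = - dir2 (Z2 t) x v"
    using dir1_solve[OF x nz] by blast
  with v have "straight_jet t x b v q" by (simp add: straight_jet_def)
  then show ?thesis by blast
qed

text \<open>
  The velocities \<open>v, w\<close> are orthogonal and of equal length because the coordinates are conformal, so
  \<open>v\<^sub>i v\<^sub>j + w\<^sub>i w\<^sub>j\<close> is a multiple of the inverse metric. Because the coordinates are harmonic, the
  accelerations add up to the same multiple of the Christoffel term of the Laplacian.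
\<close>

lemma straight_jet_laplacian:
  assumes x: "x \<in> S" and nz: "\<forall>y\<in>S. A t y \<noteq> 0" and f: "smooth_on S f"
    and j1: "straight_jet t x b v q" and j2: "straight_jet t x (\<i> * b) w p"
  shows "dir2 f x v + dir1 f x q + (dir2 f x w + dir1 f x p) = (cmod b)\<^sup>2 * (A t x)\<^sup>2 * laplacian G f x"
proof -
  define a c d e where abcd: "a = pdiff 1 (Z1 t) x" "c = pdiff 2 (Z1 t) x"
    "d = pdiff 1 (Z2 t) x" "e = pdiff 2 (Z2 t) x"
  define J where "J = a * e - c * d"
  define \<mu> where "\<mu> = (cmod b)\<^sup>2 * (A t x)\<^sup>2"
  have J: "J \<noteq> 0" "det (G x) = (A t x)\<^sup>2 * (A t x)\<^sup>2 * J\<^sup>2"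
    using stereographic_jacobian[OF x nz] by (simp_all add: abcd J_def)
  have A: "A t x \<noteq> 0" by (rule bspec[OF nz x])
  have cramer: "u $ 1 = (r1 * e - r2 * c) / J \<and> u $ 2 = (r2 * a - r1 * d) / J"
    if "dir1 (Z1 t) x u = r1" "dir1 (Z2 t) x u = r2" for u r1 r2
  proof -
    have "u $ 1 * J = r1 * e - r2 * c" "u $ 2 * J = r2 * a - r1 * d"
      unfolding that[symmetric] dir1_def sum_2 abcd[symmetric] J_def by (simp_all add: algebra_simps)
    then show ?thesis using J(1) by (simp add: eq_divide_eq)
  qed
  have v: "v $ 1 = (Re b * e - Im b * c) / J" "v $ 2 = (Im b * a - Re b * d) / J"
    using cramer[of v "Re b" "Im b"] j1 by (simp_all add: straight_jet_def)
  have w: "w $ 1 = (- Im b * e - Re b * c) / J" "w $ 2 = (Re b * a + Im b * d) / J"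
    using cramer[of w "- Im b" "Re b"] j2 by (simp_all add: straight_jet_def)
  have G: "G x $ 1 $ 1 = (A t x)\<^sup>2 * (a\<^sup>2 + d\<^sup>2)" "G x $ 1 $ 2 = (A t x)\<^sup>2 * (a * c + d * e)"
    "G x $ 2 $ 1 = (A t x)\<^sup>2 * (a * c + d * e)" "G x $ 2 $ 2 = (A t x)\<^sup>2 * (c\<^sup>2 + e\<^sup>2)"
    unfolding metric_stereographic[OF x nz] by (simp_all add: abcd power2_eq_square algebra_simps)
  have W: "v $ i * v $ j + w $ i * w $ j = \<mu> * gi i j x" for i j
  proof -
    have cb: "(cmod b)\<^sup>2 = (Re b)\<^sup>2 + (Im b)\<^sup>2" by (simp add: cmod_power2)
    have q: "r / J * (r' / J) + s / J * (s' / J) = (r * r' + s * s') / (J * J)" for r r' s s'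
      by (simp add: add_divide_distrib)
    have g: "(cmod b)\<^sup>2 * (A t x)\<^sup>2 * ((A t x)\<^sup>2 * r / ((A t x)\<^sup>2 * (A t x)\<^sup>2 * J\<^sup>2)) = (cmod b)\<^sup>2 * r / (J * J)" for r
      using A by (simp add: power2_eq_square)
    have "v $ 1 * v $ 1 + w $ 1 * w $ 1 = \<mu> * gi 1 1 x"
      unfolding matrix_inv_2[OF det_nz[OF x]] J(2) G v w \<mu>_def q g
      by (rule arg_cong[of _ _ "\<lambda>r. r / (J * J)"], unfold cb) (simp add: power2_eq_square algebra_simps)
    moreover have "v $ 2 * v $ 2 + w $ 2 * w $ 2 = \<mu> * gi 2 2 x"
      unfolding matrix_inv_2[OF det_nz[OF x]] J(2) G v w \<mu>_def q g
      by (rule arg_cong[of _ _ "\<lambda>r. r / (J * J)"], unfold cb) (simp add: power2_eq_square algebra_simps)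
    moreover have "v $ 1 * v $ 2 + w $ 1 * w $ 2 = \<mu> * gi 1 2 x"
      unfolding matrix_inv_2[OF det_nz[OF x]] J(2) G v w \<mu>_def q mult_minus_right[symmetric] g
      by (rule arg_cong[of _ _ "\<lambda>r. r / (J * J)"], unfold cb) (simp add: power2_eq_square algebra_simps)
    ultimately show ?thesis
      using exhaust_2[of i] exhaust_2[of j] gi_sym[OF x, of 2 1] by (auto simp: mult.commute)
  qed
  have sum2: "dir2 k x v + dir2 k x w = \<mu> * (\<Sum>i\<in>UNIV. \<Sum>j\<in>UNIV. gi i j x * pdiff i (pdiff j k) x)" for k
  proof -
    have "dir2 k x v + dir2 k x w = (\<Sum>i\<in>UNIV. \<Sum>j\<in>UNIV. (v $ i * v $ j + w $ i * w $ j) * pdiff i (pdiff j k) x)"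
      by (simp add: dir2_def sum_2 algebra_simps)
    then show ?thesis unfolding W by (simp add: sum_2 algebra_simps)
  qed
  define u :: "real^2" where "u = (\<chi> k. \<Sum>i\<in>UNIV. \<Sum>j\<in>UNIV. gi i j x * \<Gamma> k i j x)"
  have lap: "laplacian G k x = (\<Sum>i\<in>UNIV. \<Sum>j\<in>UNIV. gi i j x * pdiff i (pdiff j k) x) - dir1 k x u" for k
    by (simp add: laplacian_def dir1_def u_def sum_2 algebra_simps)
  have lin: "dir1 k x (r *\<^sub>R y) = r * dir1 k x y" and add: "dir1 k x (y + z) = dir1 k x y + dir1 k x z"
    for k r y z
    by (simp_all add: dir1_def sum_2 algebra_simps)
  have "dir1 (Z1 t) x (\<mu> *\<^sub>R u + (q + p)) = 0 \<and> dir1 (Z2 t) x (\<mu> *\<^sub>R u + (q + p)) = 0"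
  proof
    have "laplacian G (Z1 t) x = 0" "laplacian G (Z2 t) x = 0"
      by (rule laplacian_stereographic[OF x bspec[OF nz] pole_null]; simp add: coax_pole)+
    then have "dir2 (Z1 t) x v + dir2 (Z1 t) x w = \<mu> * dir1 (Z1 t) x u"
       "dir2 (Z2 t) x v + dir2 (Z2 t) x w = \<mu> * dir1 (Z2 t) x u"
      unfolding sum2 lap by simp_all
    then show "dir1 (Z1 t) x (\<mu> *\<^sub>R u + (q + p)) = 0" "dir1 (Z2 t) x (\<mu> *\<^sub>R u + (q + p)) = 0"
      using j1 j2 unfolding lin add straight_jet_def by linarith+
  qed
  then have "(\<mu> *\<^sub>R u + (q + p)) $ i = 0" for i
    using cramer[of "\<mu> *\<^sub>R u + (q + p)" 0 0] exhaust_2[of i] by auto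
  then have "\<mu> *\<^sub>R u + (q + p) = 0" by (simp add: vec_eq_iff)
  then have "dir1 f x (\<mu> *\<^sub>R u + (q + p)) = 0" by (simp add: dir1_def)
  then have "dir1 f x q + dir1 f x p = - \<mu> * dir1 f x u" unfolding lin add by simp
  moreover have "\<mu> * laplacian G f x = dir2 f x v + dir2 f x w - \<mu> * dir1 f x u"
    unfolding lap[of f] sum2[of f] by (simp add: algebra_simps)
  ultimately show ?thesis unfolding \<mu>_def[symmetric] by linarith
qed

end

section \<open>Conformal rescaling\<close>

text \<open>
  With \<open>n = (0, sin t, cos t)\<close> these are the inequality of Cauchy and Schwarz for \<open>n\<close> and the spatial part
  of \<open>X\<close>, whose norm is \<open>X $ 1\<close>, and its case of equality.
\<close>

lemma pole_nonpos:
  assumes "X \<in> future_light_cone"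
  shows "lorentz X (pole t) \<le> 0"
    and "lorentz X (pole t) = 0 \<Longrightarrow> X $ 3 = X $ 1 * sin t"
proof -
  have n: "(X $ 1)\<^sup>2 = (X $ 2)\<^sup>2 + (X $ 3)\<^sup>2 + (X $ 4)\<^sup>2" and p: "0 < X $ 1"
    using assms by (auto simp: future_light_cone_def lorentz_def power2_eq_square)
  define s where "s = sin t * X $ 3 + cos t * X $ 4"
  have e: "s\<^sup>2 + (cos t * X $ 3 - sin t * X $ 4)\<^sup>2 + (X $ 2)\<^sup>2 = (X $ 1)\<^sup>2"
    unfolding n s_def using sin_cos_squared_add[of t] by algebra
  have "s\<^sup>2 \<le> (X $ 1)\<^sup>2"
    using e zero_le_power2[of "X $ 2"] zero_le_power2[of "cos t * X $ 3 - sin t * X $ 4"] by linarith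
  then have "s \<le> X $ 1" using p by (simp add: power2_le_iff_abs_le)
  then show "lorentz X (pole t) \<le> 0" by (simp add: lorentz_pole s_def)
  assume "lorentz X (pole t) = 0"
  then have s: "s = X $ 1" by (simp add: lorentz_pole s_def)
  then have "(cos t * X $ 3 - sin t * X $ 4)\<^sup>2 + (X $ 2)\<^sup>2 = 0" using e by simp
  then have c: "cos t * X $ 3 - sin t * X $ 4 = 0" by (simp add: add_nonneg_eq_0_iff)
  have "X $ 3 = sin t * s + cos t * (cos t * X $ 3 - sin t * X $ 4)"
    unfolding s_def using sin_cos_squared_add[of t] by algebra
  then show "X $ 3 = X $ 1 * sin t" using s c by simp
qed

text \<open>
  A null direction meets at most one of the poles with parameter in the unit interval, because the
  sine is injective there.
\<close>

lemma avoiding_pole: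
  assumes "finite W" "W \<subseteq> future_light_cone"
  shows "\<exists>t. \<forall>X\<in>W. lorentz X (pole t) < 0"
proof -
  define bad where "bad X = {t \<in> {0..1}. lorentz X (pole t) = 0}" for X
  have "finite (bad X)" if X: "X \<in> W" for X
  proof -
    have "t = t'" if "t \<in> bad X" "t' \<in> bad X" for t t'
    proof -
      have c: "X \<in> future_light_cone" using X assms(2) by blast
      then have p: "X $ 1 \<noteq> 0" by (auto simp: future_light_cone_def)
      have "X $ 3 = X $ 1 * sin t" "X $ 3 = X $ 1 * sin t'"
        using pole_nonpos(2)[OF c, of t] pole_nonpos(2)[OF c, of t'] that unfolding bad_def by blast+
      then have "X $ 1 * sin t = X $ 1 * sin t'" by (rule trans[OF sym])
      then have "sin t = sin t'" using p by simp
      moreover have "- (pi / 2) \<le> r \<and> r \<le> pi / 2" if "r \<in> bad X" for r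
        using that pi_gt3 by (auto simp: bad_def)
      ultimately show "t = t'" using that sin_inj_pi by blast
    qed
    then have "bad X = {} \<or> (\<exists>t. bad X \<subseteq> {t})" by blast
    then show ?thesis using finite_subset by auto
  qed
  then have "finite (\<Union>X\<in>W. bad X)" using assms(1) by blast
  moreover have "infinite {0..1::real}" by (simp add: infinite_Icc)
  ultimately have "\<not> {0..1} \<subseteq> (\<Union>X\<in>W. bad X)" using finite_subset by blast
  then obtain t where t: "t \<in> {0..1}" "t \<notin> (\<Union>X\<in>W. bad X)" by blast
  have "lorentz X (pole t) < 0" if X: "X \<in> W" for X
  proof -
    have "lorentz X (pole t) \<noteq> 0" using t X unfolding bad_def by blast
    moreover have "lorentz X (pole t) \<le> 0" using pole_nonpos(1) X assms(2) by blast
    ultimately show ?thesis by simp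
  qed
  then show ?thesis by blast
qed

lemma christoffel_cong:
  assumes "open S" "x \<in> S" "\<And>y. y \<in> S \<Longrightarrow> M y = N y"
  shows "christoffel M k i j x = christoffel N k i j x"
  unfolding christoffel_def assms(3)[OF assms(2)]
  using pdiff_cong[OF assms(1,2), of "\<lambda>y. M y $ _ $ _" "\<lambda>y. N y $ _ $ _"] assms(3) by simp

lemma laplacian_cong:
  assumes "open S" "x \<in> S" "\<And>y. y \<in> S \<Longrightarrow> M y = N y" "\<And>y. y \<in> S \<Longrightarrow> f y = k y"
  shows "laplacian M f x = laplacian N k x"
proof -
  have p: "pdiff i f y = pdiff i k y" if "y \<in> S" for i y
    by (rule pdiff_cong[OF assms(1) that assms(4)])
  have "pdiff i (pdiff j f) x = pdiff i (pdiff j k) x" for i j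
    by (rule pdiff_cong[OF assms(1,2) p])
  moreover have "christoffel M l i j x = christoffel N l i j x" for l i j
    by (rule christoffel_cong[OF assms(1-3)])
  ultimately show ?thesis
    unfolding laplacian_def assms(3)[OF assms(2)] p[OF assms(2)] by simp
qed

lemma gauss_curvature_cong:
  assumes "open S" "x \<in> S" "\<And>y. y \<in> S \<Longrightarrow> M y = N y"
  shows "gauss_curvature M x = gauss_curvature N x"
proof -
  have c: "christoffel M k i j y = christoffel N k i j y" if "y \<in> S" for k i j y
    by (rule christoffel_cong[OF assms(1) that assms(3)])
  have "pdiff l (christoffel M k i j) x = pdiff l (christoffel N k i j) x" for k i j l
    by (rule pdiff_cong[OF assms(1,2) c])
  then show ?thesis
    unfolding gauss_curvature_def riemann_def assms(3)[OF assms(2)] c[OF assms(2)] by simp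
qed

lemma laplacian_add:
  assumes S: "open S" "x \<in> S" and f: "smooth_on S f" and k: "smooth_on S k"
  shows "laplacian M (\<lambda>y. f y + k y) x = laplacian M f x + laplacian M k x"
proof -
  have p: "pdiff i (\<lambda>y. f y + k y) y = pdiff i f y + pdiff i k y" if "y \<in> S" for i y
    using that f k by (intro pdiff_add smooth_on_differentiable)
  have "pdiff i (pdiff j (\<lambda>y. f y + k y)) x = pdiff i (\<lambda>y. pdiff j f y + pdiff j k y) x" for i j
    by (rule pdiff_cong[OF S p])
  moreover have "pdiff i (\<lambda>y. pdiff j f y + pdiff j k y) x = pdiff i (pdiff j f) x + pdiff i (pdiff j k) x" for i j
    using S(2) f k by (intro pdiff_add smooth_on_differentiable smooth_on_pdiff)
  ultimately show ?thesis
    unfolding laplacian_def p[OF S(2)] by (simp add: sum_2 algebra_simps)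
qed

lemma Ck_on_subset: "Ck_on k S f \<Longrightarrow> T \<subseteq> S \<Longrightarrow> Ck_on k T f"
proof (induction k arbitrary: f)
  case 0
  then show ?case using continuous_on_subset by auto
next
  case (Suc k)
  then show ?case by auto
qed

lemma smooth_on_subset: "smooth_on S f \<Longrightarrow> T \<subseteq> S \<Longrightarrow> smooth_on T f"
  unfolding smooth_on_def using Ck_on_subset by blast

lemma null_cone_patch_subset:
  assumes "null_cone_patch F S" "open T" "T \<subseteq> S"
  shows "null_cone_patch F T"
proof -
  interpret null_cone_patch F S by fact
  show ?thesis
    using assms cone posdef smooth_on_subset[OF smooth] by unfold_locales auto
qed

context null_cone_patch
begin

lemma visible_patch:
  assumes x: "x \<in> S"
  shows "\<exists>t T. open T \<and> x \<in> T \<and> T \<subseteq> S \<and> (\<forall>y\<in>T. A t y < 0) \<and> null_cone_patch F T"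
proof -
  obtain t where t: "A t x < 0"
    using avoiding_pole[of "{F x}"] cone[OF x] by auto
  define T where "T = S \<inter> (\<lambda>y. A t y) -` {..<0}"
  have "open T"
    unfolding T_def
    by (rule continuous_open_preimage[OF smooth_on_continuous[OF smooth_coordinate] open_S open_lessThan])
  then show ?thesis
    using t x null_cone_patch_subset[OF null_cone_patch_axioms, of T] by (intro exI[of _ t] exI[of _ T]) (auto simp: T_def)
qed

lemma rescaled_metric:
  assumes x: "x \<in> S" and k: "smooth_on S k"
  shows "induced_metric (\<lambda>y. k y *\<^sub>R F y) x = (k x)\<^sup>2 *\<^sub>R G x"
proof -
  have d: "pdiff i (\<lambda>y. k y *\<^sub>R F y) x = k x *\<^sub>R D i x + pdiff i k x *\<^sub>R F x" for i
    by (rule pdiff_bilinear(1)[OF bounded_bilinear_scaleR smooth_on_differentiable[OF k x] diff_F[OF x]])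
  show ?thesis
    unfolding induced_metric_def d
    using D_F[OF x] F_null[OF x]
    by (simp add: vec_eq_iff lorentz_simps lorentz_sym[of "F x" "D _ x"] power2_eq_square)
qed

lemma rescaled_patch:
  assumes k: "smooth_on S k" and pos: "\<forall>y\<in>S. 0 < k y"
  shows "null_cone_patch (\<lambda>y. k y *\<^sub>R F y) S"
proof
  show "smooth_on S (\<lambda>y. k y *\<^sub>R F y)"
    by (intro smooth_on_scaleR open_S k smooth)
  show "k x *\<^sub>R F x \<in> future_light_cone" if "x \<in> S" for x
    using cone[OF that] pos that by (auto simp: future_light_cone_def lorentz_simps)
  show "0 < metric_inner (induced_metric (\<lambda>y. k y *\<^sub>R F y) x) v v" if "x \<in> S" "v \<noteq> 0" for x v
  proof -
    have "metric_inner (induced_metric (\<lambda>y. k y *\<^sub>R F y) x) v v = (k x)\<^sup>2 * metric_inner (G x) v v"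
      unfolding rescaled_metric[OF that(1) k] by (simp add: metric_inner_2 sum_2 algebra_simps)
    moreover have "k x \<noteq> 0" using pos that(1) by fastforce
    ultimately show ?thesis using posdef[OF that] by simp
  qed
qed (rule open_S)

text \<open>
  \<open>F\<close> and \<open>k F\<close> have the same stereographic coordinates, so the same jets \<open>v, q\<close> and \<open>w, p\<close> compute both
  Laplacians by \<open>straight_jet_laplacian\<close>.
\<close>

lemma rescaled_laplacian:
  assumes x: "x \<in> S" and k: "smooth_on S k" and pos: "\<forall>y\<in>S. 0 < k y" and f: "smooth_on S f"
  shows "(k x)\<^sup>2 * laplacian (induced_metric (\<lambda>y. k y *\<^sub>R F y)) f x = laplacian G f x"
proof -
  obtain t T where T: "open T" "x \<in> T" "T \<subseteq> S" "\<forall>y\<in>T. A t y < 0" "null_cone_patch F T"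
    using visible_patch[OF x] by blast
  interpret P: null_cone_patch F T by fact
  have kT: "smooth_on T k" "\<forall>y\<in>T. 0 < k y" "smooth_on T f"
    using smooth_on_subset[OF k T(3)] smooth_on_subset[OF f T(3)] pos T(3) by auto
  interpret R: null_cone_patch "\<lambda>y. k y *\<^sub>R F y" T
    by (rule P.rescaled_patch[OF kT(1,2)])
  have nz: "\<forall>y\<in>T. P.A t y \<noteq> 0" using T(4) by fastforce
  then have nz': "\<forall>y\<in>T. R.A t y \<noteq> 0" using kT(2) by (fastforce simp: lorentz_simps)
  obtain v q where v: "P.straight_jet t x 1 v q" using P.straight_jet_exists[OF T(2) nz] by blast
  obtain w p where w: "P.straight_jet t x (\<i> * 1) w p" using P.straight_jet_exists[OF T(2) nz] by blast
  have Zeq: "(k y *\<^sub>R lorentz (F y) a) / (k y *\<^sub>R lorentz (F y) b) = lorentz (F y) a / lorentz (F y) b"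
    if "y \<in> T" for y a b
    using kT(2) that by fastforce
  have pZ: "pdiff i (\<lambda>y. lorentz (k y *\<^sub>R F y) a / lorentz (k y *\<^sub>R F y) b) y
      = pdiff i (\<lambda>y. lorentz (F y) a / lorentz (F y) b) y" if "y \<in> T" for y i a b
    by (rule pdiff_cong[OF T(1) that]) (simp only: lorentz_simps Zeq)
  have ppZ: "pdiff j (pdiff i (\<lambda>y. lorentz (k y *\<^sub>R F y) a / lorentz (k y *\<^sub>R F y) b)) x
      = pdiff j (pdiff i (\<lambda>y. lorentz (F y) a / lorentz (F y) b)) x" for i j a b
    by (rule pdiff_cong[OF T(1,2) pZ])
  have v': "R.straight_jet t x 1 v q" and w': "R.straight_jet t x (\<i> * 1) w p"
    using v w unfolding P.straight_jet_def R.straight_jet_def dir1_def dir2_def ppZ pZ[OF T(2)] by auto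
  have "(cmod 1)\<^sup>2 * (P.A t x)\<^sup>2 * laplacian G f x
      = (cmod 1)\<^sup>2 * (R.A t x)\<^sup>2 * laplacian (induced_metric (\<lambda>y. k y *\<^sub>R F y)) f x"
    using P.straight_jet_laplacian[OF T(2) nz kT(3) v w] R.straight_jet_laplacian[OF T(2) nz' kT(3) v' w'] by simp
  then show ?thesis using bspec[OF nz T(2)] by (simp add: lorentz_simps power_mult_distrib)
qed

text \<open>
  Both metrics satisfy the Liouville equation, and the logarithms of their heights over a common
  pole differ by \<open>ln l\<close>.
\<close>

lemma conformal_factor_laplacian:
  assumes x: "x \<in> S" and l: "smooth_on S l" and pos: "\<forall>y\<in>S. 0 < l y"
  shows "laplacian (induced_metric (\<lambda>y. (1 / l y) *\<^sub>R F y)) (\<lambda>y. ln (l y)) x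
     = (l x)\<^sup>2 * trh x + gauss_curvature (induced_metric (\<lambda>y. (1 / l y) *\<^sub>R F y)) x"
proof -
  let ?F = "\<lambda>y. (1 / l y) *\<^sub>R F y"
  obtain t T where T: "open T" "x \<in> T" "T \<subseteq> S" "\<forall>y\<in>T. A t y < 0" "null_cone_patch F T"
    using visible_patch[OF x] by blast
  interpret P: null_cone_patch F T by fact
  have l0: "\<forall>y\<in>S. l y \<noteq> 0" using pos by fastforce
  have k: "smooth_on S (\<lambda>y. 1 / l y)"
    using l0 by (intro smooth_on_divide smooth_on_const open_S l) auto
  have kT: "smooth_on T (\<lambda>y. 1 / l y)" "\<forall>y\<in>T. 0 < 1 / l y"
    using smooth_on_subset[OF k T(3)] pos T(3) by auto
  interpret R: null_cone_patch ?F T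
    by (rule P.rescaled_patch[OF kT])
  have nR: "R.A t y < 0" if "y \<in> T" for y
    using T(4) kT(2) that by (simp add: lorentz_simps divide_neg_pos)
  define a where "a = (\<lambda>y. ln (- lorentz (F y) (pole t)))"
  define b where "b = (\<lambda>y. ln (- lorentz (?F y) (pole t)))"
  have sb: "smooth_on T b" unfolding b_def
    by (intro smooth_on_ln smooth_on_minus R.smooth_coordinate T(1)) (use nR in force)
  have sl: "smooth_on T (\<lambda>y. ln (l y))"
    using smooth_on_subset[OF l T(3)] pos T(3) by (intro smooth_on_ln T(1)) auto
  have sa: "smooth_on T a" unfolding a_def
    by (intro smooth_on_ln smooth_on_minus P.smooth_coordinate T(1)) (use T(4) in force)
  have "laplacian (induced_metric ?F) a x = laplacian (induced_metric ?F) (\<lambda>y. ln (l y) + b y) x"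
  proof (rule laplacian_cong[OF T(1,2)])
    fix y assume y: "y \<in> T"
    then have "0 < l y" "0 < - lorentz (F y) (pole t)" using pos T(3,4) by auto
    then have "a y = ln (l y * (- lorentz (F y) (pole t) / l y))" by (simp add: a_def)
    also have "\<dots> = ln (l y) + b y"
      unfolding b_def using \<open>0 < l y\<close> \<open>0 < - lorentz (F y) (pole t)\<close>
      by (subst ln_mult) (auto simp: lorentz_simps divide_neg_pos)
    finally show "a y = ln (l y) + b y" .
  qed simp
  also have "\<dots> = laplacian (induced_metric ?F) (\<lambda>y. ln (l y)) x + laplacian (induced_metric ?F) b x"
    by (rule laplacian_add[OF T(1,2) sl sb])
  also have "laplacian (induced_metric ?F) b x = - gauss_curvature (induced_metric ?F) x"
    unfolding b_def using R.laplacian_ln_height[OF T(2) nR pole_null] R.gauss_curvature_eq[OF T(2)] by simp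
  also have "laplacian (induced_metric ?F) a x = (l x)\<^sup>2 * trh x"
  proof -
    have "(1 / l x)\<^sup>2 * laplacian (induced_metric ?F) a x = laplacian G a x"
      by (rule P.rescaled_laplacian[OF T(2) kT sa])
    also have "\<dots> = trh x"
      unfolding a_def by (rule P.laplacian_ln_height[OF T(2) _ pole_null]) (use T(4) in blast)
    finally show ?thesis using bspec[OF l0 x] by (simp add: power_divide field_simps)
  qed
  finally show ?thesis by simp
qed

end

section \<open>The conformal factor of a weakly trapped immersion\<close>

text \<open>
  What remains of a weakly trapped immersion: \<open>\<Psi>\<close> is the immersion divided by the conformal factor,
  and \<open>f\<close> is the logarithm of this factor.
\<close>

locale light_cone_surface =
  fixes A :: "('a::{t2_space,second_countable_topology}) chart set"
    and g :: "'a chart \<Rightarrow> real^2 \<Rightarrow> real^2^2"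
    and \<Psi> :: "'a \<Rightarrow> real^4" and f :: "'a \<Rightarrow> real"
  assumes surface: "riemannian_surface A g"
    and patch: "c \<in> A \<Longrightarrow> null_cone_patch (\<Psi> \<circ> chart_inv c) (chart_img c)"
    and isometric: "c \<in> A \<Longrightarrow> x \<in> chart_img c \<Longrightarrow> induced_metric (\<Psi> \<circ> chart_inv c) x = g c x"
    and smooth_f: "surface_smooth A f"
    and laplacian_f: "c \<in> A \<Longrightarrow> x \<in> chart_img c \<Longrightarrow>
      gauss_curvature (g c) x \<le> laplacian (g c) (f \<circ> chart_inv c) x"

lemma chart_facts:
  assumes "smooth_surface A" "c \<in> A"
  shows "open (chart_dom c)" "open (chart_img c)"
    "homeomorphism (chart_dom c) (chart_img c) (chart_map c) (chart_inv c)"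
  using assms by (auto simp: smooth_surface_def)

lemma surface_charts_nonempty:
  assumes "smooth_surface (A :: ('a::{t2_space,second_countable_topology}) chart set)"
  shows "\<exists>c\<in>A. chart_img c \<noteq> {}"
proof -
  obtain c where "c \<in> A" "(undefined :: 'a) \<in> chart_dom c"
    using assms unfolding smooth_surface_def by blast
  then show ?thesis by (auto simp: chart_img_def)
qed

text \<open>
  Since \<open>\<theta>\<^sub>\<xi> = 1\<close>, only the second alternative of weak trappedness is possible. It gives \<open>\<theta>\<^sub>\<eta> \<ge> 0\<close>, which is the
  first term of \<open>conformal_factor_laplacian\<close>.
\<close>

lemma trapped_light_cone_surface:
  fixes A :: "('a::{t2_space,second_countable_topology}) chart set"
  assumes surf: "riemannian_surface A g"
    and sp: "spacelike_immersion A \<psi>" and cone: "range \<psi> \<subseteq> future_light_cone"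
    and wt: "weakly_trapped A \<psi>"
    and lam: "surface_smooth A lam" "\<forall>p. 0 < lam p"
    and conf: "conformal_with_factor A g \<psi> lam"
  shows "light_cone_surface A g (\<lambda>p. (1 / lam p) *\<^sub>R \<psi> p) (\<lambda>p. ln (lam p))"
proof (rule light_cone_surface.intro)
  have sm: "smooth_surface A" using surf by (simp add: riemannian_surface_def)
  show "riemannian_surface A g" by (rule surf)
  have ncp: "null_cone_patch (\<psi> \<circ> chart_inv c) (chart_img c)" if c: "c \<in> A" for c
  proof
    show "open (chart_img c)" by (rule chart_facts[OF sm c])
    show "smooth_on (chart_img c) (\<psi> \<circ> chart_inv c)"
      using sp c by (simp add: spacelike_immersion_def surface_smooth_def)
    show "(\<psi> \<circ> chart_inv c) x \<in> future_light_cone" for x using cone by auto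
    show "0 < metric_inner (induced_metric (\<psi> \<circ> chart_inv c) x) v v" if x: "x \<in> chart_img c" and v: "v \<noteq> 0" for x v
    proof -
      have "metric_inner (induced_metric (\<psi> \<circ> chart_inv c) x) v v
          = (lam (chart_inv c x))\<^sup>2 * metric_inner (g c x) v v"
        using conf c x by (simp add: conformal_with_factor_def metric_inner_2 sum_2 algebra_simps)
      moreover have "0 < metric_inner (g c x) v v"
        using surf c x v unfolding riemannian_surface_def by blast
      moreover have "0 < (lam (chart_inv c x))\<^sup>2" using lam(2) by (simp add: less_imp_neq[THEN not_sym])
      ultimately show ?thesis by simp
    qed
  qed
  have k: "smooth_on (chart_img c) (lam \<circ> chart_inv c)" if "c \<in> A" for c
    using lam(1) that by (simp add: surface_smooth_def)
  have l0: "lam p \<noteq> 0" for p using lam(2) by (metis less_irrefl)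
  have k': "smooth_on (chart_img c) (\<lambda>x. 1 / lam (chart_inv c x))" if c: "c \<in> A" for c
    using smooth_on_divide[OF chart_facts(2)[OF sm c] smooth_on_const k[OF c]] l0 by simp
  have comp: "(\<lambda>p. (1 / lam p) *\<^sub>R \<psi> p) \<circ> chart_inv c
      = (\<lambda>x. (1 / lam (chart_inv c x)) *\<^sub>R (\<psi> \<circ> chart_inv c) x)" for c
    by (simp add: fun_eq_iff)
  show "null_cone_patch ((\<lambda>p. (1 / lam p) *\<^sub>R \<psi> p) \<circ> chart_inv c) (chart_img c)" if c: "c \<in> A" for c
    unfolding comp by (rule null_cone_patch.rescaled_patch[OF ncp[OF c] k'[OF c]]) (use lam(2) in simp)
  show iso: "induced_metric ((\<lambda>p. (1 / lam p) *\<^sub>R \<psi> p) \<circ> chart_inv c) x = g c x"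
    if c: "c \<in> A" and x: "x \<in> chart_img c" for c x
  proof -
    have "induced_metric (\<psi> \<circ> chart_inv c) x = (lam (chart_inv c x))\<^sup>2 *\<^sub>R g c x"
      using conf c x unfolding conformal_with_factor_def by blast
    then show ?thesis
      unfolding comp null_cone_patch.rescaled_metric[OF ncp[OF c] x k'[OF c]]
      using l0 by (simp add: power_divide)
  qed
  show "surface_smooth A (\<lambda>p. ln (lam p))"
    unfolding surface_smooth_def o_def
    using smooth_on_ln[OF chart_facts(2)[OF sm] k] lam(2) by (simp add: o_def)
  show "gauss_curvature (g c) x \<le> laplacian (g c) ((\<lambda>p. ln (lam p)) \<circ> chart_inv c) x"
    if c: "c \<in> A" and x: "x \<in> chart_img c" for c x
  proof -
    interpret P: null_cone_patch "\<psi> \<circ> chart_inv c" "chart_img c" by (rule ncp[OF c])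
    have "0 \<le> null_expansion (\<psi> \<circ> chart_inv c) (null_eta (\<psi> \<circ> chart_inv c)) x"
    proof -
      obtain d y where d: "d \<in> A" "y \<in> chart_img d" using surface_charts_nonempty[OF sm] by blast
      have "null_expansion (\<psi> \<circ> chart_inv d) (\<psi> \<circ> chart_inv d) y = 1"
        by (rule null_cone_patch.null_expansion_position[OF ncp[OF d(1)] d(2)])
      then have "\<not> null_expansion (\<psi> \<circ> chart_inv d) (\<psi> \<circ> chart_inv d) y \<le> 0" by simp
      then show ?thesis
        using wt c x d unfolding weakly_trapped_def Let_def by blast
    qed
    then have trh: "0 \<le> P.trh x" unfolding P.null_expansion_eta[OF x] by simp
    have M: "induced_metric (\<lambda>y. (1 / lam (chart_inv c y)) *\<^sub>R (\<psi> \<circ> chart_inv c) y) y = g c y"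
      if "y \<in> chart_img c" for y
      using iso[OF c that] unfolding comp .
    have "laplacian (g c) ((\<lambda>p. ln (lam p)) \<circ> chart_inv c) x
        = laplacian (induced_metric (\<lambda>y. (1 / lam (chart_inv c y)) *\<^sub>R (\<psi> \<circ> chart_inv c) y)) (\<lambda>y. ln (lam (chart_inv c y))) x"
      by (rule laplacian_cong[OF P.open_S x]) (simp_all add: M[unfolded o_def])
    also have "\<dots> = (lam (chart_inv c x))\<^sup>2 * P.trh x
        + gauss_curvature (induced_metric (\<lambda>y. (1 / lam (chart_inv c y)) *\<^sub>R (\<psi> \<circ> chart_inv c) y)) x"
      using P.conformal_factor_laplacian[OF x k[OF c]] lam(2) by (simp add: o_def)
    also have "gauss_curvature (induced_metric (\<lambda>y. (1 / lam (chart_inv c y)) *\<^sub>R (\<psi> \<circ> chart_inv c) y)) x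
        = gauss_curvature (g c) x"
      by (rule gauss_curvature_cong[OF P.open_S x M])
    finally show ?thesis
      using mult_nonneg_nonneg[OF zero_le_power2[of "lam (chart_inv c x)"] trh] by linarith
  qed
qed

lemma (in light_cone_surface) parabolic_imp_flat:
  assumes par: "parabolic_surface A g" and nn: "nonneg_curvature A g" and bdd: "bdd_above (range f)"
  shows "flat_surface A g"
proof -
  have sub: "subharmonic A g f"
    using smooth_f laplacian_f nn
    unfolding subharmonic_def surface_smooth_def surface_Ck_def smooth_on_def nonneg_curvature_def
    by (meson order_trans)
  then have "f constant_on UNIV" using par bdd unfolding parabolic_surface_def by blast
  then obtain k where k: "f = (\<lambda>p. k)" unfolding constant_on_def by auto
  have "laplacian M (f \<circ> chart_inv c) x = 0" for M c x
  proof -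
    have "f \<circ> chart_inv c = (\<lambda>x. k)" by (simp add: k fun_eq_iff)
    moreover have "pdiff i (\<lambda>x. k) = (\<lambda>x. 0)" for i :: 2 by (simp add: fun_eq_iff pdiff_const)
    ultimately show ?thesis by (simp add: laplacian_def pdiff_const)
  qed
  then show ?thesis
    using laplacian_f nn unfolding flat_surface_def nonneg_curvature_def by (metis order_antisym)
qed

section \<open>The Riemannian distance\<close>

lemma metric_inner_posI:
  assumes "riemannian_surface A g" "c \<in> A" "x \<in> chart_img c"
  shows "0 \<le> metric_inner (g c x) v v" "v \<noteq> 0 \<Longrightarrow> 0 < metric_inner (g c x) v v"
proof -
  show p: "v \<noteq> 0 \<Longrightarrow> 0 < metric_inner (g c x) v v"
    using assms unfolding riemannian_surface_def by blast
  show "0 \<le> metric_inner (g c x) v v"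
    by (cases "v = 0") (use p in \<open>auto simp: metric_inner_def\<close>)
qed

lemma metric_inner_scaleR: "metric_inner M (a *\<^sub>R v) (a *\<^sub>R v) = a\<^sup>2 * metric_inner M v v"
  by (simp add: metric_inner_2 sum_2 power2_eq_square algebra_simps)

locale connected_surface =
  fixes A :: "('a::{t2_space,second_countable_topology}) chart set"
    and g :: "'a chart \<Rightarrow> real^2 \<Rightarrow> real^2^2"
  assumes surf: "riemannian_surface A g" and conn: "connected (UNIV :: 'a set)"
begin

abbreviation "PL \<equiv> path_length A g"
abbreviation "d \<equiv> riemannian_dist A g"

lemma smooth_atlas: "smooth_surface A"
  using surf by (simp add: riemannian_surface_def)

lemmas open_dom = chart_facts(1)[OF smooth_atlas] and open_img = chart_facts(2)[OF smooth_atlas]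
  and chart_homeo = chart_facts(3)[OF smooth_atlas]

lemma smooth_g: "c \<in> A \<Longrightarrow> smooth_on (chart_img c) (g c)"
  using surf by (simp add: riemannian_surface_def)

lemma continuous_g: "c \<in> A \<Longrightarrow> continuous_on (chart_img c) (g c)"
  by (rule smooth_on_continuous[OF smooth_g])

lemma inv_dom: "c \<in> A \<Longrightarrow> x \<in> chart_img c \<Longrightarrow> chart_inv c x \<in> chart_dom c"
  and map_inv: "c \<in> A \<Longrightarrow> x \<in> chart_img c \<Longrightarrow> chart_map c (chart_inv c x) = x"
  and inv_map: "c \<in> A \<Longrightarrow> p \<in> chart_dom c \<Longrightarrow> chart_inv c (chart_map c p) = p"
  using homeomorphism_image2[OF chart_homeo] homeomorphism_apply2[OF chart_homeo]
    homeomorphism_apply1[OF chart_homeo] by blast+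

lemma map_img: "p \<in> chart_dom c \<Longrightarrow> chart_map c p \<in> chart_img c"
  by (simp add: chart_img_def)

lemma chart_at: "\<exists>c\<in>A. p \<in> chart_dom c"
  using smooth_atlas unfolding smooth_surface_def by blast

definition speed :: "'a chart \<Rightarrow> (real \<Rightarrow> real^2) \<Rightarrow> real \<Rightarrow> real" where
  "speed c \<gamma> t = (let v = vector_derivative \<gamma> (at t) in sqrt (metric_inner (g c (\<gamma> t)) v v))"

lemma speed_eq:
  "(\<gamma> has_vector_derivative v) (at t) \<Longrightarrow> speed c \<gamma> t = sqrt (metric_inner (g c (\<gamma> t)) v v)"
  by (simp add: speed_def vector_derivative_at)

text \<open>
  The predicate \<open>path_length\<close> only accepts arcs over the unit interval. To cut and to reverse paths, pieces of
  an arc are reparametrised affinely; \<open>\<Phi>\<close> is the arc length measured from the start.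
\<close>

lemma arc_length:
  assumes c: "c \<in> A" and C1: "\<gamma> C1_differentiable_on {0..1}" and im: "\<gamma> ` {0..1} \<subseteq> chart_img c"
  obtains \<Phi> where "\<Phi> 0 = 0" "\<Phi> 1 = integral {0..1} (speed c \<gamma>)"
    "\<And>t. t \<in> {0..1} \<Longrightarrow> (\<Phi> has_real_derivative speed c \<gamma> t) (at t within {0..1})"
    "\<And>s t. 0 \<le> s \<Longrightarrow> s \<le> t \<Longrightarrow> t \<le> 1 \<Longrightarrow> \<Phi> s \<le> \<Phi> t"
    "\<And>s t. s \<in> {0..1} \<Longrightarrow> t \<in> {0..1} \<Longrightarrow> PL (chart_inv c (\<gamma> s)) (chart_inv c (\<gamma> t)) \<bar>\<Phi> t - \<Phi> s\<bar>"
proof -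
  obtain D where D: "\<And>t. t \<in> {0..1} \<Longrightarrow> (\<gamma> has_vector_derivative D t) (at t)" "continuous_on {0..1} D"
    using C1 unfolding C1_differentiable_on_def by blast
  have \<gamma>: "continuous_on {0..1} \<gamma>"
    by (rule continuous_at_imp_continuous_on) (use D(1) has_vector_derivative_continuous in blast)
  have sp: "speed c \<gamma> t = sqrt (metric_inner (g c (\<gamma> t)) (D t) (D t))" if "t \<in> {0..1}" for t
    by (rule speed_eq[OF D(1)[OF that]])
  have G: "continuous_on {0..1} (\<lambda>t. g c (\<gamma> t))"
    by (rule continuous_on_compose2[OF continuous_g[OF c] \<gamma> im])
  have "continuous_on {0..1} (\<lambda>t. sqrt (metric_inner (g c (\<gamma> t)) (D t) (D t)))"
    unfolding metric_inner_2 sum_2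
    by (intro continuous_intros G D(2))
  then have cs: "continuous_on {0..1} (speed c \<gamma>)"
    by (rule continuous_on_eq) (simp add: sp)
  have sp0: "0 \<le> speed c \<gamma> t" if "t \<in> {0..1}" for t
    using sp[OF that] metric_inner_posI(1)[OF surf c] im that by (simp add: image_subset_iff)
  define \<Phi> where "\<Phi> t = integral {0..t} (speed c \<gamma>)" for t
  have d\<Phi>: "(\<Phi> has_real_derivative speed c \<gamma> t) (at t within {0..1})" if "t \<in> {0..1}" for t
    using integral_has_vector_derivative[OF cs that]
    unfolding has_real_derivative_iff_has_vector_derivative \<Phi>_def .
  have mono: "\<Phi> s \<le> \<Phi> t" if "0 \<le> s" "s \<le> t" "t \<le> 1" for s t
    unfolding \<Phi>_def
    by (rule integral_subset_le)
      (use that sp0 integrable_continuous_interval[OF continuous_on_subset[OF cs]] in auto)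
  have piece: "PL (chart_inv c (\<gamma> s)) (chart_inv c (\<gamma> t)) \<bar>\<Phi> t - \<Phi> s\<bar>" if st: "s \<in> {0..1}" "t \<in> {0..1}" for s t
  proof -
    define \<tau> where "\<tau> r = s + (t - s) * r" for r
    define \<delta> where "\<delta> r = \<gamma> (\<tau> r)" for r
    have \<tau>: "\<tau> r \<in> {0..1}" if "r \<in> {0..1}" for r
    proof -
      have e: "\<tau> r = (1 - r) * s + r * t" by (simp add: \<tau>_def algebra_simps)
      have "(1 - r) * s + r * t \<le> (1 - r) * 1 + r * 1"
        using that st by (intro add_mono mult_left_mono) auto
      moreover have "0 \<le> (1 - r) * s + r * t" using that st by auto
      ultimately show ?thesis unfolding e by simp
    qed
    have d\<tau>: "(\<tau> has_real_derivative (t - s)) (at r within X)" for r X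
      unfolding \<tau>_def by (auto intro!: derivative_eq_intros)
    have d\<delta>: "(\<delta> has_vector_derivative (t - s) *\<^sub>R D (\<tau> r)) (at r)" if "r \<in> {0..1}" for r
      unfolding \<delta>_def
      using vector_diff_chain_at[of \<tau> "t - s" r \<gamma> "D (\<tau> r)"] d\<tau>[of r UNIV] D(1)[OF \<tau>[OF that]]
      by (simp add: o_def has_real_derivative_iff_has_vector_derivative)
    have c\<tau>: "continuous_on {0..1} \<tau>" unfolding \<tau>_def by (intro continuous_intros)
    have C1\<delta>: "\<delta> C1_differentiable_on {0..1}"
      unfolding C1_differentiable_on_def
      using d\<delta> \<tau> by (intro exI[of _ "\<lambda>r. (t - s) *\<^sub>R D (\<tau> r)"])
        (auto intro!: continuous_intros continuous_on_compose2[OF D(2) c\<tau>])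
    have im\<delta>: "\<delta> ` {0..1} \<subseteq> chart_img c" using im \<tau> by (auto simp: \<delta>_def)
    have sp\<delta>: "speed c \<delta> r = \<bar>t - s\<bar> * speed c \<gamma> (\<tau> r)" if "r \<in> {0..1}" for r
      unfolding speed_eq[OF d\<delta>[OF that]] sp[OF \<tau>[OF that]] \<delta>_def metric_inner_scaleR
      by (simp add: real_sqrt_mult)
    have "((\<lambda>r. sgn (t - s) * \<Phi> (\<tau> r)) has_real_derivative \<bar>t - s\<bar> * speed c \<gamma> (\<tau> r)) (at r within {0..1})"
      if "r \<in> {0..1}" for r
    proof -
      have "(\<Phi> has_real_derivative speed c \<gamma> (\<tau> r)) (at (\<tau> r) within \<tau> ` {0..1})"
        using d\<Phi>[OF \<tau>[OF that]] by (rule has_field_derivative_subset) (use \<tau> in auto)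
      from DERIV_image_chain[OF this d\<tau>]
      have "((\<lambda>r. \<Phi> (\<tau> r)) has_real_derivative speed c \<gamma> (\<tau> r) * (t - s)) (at r within {0..1})"
        by (simp add: o_def)
      then have "((\<lambda>r. sgn (t - s) * \<Phi> (\<tau> r)) has_real_derivative sgn (t - s) * (speed c \<gamma> (\<tau> r) * (t - s))) (at r within {0..1})"
        by (rule DERIV_cmult)
      moreover have "sgn (t - s) * (speed c \<gamma> (\<tau> r) * (t - s)) = \<bar>t - s\<bar> * speed c \<gamma> (\<tau> r)"
        by (simp add: abs_sgn mult_ac)
      ultimately show ?thesis by simp
    qed
    then have "((\<lambda>r. \<bar>t - s\<bar> * speed c \<gamma> (\<tau> r)) has_integral sgn (t - s) * \<Phi> (\<tau> 1) - sgn (t - s) * \<Phi> (\<tau> 0)) {0..1}"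
      by (intro fundamental_theorem_of_calculus) (auto simp: has_real_derivative_iff_has_vector_derivative)
    moreover have "sgn (t - s) * \<Phi> (\<tau> 1) - sgn (t - s) * \<Phi> (\<tau> 0) = \<bar>\<Phi> t - \<Phi> s\<bar>"
      using mono[of s t] mono[of t s] st by (auto simp: \<tau>_def sgn_if)
    ultimately have "((speed c \<delta>) has_integral \<bar>\<Phi> t - \<Phi> s\<bar>) {0..1}"
      using has_integral_eq[of "{0..1}" "\<lambda>r. \<bar>t - s\<bar> * speed c \<gamma> (\<tau> r)" "speed c \<delta>"] sp\<delta> by auto
    then have "integral {0..1} (speed c \<delta>) = \<bar>\<Phi> t - \<Phi> s\<bar>" by (rule integral_unique)
    moreover have "PL (chart_inv c (\<delta> 0)) (chart_inv c (\<delta> 1)) (0 + integral {0..1} (speed c \<delta>))"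
      unfolding speed_def[abs_def] by (rule path_length.step[OF path_length.refl c C1\<delta> im\<delta>])
    ultimately show ?thesis by (simp add: \<delta>_def \<tau>_def)
  qed
  show ?thesis
    by (rule that[of \<Phi>]) (use d\<Phi> mono piece in \<open>auto simp: \<Phi>_def\<close>)
qed

lemma PL_trans: "PL q r M \<Longrightarrow> PL p q L \<Longrightarrow> PL p r (L + M)"
proof (induction rule: path_length.induct)
  case (refl q)
  then show ?case by simp
next
  case (step q c \<gamma> M)
  show ?case
    using path_length.step[OF step.IH[OF step.prems] step.hyps(2-4)] by (simp add: add.assoc)
qed

text \<open>
  Nonnegativity, symmetry and divisibility are proved in one induction, as each of them only depends on
  \<open>arc_length\<close> for the last arc. A prescribed length inside the last arc is attained by the intermediate
  value theorem.
\<close>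

lemma PL_arc_cases:
  assumes "PL p q L"
  shows "0 \<le> L \<and> PL q p L \<and> (\<forall>l. 0 \<le> l \<and> l \<le> L \<longrightarrow> (\<exists>m. PL p m l \<and> PL m q (L - l)))"
  using assms
proof (induction rule: path_length.induct)
  case (refl p)
  then show ?case using path_length.refl[of A g p] by auto
next
  case (step p c \<gamma> L)
  obtain \<Phi> where \<Phi>: "\<Phi> 0 = 0" "\<Phi> 1 = integral {0..1} (speed c \<gamma>)"
    "\<And>t. t \<in> {0..1} \<Longrightarrow> (\<Phi> has_real_derivative speed c \<gamma> t) (at t within {0..1})"
    "\<And>s t. 0 \<le> s \<Longrightarrow> s \<le> t \<Longrightarrow> t \<le> 1 \<Longrightarrow> \<Phi> s \<le> \<Phi> t"
    "\<And>s t. s \<in> {0..1} \<Longrightarrow> t \<in> {0..1} \<Longrightarrow> PL (chart_inv c (\<gamma> s)) (chart_inv c (\<gamma> t)) \<bar>\<Phi> t - \<Phi> s\<bar>"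
    using arc_length[OF step.hyps(2-4)] by blast
  let ?p = "chart_inv c (\<gamma> 0)" and ?q = "chart_inv c (\<gamma> 1)"
  have len: "L + integral {0..1} (\<lambda>t. let v = vector_derivative \<gamma> (at t) in sqrt (metric_inner (g c (\<gamma> t)) v v))
      = L + \<Phi> 1"
    unfolding \<Phi>(2) speed_def[abs_def] ..
  have p1: "0 \<le> \<Phi> 1" using \<Phi>(4)[of 0 1] \<Phi>(1) by simp
  have rev: "PL ?q p (\<Phi> 1 + L)"
    using PL_trans[OF _ \<Phi>(5)[of 1 0], of p L] step.IH p1 \<Phi>(1) by simp
  have "\<exists>m. PL p m l \<and> PL m ?q (L + \<Phi> 1 - l)" if l: "0 \<le> l" "l \<le> L + \<Phi> 1" for l
  proof (cases "l \<le> L")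
    case True
    then obtain m where m: "PL p m l" "PL m ?p (L - l)" using step.IH l(1) by blast
    have "PL m ?q (L - l + \<Phi> 1)"
      using PL_trans[OF \<Phi>(5)[of 0 1] m(2)] \<Phi>(1) p1 by simp
    then show ?thesis using m(1) by (auto simp: algebra_simps)
  next
    case False
    have "continuous_on {0..1} \<Phi>"
      by (rule DERIV_continuous_on) (rule \<Phi>(3))
    then obtain t where t: "0 \<le> t" "t \<le> 1" "\<Phi> t = l - L"
      using IVT'[of \<Phi> 0 "l - L" 1] False l \<Phi>(1) by auto
    have m1: "PL p (chart_inv c (\<gamma> t)) l"
      using PL_trans[OF \<Phi>(5)[of 0 t] step.hyps(1)] t \<Phi>(1) False by simp
    have m2: "PL (chart_inv c (\<gamma> t)) ?q (L + \<Phi> 1 - l)"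
      using \<Phi>(5)[of t 1] \<Phi>(4)[of t 1] t by (simp add: algebra_simps)
    show ?thesis using m1 m2 by blast
  qed
  then show ?case
    unfolding len using rev step.IH p1 by (auto simp: add.commute)
qed

lemma PL_nonneg: "PL p q L \<Longrightarrow> 0 \<le> L"
  and PL_sym: "PL p q L \<Longrightarrow> PL q p L"
  and PL_split: "PL p q L \<Longrightarrow> 0 \<le> l \<Longrightarrow> l \<le> L \<Longrightarrow> \<exists>m. PL p m l \<and> PL m q (L - l)"
  using PL_arc_cases by blast+

end

lemma metric_inner_bounds:
  fixes M :: "real^2^2"
  assumes pos: "\<And>v. v \<noteq> 0 \<Longrightarrow> 0 < metric_inner M v v"
  obtains m b where "0 < m" "0 < b" "\<And>v. m * (norm v)\<^sup>2 \<le> metric_inner M v v" "\<And>v. metric_inner M v v \<le> b * (norm v)\<^sup>2"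
proof -
  let ?Q = "\<lambda>v. metric_inner M v v"
  have cont: "continuous_on (sphere 0 1) ?Q"
    unfolding metric_inner_2 sum_2 by (intro continuous_intros)
  have ne: "sphere (0::real^2) 1 \<noteq> {}" by simp
  obtain u where u: "u \<in> sphere 0 1" "\<And>v. v \<in> sphere 0 1 \<Longrightarrow> ?Q u \<le> ?Q v"
    using continuous_attains_inf[OF compact_sphere ne cont] by blast
  obtain w where w: "w \<in> sphere 0 1" "\<And>v. v \<in> sphere 0 1 \<Longrightarrow> ?Q v \<le> ?Q w"
    using continuous_attains_sup[OF compact_sphere ne cont] by blast
  have "u \<noteq> 0" "w \<noteq> 0" using u(1) w(1) by auto
  then have p: "0 < ?Q u" "0 < ?Q w" using pos by blast+
  have "?Q u * (norm v)\<^sup>2 \<le> ?Q v \<and> ?Q v \<le> ?Q w * (norm v)\<^sup>2" for v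
  proof (cases "v = 0")
    case True
    then show ?thesis by (simp add: metric_inner_def)
  next
    case False
    define z where "z = (1 / norm v) *\<^sub>R v"
    have z: "z \<in> sphere 0 1" "v = norm v *\<^sub>R z" using False by (simp_all add: z_def)
    have "?Q v = (norm v)\<^sup>2 * ?Q z" using metric_inner_scaleR[of M "norm v" z] z(2) by simp
    then show ?thesis using u(2)[OF z(1)] w(2)[OF z(1)] by (auto simp: mult.commute intro!: mult_right_mono)
  qed
  then show ?thesis using that[OF p] by blast
qed

lemma metric_inner_perturb:
  fixes M N :: "real^2^2"
  assumes "\<And>i j. \<bar>M $ i $ j - N $ i $ j\<bar> \<le> e"
  shows "\<bar>metric_inner M v v - metric_inner N v v\<bar> \<le> 4 * e * (norm v)\<^sup>2"
proof -
  have "\<bar>v $ i * (M $ i $ j - N $ i $ j) * v $ j\<bar> \<le> e * (norm v)\<^sup>2" for i j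
  proof -
    have "\<bar>v $ i\<bar> * \<bar>M $ i $ j - N $ i $ j\<bar> * \<bar>v $ j\<bar> \<le> norm v * e * norm v"
      using assms[of i j] component_le_norm_cart[of v] by (intro mult_mono mult_nonneg_nonneg) (auto intro: order_trans[OF abs_ge_zero])
    then show ?thesis by (simp add: abs_mult power2_eq_square mult_ac)
  qed note t = this
  have "metric_inner M v v - metric_inner N v v = (\<Sum>i\<in>UNIV. \<Sum>j\<in>UNIV. v $ i * (M $ i $ j - N $ i $ j) * v $ j)"
    by (simp add: metric_inner_2 sum_2 algebra_simps)
  also have "\<bar>\<dots>\<bar> \<le> 4 * (e * (norm v)\<^sup>2)"
    unfolding sum_2 using t[of 1 1] t[of 1 2] t[of 2 1] t[of 2 2] by linarith
  finally show ?thesis by simp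
qed

context connected_surface
begin

text \<open>
  The metric varies continuously, so near \<open>x\<close> it differs little from its value at \<open>x\<close>; the factors
  \<open>1 / 2\<close> and \<open>2\<close> do not depend on \<open>x\<close>, unlike \<open>m\<close> and \<open>b\<close>.
\<close>

lemma local_metric:
  assumes c: "c \<in> A" and x: "x \<in> chart_img c"
  obtains r m b where "0 < r" "0 < m" "0 < b" "cball x r \<subseteq> chart_img c"
    "\<And>v. m * (norm v)\<^sup>2 \<le> metric_inner (g c x) v v" "\<And>v. metric_inner (g c x) v v \<le> b * (norm v)\<^sup>2"
    "\<And>y v. y \<in> cball x r \<Longrightarrow> metric_inner (g c x) v v / 2 \<le> metric_inner (g c y) v v"
    "\<And>y v. y \<in> cball x r \<Longrightarrow> metric_inner (g c y) v v \<le> 2 * metric_inner (g c x) v v"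
proof -
  obtain m b where mb: "0 < m" "0 < b" "\<And>v. m * (norm v)\<^sup>2 \<le> metric_inner (g c x) v v"
    "\<And>v. metric_inner (g c x) v v \<le> b * (norm v)\<^sup>2"
    using metric_inner_bounds[of "g c x"] metric_inner_posI(2)[OF surf c x] by blast
  obtain r1 where r1: "r1 > 0" "cball x r1 \<subseteq> chart_img c"
    using open_img[OF c] x open_contains_cball by metis
  have "isCont (g c) x"
    using continuous_g[OF c] open_img[OF c] x continuous_on_eq_continuous_at by blast
  then obtain r2 where r2: "r2 > 0" "\<And>y. dist y x < r2 \<Longrightarrow> dist (g c y) (g c x) < m / 8"
    unfolding continuous_at_eps_delta using mb(1) by (metis divide_pos_pos zero_less_numeral)
  define r where "r = min r1 (r2 / 2)"
  have near: "\<bar>metric_inner (g c y) v v - metric_inner (g c x) v v\<bar> \<le> metric_inner (g c x) v v / 2"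
    if "y \<in> cball x r" for y v
  proof -
    have "dist y x < r2" using that r1 r2(1) by (auto simp: r_def dist_commute)
    then have d: "norm (g c y - g c x) < m / 8" using r2(2) by (simp add: dist_norm)
    have "\<bar>g c y $ i $ j - g c x $ i $ j\<bar> \<le> m / 8" for i j
    proof -
      have "\<bar>(g c y - g c x) $ i $ j\<bar> \<le> norm ((g c y - g c x) $ i)" by (rule component_le_norm_cart)
      also have "\<dots> \<le> norm (g c y - g c x)" by (rule Finite_Cartesian_Product.norm_nth_le)
      finally show ?thesis using d by simp
    qed
    from metric_inner_perturb[OF this, of v] mb(3)[of v] show ?thesis by simp
  qed
  have pos: "0 \<le> metric_inner (g c x) v v" for v by (rule metric_inner_posI[OF surf c x])
  show ?thesis
  proof (rule that[of r m b])
    show "0 < r" "cball x r \<subseteq> chart_img c" using r1 r2(1) subset_cball[of r r1 x] by (auto simp: r_def)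
    fix y v assume "y \<in> cball x r"
    from near[OF this, of v] show "metric_inner (g c x) v v / 2 \<le> metric_inner (g c y) v v"
      "metric_inner (g c y) v v \<le> 2 * metric_inner (g c x) v v" using pos[of v] by linarith+
  qed (use mb in auto)
qed

lemma segment_length:
  assumes c: "c \<in> A" and B: "convex B" "B \<subseteq> chart_img c" and xy: "x \<in> B" "y \<in> B"
    and le: "\<And>z. z \<in> B \<Longrightarrow> metric_inner (g c z) (y - x) (y - x) \<le> K"
  shows "\<exists>L. PL (chart_inv c x) (chart_inv c y) L \<and> L \<le> sqrt K"
proof -
  define \<gamma> where "\<gamma> t = x + t *\<^sub>R (y - x)" for t
  have D: "(\<gamma> has_vector_derivative (y - x)) (at t)" for t
    unfolding \<gamma>_def by (auto intro!: derivative_eq_intros)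
  have C1: "\<gamma> C1_differentiable_on {0..1}"
    unfolding C1_differentiable_on_def using D by (intro exI[of _ "\<lambda>t. y - x"]) auto
  have inB: "\<gamma> t \<in> B" if "t \<in> {0..1}" for t
  proof -
    have "\<gamma> t = (1 - t) *\<^sub>R x + t *\<^sub>R y" by (simp add: \<gamma>_def algebra_simps)
    then show ?thesis using convexD_alt[OF B(1) xy, of t] that by simp
  qed
  then have im: "\<gamma> ` {0..1} \<subseteq> chart_img c" using B(2) by auto
  obtain \<Phi> where \<Phi>: "\<Phi> 0 = 0" "\<And>t. t \<in> {0..1} \<Longrightarrow> (\<Phi> has_real_derivative speed c \<gamma> t) (at t within {0..1})"
    "\<And>s t. s \<in> {0..1} \<Longrightarrow> t \<in> {0..1} \<Longrightarrow> PL (chart_inv c (\<gamma> s)) (chart_inv c (\<gamma> t)) \<bar>\<Phi> t - \<Phi> s\<bar>"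
    using arc_length[OF c C1 im] by metis
  have sp: "\<bar>speed c \<gamma> t\<bar> \<le> sqrt K" if t: "t \<in> {0..1}" for t
    unfolding speed_eq[OF D] using le[OF inB[OF t]] metric_inner_posI(1)[OF surf c, of "\<gamma> t"] im t
    by (auto simp: image_subset_iff)
  have "norm (\<Phi> 1 - \<Phi> 0) \<le> sqrt K * norm (1 - 0 :: real)"
    by (rule field_differentiable_bound[where S = "{0..1}" and f' = "speed c \<gamma>"])
      (use \<Phi>(2) sp in auto)
  then have "\<bar>\<Phi> 1 - \<Phi> 0\<bar> \<le> sqrt K" by simp
  moreover have "PL (chart_inv c x) (chart_inv c y) \<bar>\<Phi> 1 - \<Phi> 0\<bar>"
    using \<Phi>(3)[of 0 1] by (simp add: \<gamma>_def)
  ultimately show ?thesis by blast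
qed

text \<open>
  The points that can be reached from \<open>p\<close> form an open set, and so do the others, because every point can
  be joined to its neighbours by coordinate segments.
\<close>

lemma PL_exists: "\<exists>L. PL p q L"
proof -
  have step: "\<exists>U. open U \<and> q \<in> U \<and> (\<forall>q'\<in>U. \<exists>L. PL q q' L)" for q
  proof -
    obtain c where c: "c \<in> A" "q \<in> chart_dom c" using chart_at by blast
    let ?x = "chart_map c q"
    obtain r m b where r: "0 < r" "cball ?x r \<subseteq> chart_img c"
      "\<And>v. metric_inner (g c ?x) v v \<le> b * (norm v)\<^sup>2"
      "\<And>y v. y \<in> cball ?x r \<Longrightarrow> metric_inner (g c y) v v \<le> 2 * metric_inner (g c ?x) v v"
      using local_metric[OF c(1) map_img[OF c(2)]] by metis
    define U where "U = chart_dom c \<inter> chart_map c -` ball ?x r"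
    have "open U" unfolding U_def
      by (rule continuous_open_preimage[OF homeomorphism_cont1[OF chart_homeo[OF c(1)]] open_dom[OF c(1)] open_ball])
    moreover have "q \<in> U" using c(2) r(1) by (simp add: U_def)
    moreover have "\<exists>L. PL q q' L" if "q' \<in> U" for q'
    proof -
      have q': "q' \<in> chart_dom c" "chart_map c q' \<in> cball ?x r" using that by (auto simp: U_def)
      have "\<exists>L. PL (chart_inv c ?x) (chart_inv c (chart_map c q')) L \<and>
          L \<le> sqrt (2 * metric_inner (g c ?x) (chart_map c q' - ?x) (chart_map c q' - ?x))"
        by (rule segment_length[OF c(1) convex_cball r(2)]) (use r(1,4) q' in auto)
      then show ?thesis using c q' by (auto simp: inv_map)
    qed
    ultimately show ?thesis by blast
  qed
  let ?R = "{q. \<exists>L. PL p q L}"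
  have "open ?R"
  proof (subst open_subopen, rule ballI)
    fix q assume "q \<in> ?R"
    then obtain L where L: "PL p q L" by blast
    obtain U where U: "open U" "q \<in> U" "\<forall>q'\<in>U. \<exists>L. PL q q' L" using step by blast
    have "U \<subseteq> ?R" using PL_trans[OF _ L] U(3) by blast
    then show "\<exists>T. open T \<and> q \<in> T \<and> T \<subseteq> ?R" using U by blast
  qed
  moreover have "open (- ?R)"
  proof (subst open_subopen, rule ballI)
    fix q assume q: "q \<in> - ?R"
    obtain U where U: "open U" "q \<in> U" "\<forall>q'\<in>U. \<exists>L. PL q q' L" using step by blast
    have "q' \<notin> ?R" if q': "q' \<in> U" for q'
    proof
      assume "q' \<in> ?R"
      then obtain L where L: "PL p q' L" by blast
      obtain M where "PL q' q M" using U(3) q' PL_sym by blast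
      then have "PL p q (L + M)" using PL_trans L by blast
      then show False using q by blast
    qed
    then show "\<exists>T. open T \<and> q \<in> T \<and> T \<subseteq> - ?R" using U by blast
  qed
  moreover have "p \<in> ?R" using path_length.refl[of A g p] by auto
  ultimately have "- ?R = {}"
    using connectedD[OF conn, of ?R "- ?R"] by blast
  then show ?thesis by blast
qed

lemma d_le: "PL p q L \<Longrightarrow> d p q \<le> L"
  unfolding riemannian_dist_def by (rule cInf_lower) (auto intro!: bdd_belowI[of _ 0] PL_nonneg)

lemma d_approx: "0 < e \<Longrightarrow> \<exists>L. PL p q L \<and> L < d p q + e"
  using cInf_lessD[of "{L. PL p q L}" "d p q + e"] PL_exists by (auto simp: riemannian_dist_def)

lemma d_greatest: "(\<And>L. PL p q L \<Longrightarrow> K \<le> L) \<Longrightarrow> K \<le> d p q"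
  unfolding riemannian_dist_def by (rule cInf_greatest) (use PL_exists in auto)

lemma d_nonneg: "0 \<le> d p q"
  by (rule d_greatest) (rule PL_nonneg)

lemma d_self: "d p p = 0"
  using d_le[OF path_length.refl] d_nonneg[of p p] by (simp add: order_antisym)

lemma d_sym: "d p q = d q p"
proof -
  have "d p q \<le> d q p" for p q by (rule d_greatest) (rule d_le[OF PL_sym])
  then show ?thesis by (intro order_antisym)
qed

lemma d_triangle: "d p r \<le> d p q + d q r"
proof (rule field_le_epsilon)
  fix e :: real assume "0 < e"
  then obtain L M where "PL p q L" "L < d p q + e / 2" "PL q r M" "M < d q r + e / 2"
    using d_approx[of "e / 2"] by (metis half_gt_zero)
  then show "d p r \<le> d p q + d q r + e" using d_le[OF PL_trans, of q r M p L] by linarith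
qed

lemma d_segment:
  assumes "c \<in> A" "convex B" "B \<subseteq> chart_img c" "x \<in> B" "y \<in> B"
    and "\<And>z. z \<in> B \<Longrightarrow> metric_inner (g c z) (y - x) (y - x) \<le> K"
  shows "d (chart_inv c x) (chart_inv c y) \<le> sqrt K"
  using segment_length[OF assms] d_le by fastforce

text \<open>
  The bound is integrated along paths. Local lower bounds for the distance are obtained by applying this to
  suitable functions.
\<close>

lemma bounded_gradient_lipschitz:
  fixes h :: "'a \<Rightarrow> 'b::euclidean_space"
  assumes C: "0 \<le> C" and dh: "\<And>c x. c \<in> A \<Longrightarrow> x \<in> chart_img c \<Longrightarrow> (h \<circ> chart_inv c) differentiable at x"
    and bd: "\<And>c x v. c \<in> A \<Longrightarrow> x \<in> chart_img c \<Longrightarrow>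
      norm (frechet_derivative (h \<circ> chart_inv c) (at x) v) \<le> C * sqrt (metric_inner (g c x) v v)"
  shows "norm (h p - h q) \<le> C * d p q"
proof -
  have PL: "norm (h p - h q) \<le> C * L" if "PL p q L" for p q L
    using that
  proof (induction rule: path_length.induct)
    case (refl p)
    then show ?case by simp
  next
    case (step p c \<gamma> L)
    obtain D where D: "\<And>t. t \<in> {0..1} \<Longrightarrow> (\<gamma> has_vector_derivative D t) (at t)"
      using step.hyps(3) unfolding C1_differentiable_on_def by blast
    obtain \<Phi> where \<Phi>: "\<Phi> 0 = 0" "\<Phi> 1 = integral {0..1} (speed c \<gamma>)"
      "\<And>t. t \<in> {0..1} \<Longrightarrow> (\<Phi> has_real_derivative speed c \<gamma> t) (at t within {0..1})"
      using arc_length[OF step.hyps(2-4)] by metis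
    define k where "k t = h (chart_inv c (\<gamma> t))" for t
    define k' where "k' t = frechet_derivative (h \<circ> chart_inv c) (at (\<gamma> t)) (D t)" for t
    have img: "\<gamma> t \<in> chart_img c" if "t \<in> {0..1}" for t using step.hyps(4) that by auto
    have dk: "(k has_vector_derivative k' t) (at t within {0..1})" if t: "t \<in> {0..1}" for t
    proof -
      have "((h \<circ> chart_inv c) has_derivative frechet_derivative (h \<circ> chart_inv c) (at (\<gamma> t))) (at (\<gamma> t))"
        using dh[OF step.hyps(2) img[OF t]] frechet_derivative_works by blast
      from vector_derivative_diff_chain_within[OF D[OF t, THEN has_vector_derivative_at_within] this[THEN has_derivative_at_withinI]]
      show ?thesis by (simp add: o_def k_def[abs_def] k'_def)
    qed
    have k': "norm (k' t) \<le> C * speed c \<gamma> t" if t: "t \<in> {0..1}" for t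
      using bd[OF step.hyps(2) img[OF t], of "D t"] unfolding k'_def speed_eq[OF D[OF t]] .
    have "norm (k 1 - k 0) \<le> C * \<Phi> 1 - C * \<Phi> 0"
    proof (rule differentiable_bound_general[of 0 1])
      show "continuous_on {0..1} k"
        unfolding continuous_on_eq_continuous_within
        using has_vector_derivative_continuous[OF dk] by blast
      show "continuous_on {0..1} (\<lambda>t. C * \<Phi> t)"
        by (intro continuous_on_mult_left DERIV_continuous_on[OF \<Phi>(3)])
      fix t :: real assume t: "0 < t" "t < 1"
      have i: "t \<in> interior {0..1}" using t by simp
      show "(k has_vector_derivative k' t) (at t)"
        using dk[of t] t at_within_interior[OF i] by auto
      show "((\<lambda>t. C * \<Phi> t) has_vector_derivative C * speed c \<gamma> t) (at t)"
        using DERIV_cmult[OF \<Phi>(3)[of t], of C] t at_within_interior[OF i]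
        by (auto simp: has_real_derivative_iff_has_vector_derivative)
      show "norm (k' t) \<le> C * speed c \<gamma> t" using k' t by simp
    qed simp
    then have "norm (h (chart_inv c (\<gamma> 0)) - h (chart_inv c (\<gamma> 1))) \<le> C * integral {0..1} (speed c \<gamma>)"
      using \<Phi>(1,2) by (simp add: k_def norm_minus_commute)
    then have "norm (h p - h (chart_inv c (\<gamma> 1))) \<le> C * (L + integral {0..1} (speed c \<gamma>))"
      using step.IH norm_triangle_ineq[of "h p - h (chart_inv c (\<gamma> 0))" "h (chart_inv c (\<gamma> 0)) - h (chart_inv c (\<gamma> 1))"]
      by (simp add: distrib_left)
    then show ?case unfolding speed_def[abs_def] .
  qed
  show ?thesis
  proof (cases "C = 0")
    case True
    then show ?thesis using PL PL_exists[of p q] by force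
  next
    case False
    then have "0 < C" using C by simp
    have "norm (h p - h q) / C \<le> d p q"
      by (rule d_greatest) (use PL[of p q] \<open>0 < C\<close> in \<open>simp add: pos_divide_le_eq mult.commute\<close>)
    then show ?thesis using \<open>0 < C\<close> by (simp add: pos_divide_le_eq mult.commute)
  qed
qed

end

lemma DERIV_pos_part_square: "((\<lambda>t::real. (max 0 t)\<^sup>2) has_real_derivative 2 * max 0 t) (at t)"
proof -
  consider "t > 0" | "t < 0" | "t = 0" by linarith
  then show ?thesis
  proof cases
    case 1
    have "((\<lambda>t::real. t\<^sup>2) has_real_derivative 2 * max 0 t) (at t)"
      using 1 by (auto intro!: derivative_eq_intros)
    then show ?thesis
      by (rule has_field_derivative_transform_within_open[where S = "{0<..}"]) (use 1 in auto)
  next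
    case 2
    have "((\<lambda>t::real. 0) has_real_derivative 2 * max 0 t) (at t)" using 2 by simp
    then show ?thesis
      by (rule has_field_derivative_transform_within_open[where S = "{..<0}"]) (use 2 in auto)
  next
    case 3
    have "((\<lambda>h::real. (max 0 h)\<^sup>2 / h) \<longlongrightarrow> 0) (at 0)"
    proof (rule Lim_null_comparison)
      show "\<forall>\<^sub>F h in at 0. norm ((max 0 h)\<^sup>2 / h) \<le> \<bar>h\<bar>"
        by (auto simp: eventually_at_filter max_def power2_eq_square)
      show "((\<lambda>h::real. \<bar>h\<bar>) \<longlongrightarrow> 0) (at 0)"
        by (intro tendsto_rabs_zero tendsto_ident_at)
    qed
    then show ?thesis using 3 by (simp add: has_field_derivative_iff)
  qed
qed

text \<open>
  Being continuously differentiable across the boundary of the disc, the bump can be extended by zero from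
  a chart to the surface.
\<close>

definition bump :: "real^2 \<Rightarrow> real \<Rightarrow> real^2 \<Rightarrow> real" where
  "bump x r y = (max 0 (r\<^sup>2 - (y - x) \<bullet> (y - x)))\<^sup>2"

lemma bump_has_derivative:
  "(bump x r has_derivative (\<lambda>v. 2 * max 0 (r\<^sup>2 - (y - x) \<bullet> (y - x)) * (- 2 * ((y - x) \<bullet> v)))) (at y)"
proof -
  have "((\<lambda>y. r\<^sup>2 - (y - x) \<bullet> (y - x)) has_derivative (\<lambda>v. - 2 * ((y - x) \<bullet> v))) (at y)"
    by (auto intro!: derivative_eq_intros simp: inner_commute)
  from diff_chain_at[OF this DERIV_pos_part_square[THEN has_field_derivative_imp_has_derivative]]
  show ?thesis by (simp add: o_def bump_def[abs_def])
qed

lemma bump_outside: "0 < r \<Longrightarrow> y \<notin> cball x r \<Longrightarrow> bump x r y = 0"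
proof -
  assume "0 < r" "y \<notin> cball x r"
  then have "r < norm (y - x)" by (simp add: dist_norm norm_minus_commute)
  then have "r\<^sup>2 < (norm (y - x))\<^sup>2" using \<open>0 < r\<close> by (intro power_strict_mono) auto
  then show ?thesis by (simp add: bump_def dot_square_norm)
qed

lemma bump_derivative_bound:
  assumes "y \<in> cball x r"
  shows "\<bar>2 * max 0 (r\<^sup>2 - (y - x) \<bullet> (y - x)) * (- 2 * ((y - x) \<bullet> v))\<bar> \<le> 4 * r ^ 3 * norm v"
proof -
  have n: "norm (y - x) \<le> r" using assms by (simp add: dist_norm norm_minus_commute)
  then have r: "0 \<le> r" using norm_ge_zero order_trans by blast
  have "\<bar>(y - x) \<bullet> v\<bar> \<le> r * norm v"
    using Cauchy_Schwarz_ineq2[of "y - x" v] n by (meson mult_right_mono norm_ge_zero order_trans)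
  moreover have "max 0 (r\<^sup>2 - (y - x) \<bullet> (y - x)) \<le> r\<^sup>2" by simp
  ultimately have "max 0 (r\<^sup>2 - (y - x) \<bullet> (y - x)) * \<bar>(y - x) \<bullet> v\<bar> \<le> r\<^sup>2 * (r * norm v)"
    by (intro mult_mono) auto
  then show ?thesis by (simp add: abs_mult power2_eq_square power3_eq_cube mult_ac)
qed

lemma bump_bounds: "0 \<le> bump x r y" "bump x r y \<le> r ^ 4"
proof -
  show "0 \<le> bump x r y" by (simp add: bump_def)
  have "(max 0 (r\<^sup>2 - (y - x) \<bullet> (y - x)))\<^sup>2 \<le> (r\<^sup>2)\<^sup>2" by (intro power_mono) auto
  then show "bump x r y \<le> r ^ 4" by (simp add: bump_def)
qed

context connected_surface
begin

lemma overlap_eq: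
  assumes c: "c \<in> A"
  shows "overlap c e = chart_img c \<inter> chart_inv c -` chart_dom e"
proof (intro set_eqI iffI)
  fix y assume "y \<in> overlap c e"
  then obtain q where "q \<in> chart_dom c" "q \<in> chart_dom e" "y = chart_map c q"
    by (auto simp: overlap_def)
  then show "y \<in> chart_img c \<inter> chart_inv c -` chart_dom e"
    using map_img inv_map[OF c] by simp
next
  fix y assume "y \<in> chart_img c \<inter> chart_inv c -` chart_dom e"
  then show "y \<in> overlap c e"
    unfolding overlap_def using map_inv[OF c, of y] inv_dom[OF c, of y] by (intro image_eqI[of _ _ "chart_inv c y"]) auto
qed

lemma open_overlap: "c \<in> A \<Longrightarrow> e \<in> A \<Longrightarrow> open (overlap c e)"
  by (subst overlap_eq, assumption, rule continuous_open_preimage[OF homeomorphism_cont2[OF chart_homeo] open_img open_dom])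

text \<open>
  In another chart, \<open>h\<close> is \<open>h0\<close> composed with the transition map, which is isometric, or locally zero,
  because the support of \<open>h0\<close> is compact and hence closed in the surface.
\<close>

lemma supported_lipschitz:
  fixes h0 :: "real^2 \<Rightarrow> 'b::euclidean_space"
  assumes c: "c \<in> A" and r: "cball x r \<subseteq> chart_img c" and C: "0 \<le> C"
    and dh: "\<And>y. (h0 has_derivative h0' y) (at y)"
    and zero: "\<And>y. y \<notin> cball x r \<Longrightarrow> h0 y = 0"
    and bd: "\<And>y v. y \<in> cball x r \<Longrightarrow> norm (h0' y v) \<le> C * sqrt (metric_inner (g c y) v v)"
    and h: "\<And>q. h q = (if q \<in> chart_dom c then h0 (chart_map c q) else 0)"
  shows "norm (h p - h q) \<le> C * d p q"
proof -
  have zero': "h0' y v = 0" if "y \<notin> cball x r" for y v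
  proof -
    have "((\<lambda>y. 0) has_derivative h0' y) (at y)"
      by (rule has_derivative_transform_within_open[OF dh, of "- cball x r"]) (use that zero in auto)
    then have "h0' y = (\<lambda>v. 0)" using has_derivative_const has_derivative_unique by blast
    then show ?thesis by simp
  qed
  have "\<exists>D. ((h \<circ> chart_inv e) has_derivative D) (at y) \<and> (\<forall>v. norm (D v) \<le> C * sqrt (metric_inner (g e y) v v))"
    if e: "e \<in> A" and y: "y \<in> chart_img e" for e y
  proof (cases "chart_inv e y \<in> chart_dom c")
    case True
    let ?T = "transition e c"
    have yo: "y \<in> overlap e c" using True y by (simp add: overlap_eq[OF e])
    have "smooth_on (overlap e c) ?T" using smooth_atlas e c by (simp add: smooth_surface_def)
    then have T: "(?T has_derivative frechet_derivative ?T (at y)) (at y)"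
      using smooth_on_differentiable[OF _ yo] frechet_derivative_works by blast
    let ?D = "h0' (?T y) \<circ> frechet_derivative ?T (at y)"
    have "((h0 \<circ> ?T) has_derivative ?D) (at y)" by (rule diff_chain_at[OF T dh])
    then have "((h \<circ> chart_inv e) has_derivative ?D) (at y)"
      by (rule has_derivative_transform_within_open[OF _ open_overlap[OF e c] yo])
        (simp add: overlap_eq[OF e] h transition_def)
    moreover have "norm (?D v) \<le> C * sqrt (metric_inner (g e y) v v)" for v
    proof -
      have "metric_inner (g e y) v v = metric_inner (g c (?T y)) (frechet_derivative ?T (at y) v) (frechet_derivative ?T (at y) v)"
        using surf e c yo unfolding riemannian_surface_def Let_def by blast
      then show ?thesis
        using bd[of "?T y" "frechet_derivative ?T (at y) v"] zero'[of "?T y"] C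
          metric_inner_posI(1)[OF surf e y, of v] by (cases "?T y \<in> cball x r") auto
    qed
    ultimately show ?thesis by blast
  next
    case False
    define K where "K = chart_inv c ` cball x r"
    have "compact K" unfolding K_def
      by (rule compact_continuous_image[OF continuous_on_subset[OF homeomorphism_cont2[OF chart_homeo[OF c]] r] compact_cball])
    then have "open (- K)" using compact_imp_closed by blast
    then have O: "open (chart_img e \<inter> chart_inv e -` (- K))"
      by (rule continuous_open_preimage[OF homeomorphism_cont2[OF chart_homeo[OF e]] open_img[OF e]])
    have "chart_inv e y \<notin> K" using False inv_dom[OF c] r by (auto simp: K_def)
    then have yO: "y \<in> chart_img e \<inter> chart_inv e -` (- K)" using y by simp
    have hz: "h q = 0" if "q \<notin> K" for q
    proof (cases "q \<in> chart_dom c")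
      case True
      then have "chart_map c q \<notin> cball x r" using that inv_map[OF c True] unfolding K_def by (metis image_eqI)
      then show ?thesis using zero h by simp
    qed (simp add: h)
    have "((h \<circ> chart_inv e) has_derivative (\<lambda>v. 0)) (at y)"
      by (rule has_derivative_transform_within_open[OF has_derivative_const[of 0] O yO]) (simp add: hz)
    then show ?thesis using C metric_inner_posI(1)[OF surf e y] by (intro exI[of _ "\<lambda>v. 0"]) auto
  qed
  note D = this
  show ?thesis
  proof (rule bounded_gradient_lipschitz[OF C])
    fix e y assume ey: "e \<in> A" "y \<in> chart_img e"
    then show "(h \<circ> chart_inv e) differentiable at y" using D differentiableI by blast
    fix v show "norm (frechet_derivative (h \<circ> chart_inv e) (at y) v) \<le> C * sqrt (metric_inner (g e y) v v)"
      using D[OF ey] frechet_derivative_at by metis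
  qed
qed

text \<open>
  Both claims follow from Lipschitz functions supported in the chart: the bump itself tells \<open>p\<close> from
  the points outside a small disc, and the bump times the coordinate vector is injective near \<open>p\<close>, since
  its derivative at \<open>p\<close> is a multiple of the identity.
\<close>

lemma local_distance:
  assumes c: "c \<in> A" and p: "p \<in> chart_dom c"
  obtains s C where "0 < s" "0 < C" "cball (chart_map c p) s \<subseteq> chart_img c"
    "\<And>y z. y \<in> cball (chart_map c p) s \<Longrightarrow> z \<in> cball (chart_map c p) s \<Longrightarrow>
       norm (y - z) \<le> C * d (chart_inv c y) (chart_inv c z)"
    "\<And>e. 0 < e \<Longrightarrow> \<exists>\<delta>>0. \<forall>q. d p q < \<delta> \<longrightarrow> q \<in> chart_dom c \<and> chart_map c q \<in> ball (chart_map c p) e"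
proof -
  define x where "x = chart_map c p"
  have x: "x \<in> chart_img c" using p by (simp add: x_def map_img)
  obtain r m where r: "0 < r" "0 < m" "cball x r \<subseteq> chart_img c"
    "\<And>v. m * (norm v)\<^sup>2 \<le> metric_inner (g c x) v v"
    "\<And>y v. y \<in> cball x r \<Longrightarrow> metric_inner (g c x) v v / 2 \<le> metric_inner (g c y) v v"
    using local_metric[OF c x] by metis
  define k where "k = sqrt (m / 2)"
  have k: "0 < k" using r(2) by (simp add: k_def)
  have kv: "k * norm v \<le> sqrt (metric_inner (g c y) v v)" if "y \<in> cball x r" for y v
  proof -
    have "(k * norm v)\<^sup>2 \<le> metric_inner (g c y) v v"
      using r(4)[of v] r(5)[OF that, of v] r(2) by (simp add: k_def power_mult_distrib)
    then show ?thesis by (rule real_le_rsqrt)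
  qed
  have nv: "a * norm v \<le> a / k * sqrt (metric_inner (g c y) v v)" if "y \<in> cball x r" "0 \<le> a" for a y v
  proof -
    have "a / k * (k * norm v) \<le> a / k * sqrt (metric_inner (g c y) v v)"
      using kv[OF that(1)] that(2) k by (intro mult_left_mono) auto
    then show ?thesis using k by simp
  qed
  define b where "b q = (if q \<in> chart_dom c then bump x r (chart_map c q) else 0)" for q
  define K where "K q = (if q \<in> chart_dom c then bump x r (chart_map c q) *\<^sub>R (chart_map c q - x) else 0)" for q
  have b: "norm (b q - b q') \<le> (4 * r ^ 3 / k) * d q q'" for q q'
  proof (rule supported_lipschitz[OF c r(3) _ bump_has_derivative])
    show "0 \<le> 4 * r ^ 3 / k" using r(1) k by simp
    fix y v assume y: "y \<in> cball x r"
    show "norm (2 * max 0 (r\<^sup>2 - (y - x) \<bullet> (y - x)) * (- 2 * ((y - x) \<bullet> v))) \<le> 4 * r ^ 3 / k * sqrt (metric_inner (g c y) v v)"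
      using bump_derivative_bound[OF y, of v] nv[OF y, of "4 * r ^ 3" v] r(1) by simp
  qed (use bump_outside r(1) b_def in auto)
  have K: "norm (K q - K q') \<le> (5 * r ^ 4 / k) * d q q'" for q q'
  proof (rule supported_lipschitz[OF c r(3)])
    show "0 \<le> 5 * r ^ 4 / k" using r(1) k by simp
    show "((\<lambda>y. bump x r y *\<^sub>R (y - x)) has_derivative (\<lambda>v. bump x r y *\<^sub>R v
        + (2 * max 0 (r\<^sup>2 - (y - x) \<bullet> (y - x)) * (- 2 * ((y - x) \<bullet> v))) *\<^sub>R (y - x))) (at y)" for y
      by (rule has_derivative_scaleR[OF bump_has_derivative, THEN has_derivative_eq_rhs])
        (auto intro!: derivative_eq_intros)
    fix y v assume y: "y \<in> cball x r"
    have n: "norm (y - x) \<le> r" using y by (simp add: dist_norm norm_minus_commute)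
    let ?a = "2 * max 0 (r\<^sup>2 - (y - x) \<bullet> (y - x)) * (- 2 * ((y - x) \<bullet> v))"
    have "norm (bump x r y *\<^sub>R v + ?a *\<^sub>R (y - x)) \<le> bump x r y * norm v + \<bar>?a\<bar> * norm (y - x)"
      using norm_triangle_ineq[of "bump x r y *\<^sub>R v" "?a *\<^sub>R (y - x)"] bump_bounds(1)[of x r y] by simp
    also have "\<dots> \<le> r ^ 4 * norm v + (4 * r ^ 3 * norm v) * r"
      using bump_bounds[of x r y] bump_derivative_bound[OF y, of v] n r(1)
      by (intro add_mono mult_mono) auto
    also have "\<dots> = 5 * r ^ 4 * norm v" by (simp add: power4_eq_xxxx power3_eq_cube)
    also have "\<dots> \<le> 5 * r ^ 4 / k * sqrt (metric_inner (g c y) v v)" using nv[OF y] r(1) by simp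
    finally show "norm (bump x r y *\<^sub>R v + ?a *\<^sub>R (y - x)) \<le> 5 * r ^ 4 / k * sqrt (metric_inner (g c y) v v)" .
  qed (use bump_outside r(1) K_def in auto)
  define s where "s = r / 8"
  have s: "0 < s" "s \<le> r" using r(1) by (simp_all add: s_def)
  have lower: "norm (y - z) \<le> (25 / k) * d (chart_inv c y) (chart_inv c z)"
    if y: "y \<in> cball x s" and z: "z \<in> cball x s" for y z
  proof -
    have ny: "norm (y - x) \<le> s" and nz: "norm (z - x) \<le> s"
      using y z by (simp_all add: dist_norm norm_minus_commute)
    have yr: "y \<in> cball x r" "z \<in> cball x r" using y z s by auto
    have "(y - x) \<bullet> (y - x) \<le> s\<^sup>2" using ny by (simp add: dot_square_norm power_mono)
    then have "63 / 64 * r\<^sup>2 \<le> r\<^sup>2 - (y - x) \<bullet> (y - x)" by (simp add: s_def power_divide)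
    then have "63 / 64 * r\<^sup>2 \<le> max 0 (r\<^sup>2 - (y - x) \<bullet> (y - x))" by linarith
    then have "(63 / 64 * r\<^sup>2)\<^sup>2 \<le> bump x r y" unfolding bump_def by (intro power_mono) auto
    moreover have "(63 / 64 * r\<^sup>2)\<^sup>2 = (63 / 64)\<^sup>2 * r ^ 4" by (simp add: power2_eq_square power4_eq_xxxx)
    moreover have "7 / 10 * r ^ 4 \<le> (63 / 64)\<^sup>2 * r ^ 4" by (intro mult_right_mono) (auto simp: power2_eq_square)
    ultimately have low: "7 / 10 * r ^ 4 \<le> bump x r y" by linarith
    have bl: "norm (bump x r y - bump x r z) \<le> 4 * r ^ 3 * norm (y - z)"
      by (rule differentiable_bound[OF convex_cball has_derivative_at_withinI[OF bump_has_derivative] _ yr])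
        (rule onorm_le, use bump_derivative_bound in simp)
    have "bump x r y *\<^sub>R (y - x) - bump x r z *\<^sub>R (z - x) = bump x r y *\<^sub>R (y - z) + (bump x r y - bump x r z) *\<^sub>R (z - x)"
      by (simp add: algebra_simps)
    moreover have "norm (bump x r y *\<^sub>R (y - z)) \<ge> 7 / 10 * r ^ 4 * norm (y - z)"
      using mult_right_mono[OF low norm_ge_zero[of "y - z"]] bump_bounds(1)[of x r y] by simp
    moreover have "norm ((bump x r y - bump x r z) *\<^sub>R (z - x)) \<le> 1 / 2 * r ^ 4 * norm (y - z)"
    proof -
      have "norm ((bump x r y - bump x r z) *\<^sub>R (z - x)) \<le> (4 * r ^ 3 * norm (y - z)) * s"
        using bl nz r(1) by (auto intro!: mult_mono)
      then show ?thesis by (simp add: s_def power4_eq_xxxx power3_eq_cube mult_ac)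
    qed
    ultimately have "1 / 5 * r ^ 4 * norm (y - z) \<le> norm (bump x r y *\<^sub>R (y - x) - bump x r z *\<^sub>R (z - x))"
      using norm_diff_ineq[of "bump x r y *\<^sub>R (y - z)" "(bump x r y - bump x r z) *\<^sub>R (z - x)"] by simp
    also have "\<dots> = norm (K (chart_inv c y) - K (chart_inv c z))"
      using yr r(3) inv_dom[OF c] map_inv[OF c] by (simp add: K_def subset_iff)
    also have "\<dots> \<le> 5 * r ^ 4 / k * d (chart_inv c y) (chart_inv c z)" by (rule K)
    finally have "r ^ 4 * norm (y - z) \<le> r ^ 4 * (25 / k * d (chart_inv c y) (chart_inv c z))"
      by (simp add: mult_ac)
    then show ?thesis using r(1) by (simp only: mult_le_cancel_left_pos zero_less_power)
  qed
  have sep: "\<exists>\<delta>>0. \<forall>q. d p q < \<delta> \<longrightarrow> q \<in> chart_dom c \<and> chart_map c q \<in> ball x e" if e: "0 < e" for e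
  proof -
    define e' where "e' = min e r"
    have e': "0 < e'" "e' \<le> r" "e' \<le> e" using e r(1) by (auto simp: e'_def)
    have lt: "(r\<^sup>2 - e'\<^sup>2)\<^sup>2 < r ^ 4"
    proof -
      have "(r\<^sup>2 - e'\<^sup>2)\<^sup>2 < (r\<^sup>2)\<^sup>2"
        using e' by (intro power_strict_mono) (auto intro!: power_mono)
      then show ?thesis by simp
    qed
    define \<delta> where "\<delta> = (r ^ 4 - (r\<^sup>2 - e'\<^sup>2)\<^sup>2) / (4 * r ^ 3 / k)"
    have C: "0 < 4 * r ^ 3 / k" using r(1) k by simp
    have "0 < \<delta>" unfolding \<delta>_def using lt by (intro divide_pos_pos C) simp
    moreover have "q \<in> chart_dom c \<and> chart_map c q \<in> ball x e" if q: "d p q < \<delta>" for q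
    proof -
      have "b p = r ^ 4" using p r(1) by (simp add: b_def x_def[symmetric] bump_def)
      moreover have "(4 * r ^ 3 / k) * d p q < r ^ 4 - (r\<^sup>2 - e'\<^sup>2)\<^sup>2"
        using q unfolding \<delta>_def pos_less_divide_eq[OF C] by (subst mult.commute)
      ultimately have bq: "(r\<^sup>2 - e'\<^sup>2)\<^sup>2 < b q" using b[of p q] by (simp add: abs_le_iff)
      then have dom: "q \<in> chart_dom c" using b_def by (metis not_less zero_le_power2)
      let ?n = "(chart_map c q - x) \<bullet> (chart_map c q - x)"
      have "(r\<^sup>2 - e'\<^sup>2)\<^sup>2 < (max 0 (r\<^sup>2 - ?n))\<^sup>2" using bq dom by (simp add: b_def bump_def)
      then have "r\<^sup>2 - e'\<^sup>2 < max 0 (r\<^sup>2 - ?n)" by (rule power_less_imp_less_base) simp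
      moreover have "0 \<le> r\<^sup>2 - e'\<^sup>2" using e' by (simp add: power_mono)
      ultimately have "?n < e'\<^sup>2" by (simp add: max_def split: if_splits)
      then have "norm (chart_map c q - x) < e'"
        unfolding dot_square_norm using e'(1) by (simp add: power_less_imp_less_base)
      then show ?thesis using dom e'(3) by (simp add: dist_norm norm_minus_commute)
    qed
    ultimately show ?thesis by blast
  qed
  show ?thesis
  proof (rule that[of s "25 / k"])
    show "cball (chart_map c p) s \<subseteq> chart_img c"
      unfolding x_def[symmetric] using r(3) subset_cball[OF s(2), of x] by blast
  qed (use s k lower sep in \<open>auto simp: x_def[symmetric]\<close>)
qed


section \<open>Compactness of closed discs\<close>

lemma d_nbhd:
  assumes "0 < r"
  shows "\<exists>V. open V \<and> p \<in> V \<and> (\<forall>q\<in>V. d p q < r)"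
proof -
  obtain c where c: "c \<in> A" "p \<in> chart_dom c" using chart_at by blast
  let ?x = "chart_map c p"
  obtain s b where s: "0 < s" "0 < b" "cball ?x s \<subseteq> chart_img c"
    "\<And>v. metric_inner (g c ?x) v v \<le> b * (norm v)\<^sup>2"
    "\<And>y v. y \<in> cball ?x s \<Longrightarrow> metric_inner (g c y) v v \<le> 2 * metric_inner (g c ?x) v v"
    using local_metric[OF c(1) map_img[OF c(2)]] by metis
  have b2: "0 < sqrt (2 * b)" using s(2) by simp
  define e where "e = min s (r / sqrt (2 * b))"
  have e: "0 < e" "e \<le> s" "sqrt (2 * b) * e \<le> r" using s(1) b2 assms
    by (auto simp: e_def min_def field_simps)
  define V where "V = chart_dom c \<inter> chart_map c -` ball ?x e"
  have "open V" unfolding V_def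
    by (rule continuous_open_preimage[OF homeomorphism_cont1[OF chart_homeo[OF c(1)]] open_dom[OF c(1)] open_ball])
  moreover have "p \<in> V" using c(2) e(1) by (simp add: V_def)
  moreover have "d p q < r" if q: "q \<in> V" for q
  proof -
    let ?v = "chart_map c q - ?x"
    have n: "norm ?v < e" "q \<in> chart_dom c" using q by (auto simp: V_def dist_norm norm_minus_commute)
    have "d (chart_inv c ?x) (chart_inv c (chart_map c q)) \<le> sqrt (2 * b * (norm ?v)\<^sup>2)"
    proof (rule d_segment[OF c(1) convex_cball s(3)])
      show "?x \<in> cball ?x s" "chart_map c q \<in> cball ?x s"
        using s(1) n(1) e(2) by (auto simp: dist_norm norm_minus_commute)
      show "metric_inner (g c z) ?v ?v \<le> 2 * b * (norm ?v)\<^sup>2" if "z \<in> cball ?x s" for z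
        using s(5)[OF that, of ?v] s(4)[of ?v] by simp
    qed
    also have "\<dots> = sqrt (2 * b) * norm ?v" by (simp add: real_sqrt_mult)
    also have "\<dots> < sqrt (2 * b) * e" using n(1) b2 by (intro mult_strict_left_mono)
    also have "\<dots> \<le> r" by (rule e(3))
    finally show ?thesis using c n(2) by (simp add: inv_map)
  qed
  ultimately show ?thesis by blast
qed

lemma d_zero: "d p q = 0 \<Longrightarrow> p = q"
proof -
  assume z: "d p q = 0"
  obtain c where c: "c \<in> A" "p \<in> chart_dom c" using chart_at by blast
  have near: "q \<in> chart_dom c \<and> dist (chart_map c p) (chart_map c q) < e" if "0 < e" for e
    using local_distance[OF c] that z by (metis mem_ball)
  have "chart_map c p = chart_map c q"
  proof (rule ccontr)
    assume "chart_map c p \<noteq> chart_map c q"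
    then show False using near[of "dist (chart_map c p) (chart_map c q)"] by simp
  qed
  moreover have "q \<in> chart_dom c" using near[of 1] by simp
  ultimately show "p = q" using inv_map[OF c(1)] c(2) by metis
qed

sublocale M: Metric_space UNIV d
proof
  show "0 \<le> d x y" for x y by (rule d_nonneg)
  show "d x y = d y x" for x y by (rule d_sym)
  show "d x y = 0 \<longleftrightarrow> x = y" for x y using d_zero d_self by blast
  show "d x z \<le> d x y + d y z" for x y z by (rule d_triangle)
qed

lemma mtopology_eq: "M.mtopology = euclidean"
proof (rule topology_eq[THEN iffD2], intro allI iffI)
  fix U assume "openin M.mtopology U"
  then have U: "\<And>p. p \<in> U \<Longrightarrow> \<exists>r>0. M.mball p r \<subseteq> U" by (auto simp: M.openin_mtopology)
  have "\<exists>V. open V \<and> p \<in> V \<and> V \<subseteq> U" if "p \<in> U" for p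
  proof -
    obtain r where "r > 0" "M.mball p r \<subseteq> U" using U[OF \<open>p \<in> U\<close>] by blast
    then show ?thesis using d_nbhd[of r p] by (auto simp: M.mball_def)
  qed
  then show "openin euclidean U" by (simp add: open_subopen[of U])
next
  fix U :: "'a set" assume "openin euclidean U"
  then have U: "open U" by simp
  have "\<exists>r>0. M.mball p r \<subseteq> U" if p: "p \<in> U" for p
  proof -
    obtain c where c: "c \<in> A" "p \<in> chart_dom c" using chart_at by blast
    have "open (chart_img c \<inter> chart_inv c -` U)"
      by (rule continuous_open_preimage[OF homeomorphism_cont2[OF chart_homeo[OF c(1)]] open_img[OF c(1)] U])
    moreover have "chart_map c p \<in> chart_img c \<inter> chart_inv c -` U"
      using map_img[OF c(2)] inv_map[OF c] p by simp
    ultimately obtain e where e: "e > 0" "ball (chart_map c p) e \<subseteq> chart_img c \<inter> chart_inv c -` U"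
      using open_contains_ball by blast
    obtain \<delta> where \<delta>: "\<delta> > 0" "\<And>q. d p q < \<delta> \<Longrightarrow> q \<in> chart_dom c \<and> chart_map c q \<in> ball (chart_map c p) e"
      using local_distance[OF c] e(1) by metis
    have "q \<in> U" if "d p q < \<delta>" for q
      using \<delta>(2)[OF that] e(2) inv_map[OF c(1)] by fastforce
    then show ?thesis using \<delta>(1) by (auto simp: M.mball_def)
  qed
  then show "openin M.mtopology U" by (auto simp: M.openin_mtopology)
qed

abbreviation "disc p R \<equiv> {q. d p q \<le> R}"

lemma disc_eq: "disc p R = M.mcball p R"
  by (auto simp: M.mcball_def)

lemma closed_disc: "closed (disc p R)"
  using M.closedin_mcball[of p R] unfolding disc_eq mtopology_eq by simp

lemma open_mball: "open {q. d p q < r}"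
  using M.openin_mball[of p r] unfolding mtopology_eq by (simp add: M.mball_def)

lemma compact_mtopology: "compactin M.mtopology S \<longleftrightarrow> compact S"
  unfolding mtopology_eq by simp

lemma small_compact_disc: "\<exists>s>0. compact (disc q s)"
proof -
  obtain c where c: "c \<in> A" "q \<in> chart_dom c" using chart_at by blast
  obtain r where r: "r > 0" "cball (chart_map c q) r \<subseteq> chart_img c"
    using open_img[OF c(1)] map_img[OF c(2)] open_contains_cball by metis
  obtain \<delta> where \<delta>: "\<delta> > 0" "\<And>x. d q x < \<delta> \<Longrightarrow> x \<in> chart_dom c \<and> chart_map c x \<in> ball (chart_map c q) r"
    using local_distance[OF c] r(1) by metis
  have K: "compact (chart_inv c ` cball (chart_map c q) r)"
    by (rule compact_continuous_image[OF continuous_on_subset[OF homeomorphism_cont2[OF chart_homeo[OF c(1)]] r(2)] compact_cball])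
  have "disc q (\<delta> / 2) \<subseteq> chart_inv c ` cball (chart_map c q) r"
  proof
    fix x assume "x \<in> disc q (\<delta> / 2)"
    then have "d q x < \<delta>" using \<delta>(1) by auto
    then have "x \<in> chart_dom c" "chart_map c x \<in> ball (chart_map c q) r" using \<delta>(2) by auto
    then show "x \<in> chart_inv c ` cball (chart_map c q) r"
      using inv_map[OF c(1)] by (intro image_eqI[of _ _ "chart_map c x"]) auto
  qed
  then have "compact (chart_inv c ` cball (chart_map c q) r \<inter> disc q (\<delta> / 2))" "chart_inv c ` cball (chart_map c q) r \<inter> disc q (\<delta> / 2) = disc q (\<delta> / 2)"
    using compact_Int_closed[OF K closed_disc] by blast+
  then show ?thesis using \<delta>(1) by (metis half_gt_zero)
qed

text \<open>A nearly shortest path is cut at length \<open>R\<close>.\<close>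

lemma approach_disc:
  assumes "0 \<le> R" "d p y < R + e" "0 < e"
  shows "\<exists>m. d p m \<le> R \<and> d m y < e"
proof (cases "d p y \<le> R")
  case True
  then show ?thesis using assms(3) d_self by force
next
  case False
  obtain L where L: "PL p y L" "L < R + e"
    using d_approx[of "R + e - d p y" p y] assms(2) by auto
  have "R \<le> L" using d_le[OF L(1)] False by simp
  then obtain m where "PL p m R" "PL m y (L - R)" using PL_split[OF L(1) assms(1)] by blast
  then show ?thesis using d_le L(2) by (intro exI[of _ m]) fastforce
qed

lemma compact_disc_extend:
  assumes R: "0 \<le> R" and comp: "compact (disc p R)"
  shows "\<exists>\<delta>>0. compact (disc p (R + \<delta>))"
proof -
  have "\<forall>q. \<exists>s. s > 0 \<and> compact (disc q s)" using small_compact_disc by blast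
  from choice[OF this] obtain s where s: "\<And>q. s q > 0" "\<And>q. compact (disc q (s q))" by blast
  have cover: "disc p R \<subseteq> (\<Union>q\<in>disc p R. {x. d q x < s q / 2})"
  proof
    fix q assume "q \<in> disc p R"
    moreover have "d q q < s q / 2" using s(1)[of q] by (simp add: d_self)
    ultimately show "q \<in> (\<Union>q\<in>disc p R. {x. d q x < s q / 2})" by blast
  qed
  obtain Q where Q: "Q \<subseteq> disc p R" "finite Q" "disc p R \<subseteq> (\<Union>q\<in>Q. {x. d q x < s q / 2})"
    by (rule compactE_image[OF comp _ cover]) (rule open_mball)
  have "p \<in> disc p R" using R by (simp add: d_self)
  then have ne: "Q \<noteq> {}" using Q(3) by blast
  define \<delta> where "\<delta> = Min (s ` Q) / 4"
  have \<delta>: "0 < \<delta>" "\<And>q. q \<in> Q \<Longrightarrow> 4 * \<delta> \<le> s q" using Q(2) ne s(1) by (auto simp: \<delta>_def)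
  have "disc p (R + \<delta>) \<subseteq> (\<Union>q\<in>Q. disc q (s q))"
  proof
    fix y assume "y \<in> disc p (R + \<delta>)"
    then obtain m where m: "d p m \<le> R" "d m y < 2 * \<delta>"
      using approach_disc[of R p y "2 * \<delta>"] R \<delta>(1) by auto
    then obtain q where q: "q \<in> Q" "d q m < s q / 2" using Q(3) by blast
    have "d q y \<le> s q" using d_triangle[of q y m] m(2) q \<delta>(2)[OF q(1)] by simp
    then show "y \<in> (\<Union>q\<in>Q. disc q (s q))" using q(1) by blast
  qed
  moreover have "compact (\<Union>q\<in>Q. disc q (s q))" using Q(2) s(2) by blast
  ultimately have "compact (disc p (R + \<delta>))"
    using compact_Int_closed[OF _ closed_disc, of "\<Union>q\<in>Q. disc q (s q)" p "R + \<delta>"] by (simp add: Int_absorb1)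
  then show ?thesis using \<delta>(1) by blast
qed

lemma compact_disc_limit:
  assumes compl: "M.mcomplete" and R: "0 < R" and comp: "\<And>r. r < R \<Longrightarrow> compact (disc p r)"
  shows "compact (disc p R)"
proof -
  have "M.mtotally_bounded (disc p R)"
    unfolding M.mtotally_bounded_def
  proof (intro allI impI)
    fix e :: real assume e: "0 < e"
    define r where "r = max 0 (R - e / 4)"
    have r: "0 \<le> r" "r < R" "R \<le> r + e / 4" using e R by (auto simp: r_def)
    have tb: "M.mtotally_bounded (disc p r)"
      using M.compactin_imp_mtotally_bounded comp[OF r(2)] unfolding compact_mtopology by blast
    then obtain K where K: "finite K" "K \<subseteq> disc p r" "disc p r \<subseteq> (\<Union>x\<in>K. M.mball x (e / 2))"
      using e unfolding M.mtotally_bounded_def by (metis half_gt_zero)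
    have "disc p R \<subseteq> (\<Union>x\<in>K. M.mball x e)"
    proof
      fix y assume "y \<in> disc p R"
      then obtain m where m: "d p m \<le> r" "d m y < e / 2"
        using approach_disc[of r p y "e / 2"] r e by auto
      then obtain x where x: "x \<in> K" "d x m < e / 2" using K(3) by (auto simp: M.mball_def)
      have "d x y < e" using d_triangle[of x y m] m x by simp
      then show "y \<in> (\<Union>x\<in>K. M.mball x e)" using x(1) by (auto simp: M.mball_def)
    qed
    moreover have "K \<subseteq> disc p R" using K(2) r(2) by auto
    ultimately show "\<exists>K. finite K \<and> K \<subseteq> disc p R \<and> disc p R \<subseteq> (\<Union>x\<in>K. M.mball x e)"
      using K(1) by blast
  qed
  then have "compactin M.mtopology (M.mtopology closure_of disc p R)"
    using M.mtotally_bounded_eq_compact_closure_of[OF compl] by blast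
  moreover have "M.mtopology closure_of disc p R = disc p R"
    unfolding mtopology_eq using closed_disc by simp
  ultimately show ?thesis by (simp add: compact_mtopology)
qed

text \<open>
  Cohn-Vossen's proof for length spaces: the radii of compact discs form an interval that is open by
  \<open>compact_disc_extend\<close> and closed by \<open>compact_disc_limit\<close>.
\<close>

theorem hopf_rinow:
  assumes compl: "complete_surface A g"
  shows "compact (disc p R)"
proof (rule ccontr)
  assume nc: "\<not> compact (disc p R)"
  have compl': "M.mcomplete" using compl by (simp add: complete_surface_def)
  define T where "T = {r. \<not> compact (disc p r)}"
  have mono: "compact (disc p r)" if "compact (disc p r')" "r \<le> r'" for r r'
  proof -
    have "disc p r' \<inter> disc p r = disc p r" using that(2) by auto
    then show ?thesis using compact_Int_closed[OF that(1) closed_disc, of p r] by simp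
  qed
  have p0: "compact (disc p r)" if "r \<le> 0" for r
  proof -
    have "disc p r \<subseteq> {p}"
    proof
      fix q assume "q \<in> disc p r"
      then have "d p q \<le> 0" using that by simp
      then have "d p q = 0" using d_nonneg by (rule order_antisym)
      then show "q \<in> {p}" using d_zero by blast
    qed
    then show ?thesis by (metis compact_empty compact_sing subset_singletonD)
  qed
  have bb: "bdd_below T" by (rule bdd_belowI[of _ 0]) (use p0 in \<open>auto simp: T_def intro: linear le_cases\<close>)
  define R0 where "R0 = Inf T"
  have below: "compact (disc p r)" if "r < R0" for r
  proof (rule ccontr)
    assume "\<not> compact (disc p r)"
    then have "R0 \<le> r" unfolding R0_def T_def by (intro cInf_lower) (use bb in \<open>auto simp: T_def\<close>)
    then show False using that by simp
  qed
  have c0: "compact (disc p (max 0 R0))"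
  proof (cases "0 < R0")
    case True
    then show ?thesis using compact_disc_limit[OF compl' True below] by simp
  next
    case False
    then show ?thesis using p0[of 0] by simp
  qed
  obtain \<delta> where \<delta>: "\<delta> > 0" "compact (disc p (max 0 R0 + \<delta>))"
    using compact_disc_extend[OF _ c0] by auto
  have "R0 < max 0 R0 + \<delta>" using \<delta>(1) by simp
  moreover have "T \<noteq> {}" using nc by (auto simp: T_def)
  ultimately obtain r where "r \<in> T" "r < max 0 R0 + \<delta>" using cInf_lessD unfolding R0_def by metis
  then show False using mono[OF \<delta>(2), of r] by (simp add: T_def)
qed

end

section \<open>Chords in the light cone\<close>

text \<open>
  The form that is used twice in \<open>local_chord_metric\<close>: \<open>a\<close> is the value of a fixed differential on
  a vector of norm \<open>n\<close>, and \<open>R, R'\<close> are errors of its approximation.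
\<close>

lemma lorentz_perturb:
  assumes "norm a \<le> B * n" "norm R \<le> h * n" "norm R' \<le> h * n" "0 \<le> B" "0 \<le> h"
  shows "\<bar>lorentz (a + R) (a + R') - lorentz a a\<bar> \<le> (8 * B * h + 4 * h\<^sup>2) * n\<^sup>2"
proof -
  have n: "0 \<le> h * n" "0 \<le> B * n" using assms(1,2) norm_ge_zero order_trans by blast+
  have 1: "\<bar>lorentz a R'\<bar> \<le> 4 * ((B * n) * (h * n))"
    by (rule order_trans[OF lorentz_bound]) (intro mult_left_mono mult_mono assms n norm_ge_zero; simp)
  have 2: "\<bar>lorentz R a\<bar> \<le> 4 * ((h * n) * (B * n))"
    by (rule order_trans[OF lorentz_bound]) (intro mult_left_mono mult_mono assms n norm_ge_zero; simp)
  have 3: "\<bar>lorentz R R'\<bar> \<le> 4 * ((h * n) * (h * n))"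
    by (rule order_trans[OF lorentz_bound]) (intro mult_left_mono mult_mono assms n norm_ge_zero; simp)
  have "lorentz (a + R) (a + R') - lorentz a a = lorentz a R' + lorentz R a + lorentz R R'"
    by (simp add: lorentz_simps)
  also have "\<bar>\<dots>\<bar> \<le> 4 * ((B * n) * (h * n)) + 4 * ((h * n) * (B * n)) + 4 * ((h * n) * (h * n))"
    using 1 2 3 by linarith
  also have "\<dots> = (8 * B * h + 4 * h\<^sup>2) * n\<^sup>2" by (simp add: power2_eq_square algebra_simps)
  finally show ?thesis .
qed

context null_cone_patch
begin

text \<open>
  As \<open>F\<close> is null, the squared chord is the Lorentz square of \<open>F z - F y\<close>, and half of its derivative
  at \<open>z\<close> in the direction \<open>z - y\<close> is the product of \<open>F z - F y\<close> with the differential of \<open>F\<close> at \<open>z\<close>.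
  By continuity of the differential both are close to the metric at \<open>x\<close>.
\<close>

lemma local_chord_metric:
  assumes x: "x \<in> S" and m: "0 < m" "\<And>v. m * (norm v)\<^sup>2 \<le> metric_inner (G x) v v"
  obtains r C where "0 < r" "0 < C" "cball x r \<subseteq> S"
    "\<And>y z. y \<in> cball x r \<Longrightarrow> z \<in> cball x r \<Longrightarrow>
        metric_inner (G x) (z - y) (z - y) / 2 \<le> - 2 * lorentz (F y) (F z)"
    "\<And>y z. y \<in> cball x r \<Longrightarrow> z \<in> cball x r \<Longrightarrow> - 2 * lorentz (F y) (F z) \<le> C * (norm (z - y))\<^sup>2"
    "\<And>y z. y \<in> cball x r \<Longrightarrow> z \<in> cball x r \<Longrightarrow> y \<noteq> z \<Longrightarrow>
        dir1 (\<lambda>w. - 2 * lorentz (F y) (F w)) z (z - y) \<noteq> 0"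
proof -
  let ?L = "\<lambda>z v. \<Sum>i\<in>UNIV. v $ i *\<^sub>R D i z"
  define B where "B = norm (D 1 x) + norm (D 2 x)"
  have Lb: "norm (?L x v) \<le> B * norm v" for v
  proof -
    have "norm (?L x v) \<le> norm (v $ 1 *\<^sub>R D 1 x) + norm (v $ 2 *\<^sub>R D 2 x)"
      unfolding sum_2 by (rule norm_triangle_ineq)
    also have "\<dots> \<le> norm v * norm (D 1 x) + norm v * norm (D 2 x)"
      using component_le_norm_cart[of v] by (auto intro!: add_mono mult_right_mono)
    finally show ?thesis by (simp add: B_def algebra_simps)
  qed
  have B0: "0 \<le> B" by (simp add: B_def)
  \<comment> \<open>With this tolerance the error in \<open>lorentz_perturb\<close> is at most half of the lower bound \<open>m\<close>.\<close>
  define h where "h = min 1 (m / (2 * (8 * B + 4)))"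
  have h: "0 < h" "h \<le> 1" using m(1) B0 by (auto simp: h_def add_nonneg_pos)
  have hm: "8 * B * h + 4 * h\<^sup>2 \<le> m / 2"
  proof -
    have "h\<^sup>2 \<le> h" using h by (simp add: power2_eq_square mult_left_le)
    then have "8 * B * h + 4 * h\<^sup>2 \<le> h * (8 * B + 4)" by (simp add: algebra_simps)
    also have "\<dots> \<le> m / (2 * (8 * B + 4)) * (8 * B + 4)"
      using B0 by (intro mult_right_mono) (auto simp: h_def)
    also have "\<dots> = m / 2"
    proof -
      have "8 * B + 4 \<noteq> 0" using B0 by simp
      then show ?thesis by (simp add: divide_simps)
    qed
    finally show ?thesis .
  qed
  obtain r0 where r0: "r0 > 0" "cball x r0 \<subseteq> S" using open_S x open_contains_cball by metis
  have c: "isCont (D i) x" for i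
    using smooth_on_continuous[OF smooth_D] open_S x continuous_on_eq_continuous_at by blast
  have near: "\<exists>r>0. \<forall>z. dist z x < r \<longrightarrow> dist (D i z) (D i x) < h / 2" for i
    using c[of i] half_gt_zero[OF h(1)] unfolding continuous_at_eps_delta by blast
  obtain r1 where r1: "r1 > 0" "\<And>z. dist z x < r1 \<Longrightarrow> dist (D 1 z) (D 1 x) < h / 2"
    using near[of 1] by blast
  obtain r2 where r2: "r2 > 0" "\<And>z. dist z x < r2 \<Longrightarrow> dist (D 2 z) (D 2 x) < h / 2"
    using near[of 2] by blast
  note r12 = r1 r2
  define r where "r = min r0 (min r1 r2) / 2"
  have r: "0 < r" "r \<le> r0" "r < r1" "r < r2" using r0(1) r12(1,3) by (auto simp: r_def)
  have sub: "cball x r \<subseteq> S" using r0(2) subset_cball[OF r(2)] by blast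
  have Ld: "norm (?L z v - ?L x v) \<le> h * norm v" if z: "z \<in> cball x r" for z v
  proof -
    have "dist z x < r1" "dist z x < r2" using z r by (auto simp: dist_commute)
    then have d: "norm (D 1 z - D 1 x) \<le> h / 2" "norm (D 2 z - D 2 x) \<le> h / 2"
      using r12(2)[of z] r12(4)[of z] by (simp_all add: dist_norm)
    have "?L z v - ?L x v = v $ 1 *\<^sub>R (D 1 z - D 1 x) + v $ 2 *\<^sub>R (D 2 z - D 2 x)"
      by (simp add: sum_2 algebra_simps)
    then have "norm (?L z v - ?L x v) \<le> norm (v $ 1 *\<^sub>R (D 1 z - D 1 x)) + norm (v $ 2 *\<^sub>R (D 2 z - D 2 x))"
      using norm_triangle_ineq[of "v $ 1 *\<^sub>R (D 1 z - D 1 x)" "v $ 2 *\<^sub>R (D 2 z - D 2 x)"] by simp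
    also have "\<dots> \<le> norm v * (h / 2) + norm v * (h / 2)"
      unfolding norm_scaleR real_norm_def
      by (intro add_mono mult_mono component_le_norm_cart d norm_ge_zero)
    finally show ?thesis by (simp add: mult.commute)
  qed
  have Fd: "norm (F z - F y - ?L x (z - y)) \<le> h * norm (z - y)" if "y \<in> cball x r" "z \<in> cball x r" for y z
  proof -
    have lin: "bounded_linear (?L x)"
      using has_derivative_pdiff[OF diff_F[OF x]] by (rule has_derivative_bounded_linear)
    have "norm ((F z - ?L x z) - (F y - ?L x y)) \<le> h * norm (z - y)"
    proof (rule differentiable_bound[OF convex_cball _ _ that(2,1)])
      fix w assume w: "w \<in> cball x r"
      then have wS: "w \<in> S" using sub by blast
      show "((\<lambda>z. F z - ?L x z) has_derivative (\<lambda>v. ?L w v - ?L x v)) (at w within cball x r)"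
        by (intro has_derivative_diff has_derivative_at_withinI[OF has_derivative_pdiff[OF diff_F[OF wS]]]
            bounded_linear.has_derivative[OF lin] has_derivative_ident)
      show "onorm (\<lambda>v. ?L w v - ?L x v) \<le> h" by (rule onorm_le) (rule Ld[OF w])
    qed
    moreover have "(F z - ?L x z) - (F y - ?L x y) = F z - F y - ?L x (z - y)"
      by (simp add: sum_2 algebra_simps)
    ultimately show ?thesis by simp
  qed
  have Q: "metric_inner (G x) v v = lorentz (?L x v) (?L x v)" for v
    unfolding metric_inner_G[OF x] frechet_F[OF x] ..
  have est: "\<bar>lorentz (F z - F y) (?L w (z - y)) - metric_inner (G x) (z - y) (z - y)\<bar> \<le> metric_inner (G x) (z - y) (z - y) / 2"
    "\<bar>lorentz (F z - F y) (F z - F y) - metric_inner (G x) (z - y) (z - y)\<bar> \<le> metric_inner (G x) (z - y) (z - y) / 2"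
    if y: "y \<in> cball x r" and z: "z \<in> cball x r" and w: "w \<in> cball x r" for y z w
  proof -
    let ?v = "z - y"
    have hm': "(8 * B * h + 4 * h\<^sup>2) * (norm ?v)\<^sup>2 \<le> metric_inner (G x) ?v ?v / 2"
      using mult_right_mono[OF hm zero_le_power2[of "norm ?v"]] m(2)[of ?v] by simp
    have "\<bar>lorentz (?L x ?v + (F z - F y - ?L x ?v)) (?L x ?v + (?L w ?v - ?L x ?v)) - lorentz (?L x ?v) (?L x ?v)\<bar>
      \<le> (8 * B * h + 4 * h\<^sup>2) * (norm ?v)\<^sup>2"
      using h(1) by (intro lorentz_perturb Lb Fd[OF y z] Ld[OF w] B0) simp
    then show "\<bar>lorentz (F z - F y) (?L w ?v) - metric_inner (G x) ?v ?v\<bar> \<le> metric_inner (G x) ?v ?v / 2"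
      using hm' unfolding Q by simp
    have "\<bar>lorentz (?L x ?v + (F z - F y - ?L x ?v)) (?L x ?v + (F z - F y - ?L x ?v)) - lorentz (?L x ?v) (?L x ?v)\<bar>
      \<le> (8 * B * h + 4 * h\<^sup>2) * (norm ?v)\<^sup>2"
      using h(1) by (intro lorentz_perturb Lb Fd[OF y z] B0) simp
    then show "\<bar>lorentz (F z - F y) (F z - F y) - metric_inner (G x) ?v ?v\<bar> \<le> metric_inner (G x) ?v ?v / 2"
      using hm' unfolding Q by simp
  qed
  have ch: "- 2 * lorentz (F y) (F z) = lorentz (F z - F y) (F z - F y)" if "y \<in> cball x r" "z \<in> cball x r" for y z
    using F_null[of y] F_null[of z] sub that by (simp add: lorentz_simps lorentz_sym subset_iff)
  have Qb: "metric_inner (G x) v v \<le> (4 * B\<^sup>2) * (norm v)\<^sup>2" for v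
  proof -
    have "metric_inner (G x) v v \<le> 4 * (norm (?L x v) * norm (?L x v))"
      unfolding Q using lorentz_bound[of "?L x v" "?L x v"] by linarith
    also have "\<dots> \<le> 4 * ((B * norm v) * (B * norm v))"
      using B0 by (intro mult_left_mono mult_mono Lb) auto
    finally show ?thesis by (simp add: power2_eq_square mult_ac)
  qed
  show ?thesis
  proof (rule that[of r "6 * B\<^sup>2 + 1"])
    show "0 < r" "cball x r \<subseteq> S" by (rule r(1), rule sub)
    show "0 < 6 * B\<^sup>2 + 1" by (simp add: add_nonneg_pos)
    fix y z assume yz: "y \<in> cball x r" "z \<in> cball x r"
    note e2 = est(2)[OF yz yz(1)] and e1 = est(1)[OF yz yz(2)]
    show "metric_inner (G x) (z - y) (z - y) / 2 \<le> - 2 * lorentz (F y) (F z)"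
      unfolding ch[OF yz] using e2 by linarith
    show "- 2 * lorentz (F y) (F z) \<le> (6 * B\<^sup>2 + 1) * (norm (z - y))\<^sup>2"
    proof -
      have "- 2 * lorentz (F y) (F z) \<le> 3 / 2 * metric_inner (G x) (z - y) (z - y)"
        unfolding ch[OF yz] using e2 by linarith
      also have "\<dots> \<le> 3 / 2 * ((4 * B\<^sup>2) * (norm (z - y))\<^sup>2)" using Qb by (intro mult_left_mono) auto
      also have "\<dots> \<le> (6 * B\<^sup>2 + 1) * (norm (z - y))\<^sup>2" by (simp add: algebra_simps)
      finally show ?thesis .
    qed
    assume ne: "y \<noteq> z"
    have zS: "z \<in> S" using yz sub by blast
    have "pdiff i (\<lambda>w. - 2 * lorentz (F y) (F w)) z = - 2 * lorentz (F y) (D i z)" for i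
      by (rule pdiff_linear(1)[OF bounded_linear_const_mult[OF lorentz.bounded_linear_right] diff_F[OF zS]])
    then have "dir1 (\<lambda>w. - 2 * lorentz (F y) (F w)) z (z - y) = - 2 * lorentz (F y) (?L z (z - y))"
      by (simp add: dir1_def sum_2 lorentz_simps algebra_simps)
    also have "\<dots> = 2 * lorentz (F z - F y) (?L z (z - y))"
      using D_F[OF zS] by (simp add: sum_2 lorentz_simps lorentz_sym[of "F z"])
    finally have eq: "dir1 (\<lambda>w. - 2 * lorentz (F y) (F w)) z (z - y) = 2 * lorentz (F z - F y) (?L z (z - y))" .
    have "0 < metric_inner (G x) (z - y) (z - y)" using posdef[OF x] ne by simp
    then show "dir1 (\<lambda>w. - 2 * lorentz (F y) (F w)) z (z - y) \<noteq> 0" unfolding eq using e1 by linarith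
  qed
qed

end

locale connected_light_cone_surface = light_cone_surface A g \<Psi> f
  for A :: "('a::{t2_space,second_countable_topology}) chart set" and g \<Psi> f +
  assumes connected: "connected (UNIV :: 'a set)"

sublocale connected_light_cone_surface \<subseteq> connected_surface A g
  by unfold_locales (rule surface, rule connected)

context connected_light_cone_surface
begin

definition chord :: "'a \<Rightarrow> 'a \<Rightarrow> real" where
  "chord p q = - 2 * lorentz (\<Psi> p) (\<Psi> q)"

text \<open>
  Unless it is degenerate, the chord has a nonzero differential in its second end point. The velocity of
  this end point can then be chosen so that the chord has a prescribed derivative.
\<close>

definition regular_chord :: "'a \<Rightarrow> 'a \<Rightarrow> bool" where
  "regular_chord p q \<longleftrightarrow> (\<exists>c\<in>A. q \<in> chart_dom c \<and>
     (p \<noteq> q \<longrightarrow> (\<exists>v. dir1 (\<lambda>y. chord p (chart_inv c y)) (chart_map c q) v \<noteq> 0)))"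

text \<open>
  The constant 4 in the lower bound for the chord is universal, whereas \<open>C\<close> depends on the compact set under
  consideration. The universal constant fixes the radius of a disc containing all chains of bounded
  energy before the constants on this disc are chosen.
\<close>

definition good_edge :: "real \<Rightarrow> 'a \<Rightarrow> 'a \<Rightarrow> bool" where
  "good_edge C p q \<longleftrightarrow> (d p q)\<^sup>2 \<le> 4 * chord p q \<and> chord p q \<le> C * (d p q)\<^sup>2 \<and> regular_chord p q"

lemma local_good_edge:
  "\<exists>\<delta> C. 0 < \<delta> \<and> 0 < C \<and> (\<forall>q q'. d p q < \<delta> \<longrightarrow> d p q' < \<delta> \<longrightarrow> good_edge C q q')"
proof -
  obtain c where c: "c \<in> A" "p \<in> chart_dom c" using chart_at by blast
  interpret P: null_cone_patch "\<Psi> \<circ> chart_inv c" "chart_img c" by (rule patch[OF c(1)])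
  let ?x = "chart_map c p"
  have x: "?x \<in> chart_img c" by (rule map_img[OF c(2)])
  obtain r1 m b where r1: "0 < r1" "0 < m" "cball ?x r1 \<subseteq> chart_img c"
    "\<And>v. m * (norm v)\<^sup>2 \<le> metric_inner (g c ?x) v v"
    "\<And>y v. y \<in> cball ?x r1 \<Longrightarrow> metric_inner (g c y) v v \<le> 2 * metric_inner (g c ?x) v v"
    using local_metric[OF c(1) x] by metis
  have G: "P.G ?x = g c ?x" by (rule isometric[OF c(1) x])
  have m: "m * (norm v)\<^sup>2 \<le> metric_inner (P.G ?x) v v" for v unfolding G by (rule r1(4))
  have chord: "chord (chart_inv c y) (chart_inv c z) = - 2 * lorentz ((\<Psi> \<circ> chart_inv c) y) ((\<Psi> \<circ> chart_inv c) z)" for y z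
    by (simp add: chord_def)
  let ?F = "\<Psi> \<circ> chart_inv c"
  obtain r2 C where r2: "0 < r2" "0 < C" "cball ?x r2 \<subseteq> chart_img c"
    "\<And>y z. y \<in> cball ?x r2 \<Longrightarrow> z \<in> cball ?x r2 \<Longrightarrow>
        metric_inner (P.G ?x) (z - y) (z - y) / 2 \<le> - 2 * lorentz (?F y) (?F z)"
    "\<And>y z. y \<in> cball ?x r2 \<Longrightarrow> z \<in> cball ?x r2 \<Longrightarrow> - 2 * lorentz (?F y) (?F z) \<le> C * (norm (z - y))\<^sup>2"
    "\<And>y z. y \<in> cball ?x r2 \<Longrightarrow> z \<in> cball ?x r2 \<Longrightarrow> y \<noteq> z \<Longrightarrow>
        dir1 (\<lambda>w. - 2 * lorentz (?F y) (?F w)) z (z - y) \<noteq> 0"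
    by (rule P.local_chord_metric[OF x r1(2) m]) (rule that; assumption)
  note r2 = r2(1,2) r2(4-6)[unfolded chord[symmetric] G]
  obtain s K where s: "0 < s" "0 < K"
    "\<And>y z. y \<in> cball ?x s \<Longrightarrow> z \<in> cball ?x s \<Longrightarrow> norm (y - z) \<le> K * d (chart_inv c y) (chart_inv c z)"
    "\<And>e. 0 < e \<Longrightarrow> \<exists>\<delta>>0. \<forall>q. d p q < \<delta> \<longrightarrow> q \<in> chart_dom c \<and> chart_map c q \<in> ball ?x e"
    using local_distance[OF c] by metis
  define r where "r = min r1 (min r2 s)"
  have r: "0 < r" "cball ?x r \<subseteq> cball ?x r1" "cball ?x r \<subseteq> cball ?x r2" "cball ?x r \<subseteq> cball ?x s"
    using r1(1) r2(1) s(1) by (auto simp: r_def)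
  obtain \<delta> where \<delta>: "\<delta> > 0" "\<And>q. d p q < \<delta> \<Longrightarrow> q \<in> chart_dom c \<and> chart_map c q \<in> ball ?x r"
    using s(4)[OF r(1)] by blast
  have "good_edge (C * K\<^sup>2) q q'" if q: "d p q < \<delta>" and q': "d p q' < \<delta>" for q q'
  proof -
    let ?y = "chart_map c q" and ?z = "chart_map c q'"
    have dom: "q \<in> chart_dom c" "q' \<in> chart_dom c" using \<delta>(2) q q' by blast+
    have yz: "?y \<in> cball ?x r" "?z \<in> cball ?x r" using \<delta>(2)[OF q] \<delta>(2)[OF q'] by auto
    note inv = inv_map[OF c(1) dom(1)] inv_map[OF c(1) dom(2)]
    have d2: "d q q' \<le> sqrt (2 * metric_inner (g c ?x) (?z - ?y) (?z - ?y))"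
      using d_segment[OF c(1) convex_cball[of ?x r1] r1(3), of ?y ?z "2 * metric_inner (g c ?x) (?z - ?y) (?z - ?y)"]
        yz r(2) r1(5) unfolding inv by blast
    have "(d q q')\<^sup>2 \<le> 2 * metric_inner (g c ?x) (?z - ?y) (?z - ?y)"
      using power_mono[OF d2 d_nonneg, of 2] metric_inner_posI(1)[OF surf c(1) x, of "?z - ?y"] by simp
    also have "\<dots> \<le> 4 * chord q q'"
      using r2(3)[of ?y ?z] yz r(3) unfolding inv by (simp add: subset_iff)
    finally have 1: "(d q q')\<^sup>2 \<le> 4 * chord q q'" .
    have "norm (?z - ?y) \<le> K * d q q'"
      using s(3)[of ?y ?z] yz r(4) unfolding inv by (simp add: subset_iff norm_minus_commute)
    then have "(norm (?z - ?y))\<^sup>2 \<le> (K * d q q')\<^sup>2" by (intro power_mono) auto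
    then have "C * (norm (?z - ?y))\<^sup>2 \<le> C * K\<^sup>2 * (d q q')\<^sup>2" using r2(2) by (simp add: power_mult_distrib)
    moreover have "chord q q' \<le> C * (norm (?z - ?y))\<^sup>2"
      using r2(4)[of ?y ?z] yz r(3) unfolding inv by (simp add: subset_iff)
    ultimately have 2: "chord q q' \<le> C * K\<^sup>2 * (d q q')\<^sup>2" by linarith
    have "regular_chord q q'"
      unfolding regular_chord_def
    proof (intro bexI[OF _ c(1)] conjI impI)
      show "q' \<in> chart_dom c" by (rule dom(2))
      assume "q \<noteq> q'"
      then have "?y \<noteq> ?z" using inv by metis
      then show "\<exists>v. dir1 (\<lambda>y. chord q (chart_inv c y)) ?z v \<noteq> 0"
        using r2(5)[of ?y ?z] yz r(3) unfolding inv by blast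
    qed
    with 1 2 show ?thesis by (simp add: good_edge_def)
  qed
  moreover have "0 < C * K\<^sup>2" using r2(2) s(2) by simp
  ultimately show ?thesis using \<delta>(1) by blast
qed

lemma uniform_good_edge:
  assumes comp: "compact B"
  shows "\<exists>r C. 0 < r \<and> 0 < C \<and> (\<forall>q\<in>B. \<forall>q'. d q q' \<le> r \<longrightarrow> good_edge C q q')"
proof (cases "B = {}")
  case True
  then show ?thesis by (intro exI[of _ 1]) auto
next
  case False
  have "\<forall>p. \<exists>k :: real \<times> real. 0 < fst k \<and> 0 < snd k \<and>
      (\<forall>q q'. d p q < fst k \<longrightarrow> d p q' < fst k \<longrightarrow> good_edge (snd k) q q')" (is "\<forall>p. ?P p")
  proof
    fix p
    obtain \<delta> C where "0 < \<delta>" "0 < C" "\<forall>q q'. d p q < \<delta> \<longrightarrow> d p q' < \<delta> \<longrightarrow> good_edge C q q'"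
      using local_good_edge by blast
    then show "?P p"
      by (intro exI[of _ "(\<delta>, C)"]) simp
  qed
  from choice[OF this] obtain k where k: "\<And>p. 0 < fst (k p)" "\<And>p. 0 < snd (k p)"
    "\<And>p q q'. d p q < fst (k p) \<Longrightarrow> d p q' < fst (k p) \<Longrightarrow> good_edge (snd (k p)) q q'" by blast
  have cover: "B \<subseteq> (\<Union>p\<in>B. {q. d p q < fst (k p) / 2})"
  proof
    fix q assume "q \<in> B"
    moreover have "d q q < fst (k q) / 2" using k(1)[of q] by (simp add: d_self)
    ultimately show "q \<in> (\<Union>p\<in>B. {q. d p q < fst (k p) / 2})" by blast
  qed
  obtain Q where Q: "Q \<subseteq> B" "finite Q" "B \<subseteq> (\<Union>p\<in>Q. {q. d p q < fst (k p) / 2})"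
    by (rule compactE_image[OF comp _ cover]) (rule open_mball)
  have ne: "Q \<noteq> {}" using Q(3) False by blast
  define r where "r = Min ((\<lambda>p. fst (k p)) ` Q) / 4"
  define C where "C = Max ((\<lambda>p. snd (k p)) ` Q)"
  have r: "0 < r" "\<And>p. p \<in> Q \<Longrightarrow> 4 * r \<le> fst (k p)" using Q(2) ne k(1) by (auto simp: r_def)
  have C: "0 < C" "\<And>p. p \<in> Q \<Longrightarrow> snd (k p) \<le> C" using Q(2) ne k(2) by (auto simp: C_def Max_gr_iff)
  have "good_edge C q q'" if q: "q \<in> B" and q': "d q q' \<le> r" for q q'
  proof -
    obtain p where p: "p \<in> Q" "d p q < fst (k p) / 2" using Q(3) q by blast
    have "d p q < fst (k p)" using p(2) k(1)[of p] by simp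
    moreover have "d p q' < fst (k p)" using d_triangle[of p q' q] q' p(2) r(2)[OF p(1)] r(1) by simp
    ultimately have g: "good_edge (snd (k p)) q q'" by (rule k(3))
    have "snd (k p) * (d q q')\<^sup>2 \<le> C * (d q q')\<^sup>2" using C(2)[OF p(1)] by (intro mult_right_mono) auto
    then show ?thesis using g by (auto simp: good_edge_def)
  qed
  then show ?thesis using r(1) C(1) by blast
qed

end

section \<open>Holomorphic variations of chains\<close>

text \<open>
  The function is the squared chord between points with the logarithmic heights \<open>a\<close>, \<open>a'\<close> and the
  stereographic coordinates \<open>z\<close>, \<open>w\<close>. Its logarithm is the sum of \<open>a\<close>, \<open>a'\<close> and twice the logarithm of
  \<open>|w - z|\<close>. The latter is harmonic, so its contribution changes sign when \<open>\<beta>, \<gamma>\<close> are replaced by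
  \<open>\<i> \<beta>, \<i> \<gamma>\<close>.
\<close>

lemma edge_jet:
  assumes a: "has_jet2 a p1 p2" and a': "has_jet2 a' q1 q2"
    and z: "has_jet2 z1 (Re \<beta>) 0" "has_jet2 z2 (Im \<beta>) 0"
    and w: "has_jet2 w1 (Re \<gamma>) 0" "has_jet2 w2 (Im \<gamma>) 0"
    and D: "D = Complex (w1 0 - z1 0) (w2 0 - z2 0)" "D \<noteq> 0"
    and e: "e = exp (a 0 + a' 0) * (cmod D)\<^sup>2"
    and \<kappa>: "\<kappa> = p1 + q1 + 2 * Re ((\<gamma> - \<beta>) / D)"
  shows "has_jet2 (\<lambda>s. exp (a s + a' s) * ((w1 s - z1 s)\<^sup>2 + (w2 s - z2 s)\<^sup>2))
     (e * \<kappa>) (e * (\<kappa>\<^sup>2 + (p2 + q2 - 2 * Re (((\<gamma> - \<beta>) / D)\<^sup>2))))"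
proof -
  define M where "M s = (w1 s - z1 s) * (w1 s - z1 s) + (w2 s - z2 s) * (w2 s - z2 s)" for s
  define \<omega> where "\<omega> = (\<gamma> - \<beta>) / D"
  have \<delta>: "\<gamma> - \<beta> = \<omega> * D" using D(2) by (simp add: \<omega>_def)
  have \<delta>1: "Re \<gamma> - Re \<beta> = Re \<omega> * Re D - Im \<omega> * Im D" and \<delta>2: "Im \<gamma> - Im \<beta> = Re \<omega> * Im D + Im \<omega> * Re D"
    using arg_cong[OF \<delta>, of Re] arg_cong[OF \<delta>, of Im] by simp_all
  have M0: "M 0 = (cmod D)\<^sup>2" unfolding cmod_power2 by (simp add: M_def D(1) power2_eq_square)
  have pos: "0 < M 0" using D(2) by (simp add: M0)
  have d1: "has_jet2 (\<lambda>s. w1 s - z1 s) (Re \<gamma> - Re \<beta>) (0 - 0)" by (rule has_jet2_diff[OF w(1) z(1)])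
  have d2: "has_jet2 (\<lambda>s. w2 s - z2 s) (Im \<gamma> - Im \<beta>) (0 - 0)" by (rule has_jet2_diff[OF w(2) z(2)])
  have M: "has_jet2 M (2 * Re \<omega> * M 0) (2 * ((Re \<omega>)\<^sup>2 + (Im \<omega>)\<^sup>2) * M 0)"
  proof -
    have D12: "w1 0 - z1 0 = Re D" "w2 0 - z2 0 = Im D" by (simp_all add: D(1))
    have e1: "(Re \<gamma> - Re \<beta>) * (w1 0 - z1 0) + (w1 0 - z1 0) * (Re \<gamma> - Re \<beta>)
       + ((Im \<gamma> - Im \<beta>) * (w2 0 - z2 0) + (w2 0 - z2 0) * (Im \<gamma> - Im \<beta>)) = 2 * Re \<omega> * M 0"
      unfolding \<delta>1 \<delta>2 M_def D12 by (simp add: algebra_simps)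
    have e2: "(0 - 0) * (w1 0 - z1 0) + 2 * (Re \<gamma> - Re \<beta>) * (Re \<gamma> - Re \<beta>) + (w1 0 - z1 0) * (0 - 0)
       + ((0 - 0) * (w2 0 - z2 0) + 2 * (Im \<gamma> - Im \<beta>) * (Im \<gamma> - Im \<beta>) + (w2 0 - z2 0) * (0 - 0))
       = 2 * ((Re \<omega>)\<^sup>2 + (Im \<omega>)\<^sup>2) * M 0"
      unfolding \<delta>1 \<delta>2 M_def D12 by (simp add: power2_eq_square algebra_simps)
    show ?thesis
      using has_jet2_add[OF has_jet2_mult[OF d1 d1] has_jet2_mult[OF d2 d2]]
      unfolding e1 e2 M_def[abs_def] .
  qed
  have lM: "has_jet2 (\<lambda>s. ln (M s)) (2 * Re \<omega>) (- 2 * Re (\<omega>\<^sup>2))"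
  proof -
    have "2 * Re \<omega> * M 0 / M 0 = 2 * Re \<omega>"
      "2 * ((Re \<omega>)\<^sup>2 + (Im \<omega>)\<^sup>2) * M 0 / M 0 - (2 * Re \<omega>)\<^sup>2 = - 2 * Re (\<omega>\<^sup>2)"
      using pos by (simp_all add: power2_eq_square)
    then show ?thesis using has_jet2_ln[OF M pos] by simp
  qed
  have "has_jet2 (\<lambda>s. exp (a s + a' s + ln (M s))) (e * \<kappa>) (e * (\<kappa>\<^sup>2 + (p2 + q2 - 2 * Re (\<omega>\<^sup>2))))"
  proof -
    have "exp (a 0 + a' 0 + ln (M 0)) = e" using pos by (simp add: e exp_add M0)
    then show ?thesis
      using has_jet2_exp[OF has_jet2_add[OF has_jet2_add[OF a a'] lM]] by (simp add: \<kappa> \<omega>_def)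
  qed
  moreover have "\<forall>\<^sub>F s in nhds 0. exp (a s + a' s + ln (M s)) = exp (a s + a' s) * ((w1 s - z1 s)\<^sup>2 + (w2 s - z2 s)\<^sup>2)"
  proof -
    have "\<forall>\<^sub>F s in nhds 0. M s \<in> {0<..}"
      by (rule isCont_eventually_mem[OF has_jet2_isCont[OF M]]) (use pos in auto)
    then show ?thesis
      by eventually_elim (simp add: exp_add M_def power2_eq_square)
  qed
  ultimately show ?thesis unfolding \<omega>_def by (rule has_jet2_cong)
qed

text \<open>
  The logarithm used in \<open>edge_jet\<close> is not available for coinciding end points; there both coordinate
  differences have a vanishing jet.
\<close>

lemma degenerate_edge_jet:
  assumes a: "has_jet2 a p1 p2" and a': "has_jet2 a' q1 q2"
    and z: "has_jet2 z1 b1 0" "has_jet2 z2 b2 0" and w: "has_jet2 w1 b1 0" "has_jet2 w2 b2 0"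
    and D: "w1 0 = z1 0" "w2 0 = z2 0"
  shows "has_jet2 (\<lambda>s. exp (a s + a' s) * ((w1 s - z1 s)\<^sup>2 + (w2 s - z2 s)\<^sup>2)) 0 0"
proof -
  have d: "has_jet2 (\<lambda>s. w1 s - z1 s) 0 0" "has_jet2 (\<lambda>s. w2 s - z2 s) 0 0"
    using has_jet2_diff[OF w(1) z(1)] has_jet2_diff[OF w(2) z(2)] by simp_all
  have "has_jet2 (\<lambda>s. (w1 s - z1 s)\<^sup>2 + (w2 s - z2 s)\<^sup>2) 0 0"
    using has_jet2_add[OF has_jet2_mult[OF d(1) d(1)] has_jet2_mult[OF d(2) d(2)]] D
    by (simp add: power2_eq_square)
  from has_jet2_mult[OF has_jet2_exp[OF has_jet2_add[OF a a']] this] show ?thesis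
    using D by simp
qed

lemma DERIV_edge:
  assumes "(a has_real_derivative m) (at 0)" "(w1 has_real_derivative n1) (at 0)" "(w2 has_real_derivative n2) (at 0)"
  shows "((\<lambda>s. exp (c + a s) * ((w1 s - z1)\<^sup>2 + (w2 s - z2)\<^sup>2)) has_real_derivative
    exp (c + a 0) * (m * ((w1 0 - z1)\<^sup>2 + (w2 0 - z2)\<^sup>2) + 2 * ((w1 0 - z1) * n1 + (w2 0 - z2) * n2))) (at 0)"
  using assms by (auto intro!: derivative_eq_intros simp: algebra_simps)

context null_cone_patch
begin

text \<open>
  The stereographic coordinate has an invertible differential, so every covector is the real part of a
  complex multiple of it.
\<close>

lemma complex_gradient:
  assumes x: "x \<in> S" and nz: "\<forall>y\<in>S. A t y \<noteq> 0"
  shows "\<exists>\<mu>. \<forall>v. dir1 L x v = Re (\<mu> * Complex (dir1 (Z1 t) x v) (dir1 (Z2 t) x v))"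
proof -
  define a c d e where abcd: "a = pdiff 1 (Z1 t) x" "c = pdiff 2 (Z1 t) x"
    "d = pdiff 1 (Z2 t) x" "e = pdiff 2 (Z2 t) x"
  define J where "J = a * e - c * d"
  have J: "J \<noteq> 0" using stereographic_jacobian(1)[OF x nz] by (simp add: abcd J_def)
  define p q where "p = (pdiff 1 L x * e - pdiff 2 L x * d) / J" and "q = (a * pdiff 2 L x - c * pdiff 1 L x) / J"
  have "p * a + q * d = pdiff 1 L x * J / J" "p * c + q * e = pdiff 2 L x * J / J"
    unfolding p_def q_def times_divide_eq_left add_divide_distrib[symmetric]
    by (simp_all add: J_def algebra_simps)
  then have L: "pdiff 1 L x = p * a + q * d" "pdiff 2 L x = p * c + q * e" using J by simp_all
  have "dir1 L x v = Re (Complex p (- q) * Complex (dir1 (Z1 t) x v) (dir1 (Z2 t) x v))" for v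
    unfolding dir1_def sum_2 L abcd[symmetric] by (simp add: algebra_simps)
  then show ?thesis by blast
qed

end

context connected_light_cone_surface
begin

definition ht :: "real \<Rightarrow> 'a \<Rightarrow> real" where
  "ht t p = - lorentz (\<Psi> p) (pole t)"

definition zc :: "real \<Rightarrow> 'a \<Rightarrow> complex" where
  "zc t p = stereo t (\<Psi> p)"

lemma \<Psi>_cone: "\<Psi> p \<in> future_light_cone"
proof -
  obtain c where c: "c \<in> A" "p \<in> chart_dom c" using chart_at by blast
  interpret P: null_cone_patch "\<Psi> \<circ> chart_inv c" "chart_img c" by (rule patch[OF c(1)])
  show ?thesis using P.cone[OF map_img[OF c(2)]] by (simp add: inv_map[OF c])
qed

lemma \<Psi>_null: "lorentz (\<Psi> p) (\<Psi> p) = 0"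
  using \<Psi>_cone by (simp add: future_light_cone_def)

lemma chord_stereographic:
  assumes "0 < ht t p" "0 < ht t q"
  shows "chord p q = ht t p * ht t q * (cmod (zc t q - zc t p))\<^sup>2"
  using chord_stereo[OF \<Psi>_null _ \<Psi>_null, of p t q] assms
  by (simp add: chord_def ht_def zc_def norm_minus_commute)

lemma chord_exp:
  assumes "0 < ht t p" "0 < ht t q"
  shows "chord p q = exp (ln (ht t p) + ln (ht t q)) *
    ((Re (zc t q) - Re (zc t p))\<^sup>2 + (Im (zc t q) - Im (zc t p))\<^sup>2)"
  using assms by (simp add: chord_stereographic exp_add cmod_power2)

text \<open>
  A curve through a point whose stereographic coordinate moves with velocity \<open>b\<close> and without
  acceleration; \<open>\<mu>\<close> encodes the gradient of the logarithm of the height, and \<open>l, k\<close> are the second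
  derivatives of this logarithm and of \<open>f\<close> along the curve.
\<close>

definition variation :: "real \<Rightarrow> complex \<Rightarrow> complex \<Rightarrow> (real \<Rightarrow> 'a) \<Rightarrow> real \<Rightarrow> real \<Rightarrow> bool" where
  "variation t \<mu> b X l k \<longleftrightarrow> isCont X 0 \<and> has_jet2 (\<lambda>s. Re (zc t (X s))) (Re b) 0 \<and>
     has_jet2 (\<lambda>s. Im (zc t (X s))) (Im b) 0 \<and> has_jet2 (\<lambda>s. ln (ht t (X s))) (Re (\<mu> * b)) l \<and>
     (\<exists>k'. has_jet2 (\<lambda>s. f (X s)) k' k)"

text \<open>
  The curves are parabolas with straight jets in the directions \<open>b\<close> and \<open>\<i> b\<close>; the logarithm of the height
  is superharmonic by the Liouville equation. The last clause concerns a chord from \<open>x\<close> to \<open>q\<close>: its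
  logarithmic derivative, when \<open>q\<close> moves with velocity \<open>b\<close>, is the real part of
  \<open>(\<mu> + 2 / (zc t q - zc t x)) b\<close>, and a chord with nonzero differential has a nonzero factor there.
\<close>

lemma node_variation:
  assumes nn: "nonneg_curvature A g" and c: "c \<in> A" "q \<in> chart_dom c" and t: "0 < ht t q"
  shows "\<exists>\<mu>. (\<forall>b. \<exists>X X' l l' k k'. X 0 = q \<and> X' 0 = q \<and> variation t \<mu> b X l k \<and> variation t \<mu> (\<i> * b) X' l' k' \<and>
      l + l' \<le> 0 \<and> k + k' = (cmod b)\<^sup>2 * (ht t q)\<^sup>2 * laplacian (g c) (f \<circ> chart_inv c) (chart_map c q)) \<and>
    (\<forall>x. 0 < ht t x \<longrightarrow> zc t x \<noteq> zc t q \<longrightarrow> (\<exists>v. dir1 (\<lambda>y. chord x (chart_inv c y)) (chart_map c q) v \<noteq> 0) \<longrightarrow>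
      \<mu> * (zc t q - zc t x) + 2 \<noteq> 0)"
proof -
  let ?F = "\<Psi> \<circ> chart_inv c" and ?x = "chart_map c q"
  interpret P0: null_cone_patch ?F "chart_img c" by (rule patch[OF c(1)])
  define S where "S = chart_img c \<inter> (\<lambda>y. P0.A t y) -` {..<0}"
  have S: "open S" unfolding S_def
    by (rule continuous_open_preimage[OF smooth_on_continuous[OF P0.smooth_coordinate] P0.open_S open_lessThan])
  have SS: "S \<subseteq> chart_img c" by (auto simp: S_def)
  interpret P: null_cone_patch ?F S
    by (rule null_cone_patch_subset[OF patch[OF c(1)] S SS])
  have x: "?x \<in> S" using map_img[OF c(2)] t by (simp add: S_def ht_def inv_map[OF c])
  have neg: "\<And>y. y \<in> S \<Longrightarrow> P.A t y < 0" by (simp add: S_def)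
  then have nz: "\<forall>y\<in>S. P.A t y \<noteq> 0" by fastforce
  define L where "L = (\<lambda>y. ln (- lorentz (?F y) (pole t)))"
  have sL: "smooth_on S L" unfolding L_def
    by (intro smooth_on_ln smooth_on_minus P.smooth_coordinate S) (use neg in force)
  have sf: "smooth_on S (f \<circ> chart_inv c)"
    by (rule smooth_on_subset[OF smooth_f[unfolded surface_smooth_def, rule_format, OF c(1)] SS])
  have G: "P.G y = g c y" if "y \<in> S" for y using isometric[OF c(1)] SS that by blast
  have lapL: "laplacian P.G L ?x \<le> 0"
  proof -
    have "laplacian P.G L ?x = - gauss_curvature P.G ?x"
      unfolding L_def using P.laplacian_ln_height[OF x neg pole_null] P.gauss_curvature_eq[OF x] by linarith
    also have "gauss_curvature P.G ?x = gauss_curvature (g c) ?x" by (rule gauss_curvature_cong[OF S x G])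
    also have "- gauss_curvature (g c) ?x \<le> 0" using nn c(1) map_img[OF c(2)] by (simp add: nonneg_curvature_def)
    finally show ?thesis .
  qed
  have lapf: "laplacian P.G (f \<circ> chart_inv c) ?x = laplacian (g c) (f \<circ> chart_inv c) ?x"
    by (rule laplacian_cong[OF S x G]) simp_all
  obtain \<mu> where \<mu>: "\<And>v. dir1 L ?x v = Re (\<mu> * Complex (dir1 (P.Z1 t) ?x v) (dir1 (P.Z2 t) ?x v))"
    using P.complex_gradient[OF x nz] by blast
  have cont: "isCont (\<lambda>s. chart_inv c (jet_curve ?x v w s)) 0" for v w
  proof -
    have "isCont (chart_inv c) (jet_curve ?x v w 0)"
      using homeomorphism_cont2[OF chart_homeo[OF c(1)]] open_img[OF c(1)] map_img[OF c(2)] continuous_on_eq_continuous_at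
      by (metis jet_curve_0)
    moreover have "isCont (jet_curve ?x v w) 0"
      using continuous_jet_curve continuous_on_eq_continuous_at open_UNIV by blast
    ultimately show ?thesis by (rule isCont_o2[rotated])
  qed
  have Re_zc: "Re (zc t (chart_inv c y)) = P.Z1 t y" and Im_zc: "Im (zc t (chart_inv c y)) = P.Z2 t y"
    and ln_ht: "ln (ht t (chart_inv c y)) = L y" for y
    by (simp_all add: zc_def stereo_def ht_def L_def)
  note jet = has_jet2_jet_curve[OF S x]
  have var: "variation t \<mu> b (\<lambda>s. chart_inv c (jet_curve ?x v w s)) (dir2 L ?x v + dir1 L ?x w)
      (dir2 (f \<circ> chart_inv c) ?x v + dir1 (f \<circ> chart_inv c) ?x w)"
    if "P.straight_jet t ?x b v w" for b v w
  proof -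
    have j: "dir1 (P.Z1 t) ?x v = Re b" "dir1 (P.Z2 t) ?x v = Im b"
      "dir2 (P.Z1 t) ?x v + dir1 (P.Z1 t) ?x w = 0" "dir2 (P.Z2 t) ?x v + dir1 (P.Z2 t) ?x w = 0"
      using that by (auto simp: P.straight_jet_def)
    have "has_jet2 (\<lambda>s. Re (zc t (chart_inv c (jet_curve ?x v w s)))) (Re b) 0"
      unfolding Re_zc using jet[OF P.smooth_Z(1)[OF nz], of v w] unfolding j .
    moreover have "has_jet2 (\<lambda>s. Im (zc t (chart_inv c (jet_curve ?x v w s)))) (Im b) 0"
      unfolding Im_zc using jet[OF P.smooth_Z(2)[OF nz], of v w] unfolding j .
    moreover have "has_jet2 (\<lambda>s. ln (ht t (chart_inv c (jet_curve ?x v w s)))) (Re (\<mu> * b)) (dir2 L ?x v + dir1 L ?x w)"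
      unfolding ln_ht using jet[OF sL, of v w] unfolding \<mu> j by (simp add: complex_surj)
    moreover have "has_jet2 (\<lambda>s. f (chart_inv c (jet_curve ?x v w s))) (dir1 (f \<circ> chart_inv c) ?x v)
        (dir2 (f \<circ> chart_inv c) ?x v + dir1 (f \<circ> chart_inv c) ?x w)"
      using jet[OF sf, of v w] by simp
    ultimately show ?thesis using cont unfolding variation_def by blast
  qed
  have 1: "\<exists>X X' l l' k k'. X 0 = q \<and> X' 0 = q \<and> variation t \<mu> b X l k \<and> variation t \<mu> (\<i> * b) X' l' k' \<and>
      l + l' \<le> 0 \<and> k + k' = (cmod b)\<^sup>2 * (ht t q)\<^sup>2 * laplacian (g c) (f \<circ> chart_inv c) ?x" for b
  proof -
    obtain v w where v: "P.straight_jet t ?x b v w" using P.straight_jet_exists[OF x nz] by blast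
    obtain v' w' where v': "P.straight_jet t ?x (\<i> * b) v' w'" using P.straight_jet_exists[OF x nz] by blast
    have "dir2 L ?x v + dir1 L ?x w + (dir2 L ?x v' + dir1 L ?x w') \<le> 0"
      unfolding P.straight_jet_laplacian[OF x nz sL v v']
      by (intro mult_nonneg_nonpos lapL) simp
    moreover have "dir2 (f \<circ> chart_inv c) ?x v + dir1 (f \<circ> chart_inv c) ?x w + (dir2 (f \<circ> chart_inv c) ?x v' + dir1 (f \<circ> chart_inv c) ?x w')
        = (cmod b)\<^sup>2 * (ht t q)\<^sup>2 * laplacian (g c) (f \<circ> chart_inv c) ?x"
      unfolding P.straight_jet_laplacian[OF x nz sf v v'] lapf by (simp add: ht_def inv_map[OF c])
    ultimately show ?thesis
      using var[OF v] var[OF v']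
      by (intro exI[of _ "\<lambda>s. chart_inv c (jet_curve ?x v w s)"] exI[of _ "\<lambda>s. chart_inv c (jet_curve ?x v' w' s)"] exI conjI)
        (simp_all add: inv_map[OF c])
  qed
  have 2: "\<mu> * (zc t q - zc t p) + 2 \<noteq> 0"
    if p: "0 < ht t p" and ne: "zc t p \<noteq> zc t q" and v: "dir1 (\<lambda>y. chord p (chart_inv c y)) ?x v \<noteq> 0" for p v
  proof
    assume eq: "\<mu> * (zc t q - zc t p) + 2 = 0"
    define b where "b = Complex (dir1 (P.Z1 t) ?x v) (dir1 (P.Z2 t) ?x v)"
    define D where "D = zc t q - zc t p"
    have D0: "D \<noteq> 0" using ne by (simp add: D_def)
    let ?X = "\<lambda>s. chart_inv c (jet_curve ?x v 0 s)"
    have z0: "dir1 k ?x 0 = 0" for k by (simp add: dir1_def)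
    have jL: "has_jet2 (\<lambda>s. ln (ht t (?X s))) (Re (\<mu> * b)) (dir2 L ?x v)"
      unfolding ln_ht using jet[OF sL, of v 0] unfolding \<mu>[of v] b_def[symmetric] z0 by simp
    have jZ: "\<exists>l. has_jet2 (\<lambda>s. Re (zc t (?X s))) (Re b) l" "\<exists>l. has_jet2 (\<lambda>s. Im (zc t (?X s))) (Im b) l"
      unfolding Re_zc Im_zc b_def complex.sel using jet[OF P.smooth_Z(1)[OF nz]] jet[OF P.smooth_Z(2)[OF nz]] by blast+
    have se: "smooth_on S (\<lambda>y. chord p (chart_inv c y))"
      unfolding chord_def
      by (rule smooth_on_mult[OF S smooth_on_const P.smooth_lorentz[OF smooth_on_const P.smooth[unfolded o_def]]])
    have "((\<lambda>s. chord p (?X s)) has_real_derivative dir1 (\<lambda>y. chord p (chart_inv c y)) ?x v) (at 0)"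
      by (rule has_jet2_DERIV[OF jet[OF se, of v 0]])
    moreover have "((\<lambda>s. chord p (?X s)) has_real_derivative 0) (at 0)"
    proof -
      have dL: "((\<lambda>s. ln (ht t (?X s))) has_real_derivative Re (\<mu> * b)) (at 0)" by (rule has_jet2_DERIV[OF jL])
      have d1: "((\<lambda>s. Re (zc t (?X s))) has_real_derivative Re b) (at 0)"
        and d2: "((\<lambda>s. Im (zc t (?X s))) has_real_derivative Im b) (at 0)"
        using jZ has_jet2_DERIV by blast+
      have X0: "?X 0 = q" by (simp add: inv_map[OF c])
      let ?e = "\<lambda>s. exp (ln (ht t p) + ln (ht t (?X s))) * ((Re (zc t (?X s)) - Re (zc t p))\<^sup>2 + (Im (zc t (?X s)) - Im (zc t p))\<^sup>2)"
      have "(?e has_real_derivative exp (ln (ht t p) + ln (ht t q)) * (Re (\<mu> * b) * ((Re D)\<^sup>2 + (Im D)\<^sup>2) + 2 * (Re D * Re b + Im D * Im b))) (at 0)"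
        using DERIV_edge[OF dL d1 d2, of "ln (ht t p)" "Re (zc t p)" "Im (zc t p)"] by (simp add: inv_map[OF c] D_def)
      moreover have "Re (\<mu> * b) * ((Re D)\<^sup>2 + (Im D)\<^sup>2) + 2 * (Re D * Re b + Im D * Im b) = Re ((\<mu> * D + 2) * (b * cnj D))"
        by (simp add: power2_eq_square algebra_simps)
      ultimately have "(?e has_real_derivative 0) (at 0)" using eq by (simp add: D_def)
      moreover have ev: "\<forall>\<^sub>F s in nhds 0. ?e s = chord p (?X s)"
        using eventually_jet_curve[OF S x, of v 0]
        by eventually_elim (rule chord_exp[OF p, symmetric], simp add: S_def ht_def)
      ultimately show ?thesis using DERIV_cong_ev[OF HOL.refl ev HOL.refl] by simp
    qed
    ultimately show False using DERIV_unique v by blast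
  qed
  show ?thesis using 1 2 by (intro exI[of _ \<mu>]) blast
qed


lemma isCont_of_charts:
  fixes k :: "'a \<Rightarrow> 'b::topological_space"
  assumes "\<And>c. c \<in> A \<Longrightarrow> continuous_on (chart_img c) (k \<circ> chart_inv c)"
  shows "isCont k p"
proof -
  obtain c where c: "c \<in> A" "p \<in> chart_dom c" using chart_at by blast
  have "continuous_on (chart_dom c) ((k \<circ> chart_inv c) \<circ> chart_map c)"
    by (rule continuous_on_compose[OF homeomorphism_cont1[OF chart_homeo[OF c(1)]]])
      (simp only: homeomorphism_image1[OF chart_homeo[OF c(1)]] assms[OF c(1)])
  then have "continuous_on (chart_dom c) k"
    by (rule continuous_on_eq) (simp add: inv_map[OF c(1)])
  then show ?thesis using open_dom[OF c(1)] c(2) continuous_on_eq_continuous_at by blast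
qed

lemma isCont_\<Psi>: "isCont \<Psi> p"
  by (rule isCont_of_charts) (rule smooth_on_continuous[OF null_cone_patch.smooth[OF patch]])

lemma isCont_f: "isCont f p"
  by (rule isCont_of_charts) (rule smooth_on_continuous[OF smooth_f[unfolded surface_smooth_def, rule_format]])

lemma isCont_ht: "isCont (ht t) p"
  unfolding ht_def by (intro continuous_intros bounded_bilinear.continuous[OF bounded_bilinear_lorentz] isCont_\<Psi>)

lemma eventually_ht_pos:
  assumes "isCont X (0::real)" "0 < ht t (X 0)"
  shows "\<forall>\<^sub>F s in nhds 0. 0 < ht t (X s)"
proof -
  have "isCont (\<lambda>s. ht t (X s)) 0" by (rule isCont_o2[OF assms(1) isCont_ht])
  from isCont_eventually_mem[OF this open_greaterThan[of 0]] assms(2) show ?thesis by simp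
qed

text \<open>
  The relation between \<open>b\<close> and \<open>b'\<close> says that the logarithm of the chord has derivative 1 along the
  first pair of curves and 0 along the second. As the logarithms of the heights are superharmonic and that
  of the coordinate distance is harmonic, the logarithm of the chord is superharmonic.
\<close>

lemma edge_variation:
  assumes X: "variation t \<mu> b X l k" "variation t \<mu> (\<i> * b) X' l' k'" "X 0 = p" "X' 0 = p" "l + l' \<le> 0"
    and Y: "variation t \<nu> b' Y m j" "variation t \<nu> (\<i> * b') Y' m' j'" "Y 0 = q" "Y' 0 = q" "m + m' \<le> 0"
    and h: "0 < ht t p" "0 < ht t q"
    and rel: "p = q \<and> b' = b \<or> zc t p \<noteq> zc t q \<and> \<mu> * b + \<nu> * b' + 2 * (b' - b) / (zc t q - zc t p) = 1"
  shows "\<exists>n n'. has_jet2 (\<lambda>s. chord (X s) (Y s)) (chord p q) n \<and> has_jet2 (\<lambda>s. chord (X' s) (Y' s)) 0 n' \<and>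
     n + n' \<le> chord p q"
proof -
  have cong: "has_jet2 (\<lambda>s. chord (V s) (W s)) a1 a2"
    if "has_jet2 (\<lambda>s. exp (ln (ht t (V s)) + ln (ht t (W s))) *
      ((Re (zc t (W s)) - Re (zc t (V s)))\<^sup>2 + (Im (zc t (W s)) - Im (zc t (V s)))\<^sup>2)) a1 a2"
      "isCont V 0" "isCont W 0" "V 0 = p" "W 0 = q" for V W a1 a2
  proof (rule has_jet2_cong[OF that(1)])
    have "\<forall>\<^sub>F s in nhds 0. 0 < ht t (V s)" "\<forall>\<^sub>F s in nhds 0. 0 < ht t (W s)"
      using eventually_ht_pos that h by auto
    then show "\<forall>\<^sub>F s in nhds 0. exp (ln (ht t (V s)) + ln (ht t (W s))) *
      ((Re (zc t (W s)) - Re (zc t (V s)))\<^sup>2 + (Im (zc t (W s)) - Im (zc t (V s)))\<^sup>2) = chord (V s) (W s)"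
      by eventually_elim (simp add: chord_exp)
  qed
  note jX = X(1,2)[unfolded variation_def] and jY = Y(1,2)[unfolded variation_def]
  show ?thesis
    using rel
  proof
    assume pq: "p = q \<and> b' = b"
    have "has_jet2 (\<lambda>s. chord (X s) (Y s)) 0 0"
      by (rule cong[OF degenerate_edge_jet[where ?b1.0 = "Re b" and ?b2.0 = "Im b"]])
        (use jX jY pq X(3) Y(3) in auto)
    moreover have "has_jet2 (\<lambda>s. chord (X' s) (Y' s)) 0 0"
      by (rule cong[OF degenerate_edge_jet[where ?b1.0 = "Re (\<i> * b)" and ?b2.0 = "Im (\<i> * b)"]])
        (use jX jY pq X(4) Y(4) in auto)
    moreover have "chord p q = 0" using pq \<Psi>_null by (simp add: chord_def)
    ultimately show ?thesis by (intro exI[of _ 0]) simp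
  next
    assume *: "zc t p \<noteq> zc t q \<and> \<mu> * b + \<nu> * b' + 2 * (b' - b) / (zc t q - zc t p) = 1"
    define D where "D = zc t q - zc t p"
    have D: "D \<noteq> 0" "\<mu> * b + \<nu> * b' + 2 * ((b' - b) / D) = 1" using * by (auto simp: D_def)
    have e: "chord p q = exp (ln (ht t p) + ln (ht t q)) * (cmod D)\<^sup>2"
      using chord_exp[OF h] by (simp add: D_def cmod_power2)
    have r: "Re a + Re a' + 2 * Re w = Re c" if "a + a' + 2 * w = c" for a a' w c :: complex
      using arg_cong[OF that, of Re] by simp
    have r1: "Re (\<mu> * b) + Re (\<nu> * b') + 2 * Re ((b' - b) / D) = 1"
      using r[OF D(2)] by simp
    have w: "(\<i> * b' - \<i> * b) / D = \<i> * ((b' - b) / D)"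
      by (simp add: diff_divide_distrib right_diff_distrib)
    have "\<mu> * (\<i> * b) + \<nu> * (\<i> * b') + 2 * (\<i> * ((b' - b) / D)) = \<i> * (\<mu> * b + \<nu> * b' + 2 * ((b' - b) / D))"
      by (simp add: algebra_simps)
    then have "\<mu> * (\<i> * b) + \<nu> * (\<i> * b') + 2 * (\<i> * ((b' - b) / D)) = \<i>" using D(2) by simp
    from r[OF this]
    have r2: "Re (\<mu> * (\<i> * b)) + Re (\<nu> * (\<i> * b')) + 2 * Re (\<i> * ((b' - b) / D)) = 0" by simp
    have 1: "has_jet2 (\<lambda>s. chord (X s) (Y s)) (chord p q * 1) (chord p q * (1\<^sup>2 + (l + m - 2 * Re (((b' - b) / D)\<^sup>2))))"
      by (rule cong[OF edge_jet[where \<beta> = b and \<gamma> = b' and D = D]])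
        (use jX jY X(3) Y(3) D(1) e r1 in \<open>auto simp: D_def complex_eq_iff\<close>)
    have 2: "has_jet2 (\<lambda>s. chord (X' s) (Y' s)) (chord p q * 0) (chord p q * (0\<^sup>2 + (l' + m' - 2 * Re (((\<i> * b' - \<i> * b) / D)\<^sup>2))))"
      by (rule cong[OF edge_jet[where \<beta> = "\<i> * b" and \<gamma> = "\<i> * b'" and D = D]])
        (use jX jY X(4) Y(4) D(1) e r2 w in \<open>auto simp: D_def complex_eq_iff\<close>)
    have "Re (((\<i> * b' - \<i> * b) / D)\<^sup>2) = - Re (((b' - b) / D)\<^sup>2)"
      unfolding w power_mult_distrib power2_i by (simp only: mult_minus_left mult_1_left uminus_complex.sel)
    then have "chord p q * (1\<^sup>2 + (l + m - 2 * Re (((b' - b) / D)\<^sup>2))) + chord p q * (0\<^sup>2 + (l' + m' - 2 * Re (((\<i> * b' - \<i> * b) / D)\<^sup>2)))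
      = chord p q * (1 + (l + l') + (m + m'))"
      by (simp add: algebra_simps)
    also have "\<dots> \<le> chord p q * 1"
      using X(5) Y(5) by (intro mult_left_mono) (auto simp: e)
    finally show ?thesis using 1 2 by (intro exI conjI) simp_all
  qed
qed

definition energy :: "nat \<Rightarrow> (nat \<Rightarrow> 'a) \<Rightarrow> real" where
  "energy N x = (\<Sum>i<N. chord (x i) (x (Suc i)))"

lemma laplacian_f_nonneg:
  assumes "nonneg_curvature A g" "c \<in> A" "x \<in> chart_img c"
  shows "0 \<le> laplacian (g c) (f \<circ> chart_inv c) x"
  using assms laplacian_f[OF assms(2,3)] by (force simp: nonneg_curvature_def)

lemma chord_pos:
  assumes "good_edge C p q" "p \<noteq> q"
  shows "0 < chord p q"
proof -
  have "0 < (d p q)\<^sup>2" using d_zero[of p q] assms(2) by auto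
  also have "\<dots> \<le> 4 * chord p q" using assms(1) by (simp add: good_edge_def)
  finally show ?thesis by simp
qed

text \<open>
  The velocities are chosen so that all chords, and hence the energy, are multiplied by \<open>1 + s\<close> to first
  order along the first family of curves and are unchanged to first order along the second. Then the
  logarithm of the energy is superharmonic with gradient of length one, a strictly concave increasing
  function of it is strictly superharmonic, and \<open>f\<close> minus a multiple of this function has no interior
  maximum.
\<close>

lemma chain_no_interior_maximum:
  assumes nn: "nonneg_curvature A g" and N: "0 < N"
    and ge: "\<And>i. i < N \<Longrightarrow> good_edge C (x i) (x (Suc i))"
    and E: "0 < energy N x" and \<epsilon>: "0 < \<epsilon>" and a: "0 < a" and \<tau>: "0 < 1 + ln (a * energy N x)"
    and mx: "\<And>Y. Y 0 = x \<Longrightarrow> (\<And>s. Y s 0 = x 0) \<Longrightarrow> (\<And>s i. N < i \<Longrightarrow> Y s i = x i) \<Longrightarrow>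
      (\<And>i. isCont (\<lambda>s::real. Y s i) 0) \<Longrightarrow>
      \<forall>\<^sub>F s in nhds 0. f (Y s N) - \<epsilon> * ln (1 + ln (a * energy N (Y s)))
        \<le> f (x N) - \<epsilon> * ln (1 + ln (a * energy N x))"
  shows False
proof -
  obtain t where t0: "\<forall>X\<in>\<Psi> ` x ` {..N}. lorentz X (pole t) < 0"
    using avoiding_pole[of "\<Psi> ` x ` {..N}"] \<Psi>_cone by auto
  have t: "0 < ht t (x i)" if "i \<le> N" for i using t0 that by (auto simp: ht_def)
  define z where "z i = zc t (x i)" for i
  have zne: "z i \<noteq> z (Suc i)" if i: "i < N" "x i \<noteq> x (Suc i)" for i
    using chord_pos[OF ge[OF i(1)] i(2)] chord_stereographic[OF t t, of i "Suc i"] i(1) by (auto simp: z_def)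
  have "\<forall>i. \<exists>\<mu>. i < N \<longrightarrow> (\<forall>b. \<exists>X X' l l' k k'. X 0 = x (Suc i) \<and> X' 0 = x (Suc i) \<and> variation t \<mu> b X l k \<and>
      variation t \<mu> (\<i> * b) X' l' k' \<and> l + l' \<le> 0 \<and> 0 \<le> k + k') \<and>
      (x i \<noteq> x (Suc i) \<longrightarrow> \<mu> * (z (Suc i) - z i) + 2 \<noteq> 0)" (is "\<forall>i. ?P i")
  proof
    fix i
    show "?P i"
    proof (cases "i < N")
      case True
      obtain c where c: "c \<in> A" "x (Suc i) \<in> chart_dom c"
        "x i \<noteq> x (Suc i) \<longrightarrow> (\<exists>v. dir1 (\<lambda>y. chord (x i) (chart_inv c y)) (chart_map c (x (Suc i))) v \<noteq> 0)"
        using ge[OF True] unfolding good_edge_def regular_chord_def by blast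
      have lap: "0 \<le> laplacian (g c) (f \<circ> chart_inv c) (chart_map c (x (Suc i)))"
        by (rule laplacian_f_nonneg[OF nn c(1) map_img[OF c(2)]])
      have hi: "0 < ht t (x (Suc i))" "0 < ht t (x i)" using t True by auto
      obtain \<mu> where \<mu>: "\<forall>b. \<exists>X X' l l' k k'. X 0 = x (Suc i) \<and> X' 0 = x (Suc i) \<and> variation t \<mu> b X l k \<and> variation t \<mu> (\<i> * b) X' l' k' \<and>
          l + l' \<le> 0 \<and> k + k' = (cmod b)\<^sup>2 * (ht t (x (Suc i)))\<^sup>2 * laplacian (g c) (f \<circ> chart_inv c) (chart_map c (x (Suc i)))"
        "\<forall>y. 0 < ht t y \<longrightarrow> zc t y \<noteq> zc t (x (Suc i)) \<longrightarrow> (\<exists>v. dir1 (\<lambda>w. chord y (chart_inv c w)) (chart_map c (x (Suc i))) v \<noteq> 0) \<longrightarrow>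
          \<mu> * (zc t (x (Suc i)) - zc t y) + 2 \<noteq> 0"
        using node_variation[OF nn c(1,2) hi(1)] by blast
      have "0 \<le> (cmod b)\<^sup>2 * (ht t (x (Suc i)))\<^sup>2 * laplacian (g c) (f \<circ> chart_inv c) (chart_map c (x (Suc i)))" for b
        using lap by simp
      with \<mu>(1) have "\<forall>b. \<exists>X X' l l' k k'. X 0 = x (Suc i) \<and> X' 0 = x (Suc i) \<and> variation t \<mu> b X l k \<and>
          variation t \<mu> (\<i> * b) X' l' k' \<and> l + l' \<le> 0 \<and> 0 \<le> k + k'" by metis
      moreover have "x i \<noteq> x (Suc i) \<longrightarrow> \<mu> * (z (Suc i) - z i) + 2 \<noteq> 0"
        using \<mu>(2) hi(2) zne[OF True] c(3) unfolding z_def by blast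
      ultimately show ?thesis by blast
    qed simp
  qed
  from choice[OF this] obtain m where m:
    "\<And>i b. i < N \<Longrightarrow> \<exists>X X' l l' k k'. X 0 = x (Suc i) \<and> X' 0 = x (Suc i) \<and> variation t (m i) b X l k \<and>
      variation t (m i) (\<i> * b) X' l' k' \<and> l + l' \<le> 0 \<and> 0 \<le> k + k'"
    "\<And>i. i < N \<Longrightarrow> x i \<noteq> x (Suc i) \<Longrightarrow> m i * (z (Suc i) - z i) + 2 \<noteq> 0" by blast
  define \<mu> where "\<mu> i = (case i of 0 \<Rightarrow> 0 | Suc j \<Rightarrow> m j)" for i
  \<comment> \<open>The recursion solves the relation in \<open>edge_variation\<close> for the velocity of the later node.\<close>
  define b where "b = rec_nat 0 (\<lambda>i \<beta>. if x i = x (Suc i) then \<beta> else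
      (1 - \<mu> i * \<beta> + 2 * \<beta> / (z (Suc i) - z i)) / (\<mu> (Suc i) + 2 / (z (Suc i) - z i)))"
  have b0: "b 0 = 0" by (simp add: b_def)
  have rel: "x i = x (Suc i) \<and> b (Suc i) = b i \<or>
     z i \<noteq> z (Suc i) \<and> \<mu> i * b i + \<mu> (Suc i) * b (Suc i) + 2 * (b (Suc i) - b i) / (z (Suc i) - z i) = 1"
    if i: "i < N" for i
  proof (cases "x i = x (Suc i)")
    case True
    then show ?thesis by (simp add: b_def)
  next
    case False
    define D where "D = z (Suc i) - z i"
    have D: "D \<noteq> 0" using zne[OF i False] by (simp add: D_def)
    have nz: "\<mu> (Suc i) + 2 / D \<noteq> 0"
    proof
      assume "\<mu> (Suc i) + 2 / D = 0"
      then have "(\<mu> (Suc i) + 2 / D) * D = 0" by simp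
      then have "\<mu> (Suc i) * D + 2 = 0" using D by (simp add: distrib_right)
      then show False using m(2)[OF i False] by (simp add: \<mu>_def D_def)
    qed
    have "b (Suc i) = (1 - \<mu> i * b i + 2 * b i / D) / (\<mu> (Suc i) + 2 / D)" using False by (simp add: b_def D_def)
    then have "(\<mu> (Suc i) + 2 / D) * b (Suc i) = 1 - \<mu> i * b i + 2 * b i / D" using nz by simp
    then have "\<mu> i * b i + \<mu> (Suc i) * b (Suc i) + 2 * (b (Suc i) - b i) / D = 1"
      by (simp add: algebra_simps diff_divide_distrib)
    then show ?thesis using zne[OF i False] by (simp add: D_def)
  qed
  \<comment> \<open>All chains start at the same point, so the initial node must not move.\<close>
  have nodes: "\<forall>i. \<exists>W :: (real \<Rightarrow> 'a) \<times> (real \<Rightarrow> 'a) \<times> real \<times> real \<times> real \<times> real.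
     case W of (X, X', l, l', k, k') \<Rightarrow> X 0 = x i \<and> X' 0 = x i \<and> (i \<le> N \<longrightarrow> variation t (\<mu> i) (b i) X l k \<and>
       variation t (\<mu> i) (\<i> * b i) X' l' k' \<and> l + l' \<le> 0 \<and> 0 \<le> k + k') \<and> (i = 0 \<or> N < i \<longrightarrow> X = (\<lambda>s. x i) \<and> X' = (\<lambda>s. x i))"
    (is "\<forall>i. ?Q i")
  proof
    fix i
    show "?Q i"
    proof (cases "0 < i \<and> i \<le> N")
      case True
      then obtain j where j: "i = Suc j" "j < N" by (cases i) auto
      obtain X X' l l' k k' where "X 0 = x i \<and> X' 0 = x i \<and> variation t (\<mu> i) (b i) X l k \<and>
        variation t (\<mu> i) (\<i> * b i) X' l' k' \<and> l + l' \<le> 0 \<and> 0 \<le> k + k'"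
        using m(1)[OF j(2), of "b i"] unfolding j(1) \<mu>_def by auto
      then show ?thesis using True by (intro exI[of _ "(X, X', l, l', k, k')"]) auto
    next
      case False
      have "variation t \<mu> 0 (\<lambda>s. x i) 0 0" for \<mu>
        unfolding variation_def using has_jet2_const by auto
      then show ?thesis using False b0
        by (intro exI[of _ "(\<lambda>s. x i, \<lambda>s. x i, 0, 0, 0, 0)"]) auto
    qed
  qed
  from choice[OF nodes] obtain W where W: "\<forall>i. case W i of (X, X', l, l', k, k') \<Rightarrow> X 0 = x i \<and> X' 0 = x i \<and> (i \<le> N \<longrightarrow> variation t (\<mu> i) (b i) X l k \<and>
       variation t (\<mu> i) (\<i> * b i) X' l' k' \<and> l + l' \<le> 0 \<and> 0 \<le> k + k') \<and> (i = 0 \<or> N < i \<longrightarrow> X = (\<lambda>s. x i) \<and> X' = (\<lambda>s. x i))" ..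
  define X X' l l' k k' where XX: "X i = fst (W i)" "X' i = fst (snd (W i))" "l i = fst (snd (snd (W i)))"
    "l' i = fst (snd (snd (snd (W i))))" "k i = fst (snd (snd (snd (snd (W i)))))" "k' i = snd (snd (snd (snd (snd (W i)))))" for i
  have X: "X i 0 = x i" "X' i 0 = x i"
    "i \<le> N \<Longrightarrow> variation t (\<mu> i) (b i) (X i) (l i) (k i)" "i \<le> N \<Longrightarrow> variation t (\<mu> i) (\<i> * b i) (X' i) (l' i) (k' i)"
    "i \<le> N \<Longrightarrow> l i + l' i \<le> 0" "i \<le> N \<Longrightarrow> 0 \<le> k i + k' i"
    "i = 0 \<or> N < i \<Longrightarrow> X i = (\<lambda>s. x i)" "i = 0 \<or> N < i \<Longrightarrow> X' i = (\<lambda>s. x i)" for i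
    using spec[OF W, of i] unfolding XX by (auto simp: split_beta)
  have "\<forall>i. \<exists>n. i < N \<longrightarrow> has_jet2 (\<lambda>s. chord (X i s) (X (Suc i) s)) (chord (x i) (x (Suc i))) (fst n) \<and>
     has_jet2 (\<lambda>s. chord (X' i s) (X' (Suc i) s)) 0 (snd n) \<and> fst n + snd n \<le> chord (x i) (x (Suc i))"
    (is "\<forall>i. ?R i")
  proof
    fix i
    show "?R i"
    proof (cases "i < N")
      case True
      then have le: "i \<le> N" "Suc i \<le> N" by auto
      have "\<exists>n n'. has_jet2 (\<lambda>s. chord (X i s) (X (Suc i) s)) (chord (x i) (x (Suc i))) n \<and>
         has_jet2 (\<lambda>s. chord (X' i s) (X' (Suc i) s)) 0 n' \<and> n + n' \<le> chord (x i) (x (Suc i))"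
        using edge_variation[OF X(3)[OF le(1)] X(4)[OF le(1)] X(1,2) X(5)[OF le(1)]
            X(3)[OF le(2)] X(4)[OF le(2)] X(1,2) X(5)[OF le(2)] t[OF le(1)] t[OF le(2)]] rel[OF True]
        unfolding z_def by blast
      then obtain n n' where "has_jet2 (\<lambda>s. chord (X i s) (X (Suc i) s)) (chord (x i) (x (Suc i))) n"
         "has_jet2 (\<lambda>s. chord (X' i s) (X' (Suc i) s)) 0 n'" "n + n' \<le> chord (x i) (x (Suc i))" by blast
      then show ?thesis by (intro exI[of _ "(n, n')"]) simp
    qed simp
  qed
  from choice[OF this] obtain n where n: "\<And>i. i < N \<Longrightarrow> has_jet2 (\<lambda>s. chord (X i s) (X (Suc i) s)) (chord (x i) (x (Suc i))) (fst (n i))"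
     "\<And>i. i < N \<Longrightarrow> has_jet2 (\<lambda>s. chord (X' i s) (X' (Suc i) s)) 0 (snd (n i))"
     "\<And>i. i < N \<Longrightarrow> fst (n i) + snd (n i) \<le> chord (x i) (x (Suc i))" by blast
  define E0 e2 e2' where "E0 = energy N x" and "e2 = (\<Sum>i<N. fst (n i))" and "e2' = (\<Sum>i<N. snd (n i))"
  have jE: "has_jet2 (\<lambda>s. energy N (\<lambda>i. X i s)) E0 e2"
    unfolding energy_def E0_def e2_def by (rule has_jet2_sum) (use n(1) in simp)
  have jE': "has_jet2 (\<lambda>s. energy N (\<lambda>i. X' i s)) 0 e2'"
    using has_jet2_sum[of "{..<N}" "\<lambda>i s. chord (X' i s) (X' (Suc i) s)" "\<lambda>i. 0"] n(2)
    by (simp add: energy_def e2'_def)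
  have e2: "e2 + e2' \<le> E0"
    unfolding e2_def e2'_def E0_def energy_def sum.distrib[symmetric] by (rule sum_mono) (use n(3) in simp)
  have X0: "(\<lambda>i. X i 0) = x" "(\<lambda>i. X' i 0) = x" by (simp_all add: X)
  define T where "T = 1 + ln (a * E0)"
  have T: "0 < T" using \<tau> by (simp add: T_def E0_def)
  have E0: "0 < E0" using E by (simp add: E0_def)
  \<comment> \<open>The square in the second derivative is the strict gain from the outer logarithm.\<close>
  have ch: "has_jet2 (\<lambda>s. ln (1 + ln (a * h s))) (h1 / E0 / T) ((h2 / E0 - (h1 / E0)\<^sup>2) / T - (h1 / E0 / T)\<^sup>2)"
    if h: "has_jet2 h h1 h2" "h 0 = E0" for h h1 h2
  proof -
    have 1: "has_jet2 (\<lambda>s. ln (a * h s)) (h1 / E0) (h2 / E0 - (h1 / E0)\<^sup>2)"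
      using has_jet2_ln[OF has_jet2_cmult[OF h(1), of a]] h(2) a E0 by simp
    have 2: "has_jet2 (\<lambda>s. 1 + ln (a * h s)) (h1 / E0) (h2 / E0 - (h1 / E0)\<^sup>2)"
      using has_jet2_add[OF has_jet2_const[of 1] 1] by simp
    show ?thesis using has_jet2_ln[OF 2] h(2) T by (simp add: T_def)
  qed
  obtain c1 c1' where f: "has_jet2 (\<lambda>s. f (X N s)) c1 (k N)" "has_jet2 (\<lambda>s. f (X' N s)) c1' (k' N)"
    using X(3,4)[of N] unfolding variation_def by auto
  have Lx: "(\<lambda>i. X i s) 0 = x 0" "(\<lambda>i. X' i s) 0 = x 0" "N < i \<Longrightarrow> X i s = x i" "N < i \<Longrightarrow> X' i s = x i" for s i
    using X(7,8)[of 0] X(7,8)[of i] by auto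
  have cX: "isCont (\<lambda>s. X i s) 0" "isCont (\<lambda>s. X' i s) 0" for i
    using X(3,4)[of i] X(7,8)[of i] unfolding variation_def by (cases "i \<le> N"; auto)+
  have "k N - \<epsilon> * ((e2 / E0 - (E0 / E0)\<^sup>2) / T - (E0 / E0 / T)\<^sup>2) \<le> 0"
  proof (rule has_jet2_local_max[OF has_jet2_diff[OF f(1) has_jet2_cmult[OF ch[OF jE]]]])
    show "energy N (\<lambda>i. X i 0) = E0" by (simp add: X0 E0_def)
    show "\<forall>\<^sub>F s in nhds 0. f (X N s) - \<epsilon> * ln (1 + ln (a * energy N (\<lambda>i. X i s)))
      \<le> f (X N 0) - \<epsilon> * ln (1 + ln (a * energy N (\<lambda>i. X i 0)))"
      unfolding X0 X(1) by (rule mx[of "\<lambda>s i. X i s"]) (use X0 Lx cX in auto)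
  qed
  moreover have "k' N - \<epsilon> * ((e2' / E0 - (0 / E0)\<^sup>2) / T - (0 / E0 / T)\<^sup>2) \<le> 0"
  proof (rule has_jet2_local_max[OF has_jet2_diff[OF f(2) has_jet2_cmult[OF ch[OF jE']]]])
    show "energy N (\<lambda>i. X' i 0) = E0" by (simp add: X0 E0_def)
    show "\<forall>\<^sub>F s in nhds 0. f (X' N s) - \<epsilon> * ln (1 + ln (a * energy N (\<lambda>i. X' i s)))
      \<le> f (X' N 0) - \<epsilon> * ln (1 + ln (a * energy N (\<lambda>i. X' i 0)))"
      unfolding X0 X(2) by (rule mx[of "\<lambda>s i. X' i s"]) (use X0 Lx cX in auto)
  qed
  ultimately have "k N + k' N - \<epsilon> * (((e2 + e2') / E0 - 1) / T - (1 / T)\<^sup>2) \<le> 0"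
    using E0 by (simp add: algebra_simps add_divide_distrib diff_divide_distrib)
  moreover have "((e2 + e2') / E0 - 1) / T - (1 / T)\<^sup>2 < 0"
  proof -
    have "(e2 + e2') / E0 \<le> 1" using e2 E0 by simp
    then have "((e2 + e2') / E0 - 1) / T \<le> 0" using T by (simp add: divide_nonpos_pos)
    moreover have "0 < (1 / T)\<^sup>2" using T by simp
    ultimately show ?thesis by linarith
  qed
  then have "\<epsilon> * (((e2 + e2') / E0 - 1) / T - (1 / T)\<^sup>2) < 0" using \<epsilon> by (rule mult_pos_neg[rotated])
  ultimately show False using X(6)[of N] by simp
qed

end

section \<open>Complete surfaces\<close>

context connected_light_cone_surface
begin

lemma tendsto_d:
  assumes "(X \<longlongrightarrow> p) F" "(Y \<longlongrightarrow> q) F"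
  shows "((\<lambda>s. d (X s) (Y s)) \<longlongrightarrow> d p q) F"
proof (rule tendstoI)
  fix e :: real assume e: "0 < e"
  have "\<forall>\<^sub>F s in F. X s \<in> {x. d p x < e / 2}" "\<forall>\<^sub>F s in F. Y s \<in> {x. d q x < e / 2}"
    by (rule topological_tendstoD[OF assms(1) open_mball], simp add: d_self e)
      (rule topological_tendstoD[OF assms(2) open_mball], simp add: d_self e)
  then show "\<forall>\<^sub>F s in F. dist (d (X s) (Y s)) (d p q) < e"
  proof eventually_elim
    case (elim s)
    then show ?case
      using d_triangle[of p q "X s"] d_triangle[of "X s" q "Y s"] d_triangle[of "X s" "Y s" p] d_triangle[of p "Y s" q]
        d_sym[of "X s" p] d_sym[of "Y s" q]
      by (simp add: dist_real_def abs_less_iff)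
  qed
qed

lemma continuous_on_node: "continuous_on S (\<lambda>x :: nat \<Rightarrow> 'a. x i)"
  using continuous_on_subset[OF continuous_on_product_coordinates subset_UNIV] .

lemma continuous_on_d_nodes: "continuous_on S (\<lambda>x :: nat \<Rightarrow> 'a. d (x i) (x j))"
  using continuous_on_node[of S i] continuous_on_node[of S j]
  unfolding continuous_on_def by (intro ballI tendsto_d) auto

lemma continuous_on_\<Psi>: "continuous_on S \<Psi>"
  using isCont_\<Psi> continuous_at_imp_continuous_on by blast

lemma continuous_on_f: "continuous_on S f"
  using isCont_f continuous_at_imp_continuous_on by blast

lemma continuous_on_energy: "continuous_on S (energy N)"
  unfolding energy_def[abs_def] chord_def
  by (intro continuous_intros bounded_bilinear.continuous_on[OF bounded_bilinear_lorentz]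
      continuous_on_compose2[OF continuous_on_\<Psi>[of UNIV]] continuous_on_node) auto

lemma isCont_energy:
  assumes "\<And>i. isCont (\<lambda>s::real. Y s i) 0"
  shows "isCont (\<lambda>s. energy N (Y s)) 0"
  unfolding energy_def chord_def
  by (intro continuous_intros bounded_bilinear.continuous[OF bounded_bilinear_lorentz] isCont_o2[OF assms isCont_\<Psi>])

lemma compact_chains: "compact B \<Longrightarrow> compact {x :: nat \<Rightarrow> 'a. \<forall>i. x i \<in> B}"
  using compactin_PiE[of "\<lambda>i::nat. euclidean :: 'a topology" UNIV "\<lambda>i. B"]
  unfolding euclidean_product_topology by (simp add: PiE_UNIV_domain Pi_def)

text \<open>
  The triangle inequality bounds the distance by the sum of the roots of the chords, and the inequality of
  Cauchy and Schwarz bounds this sum by the energy.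
\<close>

lemma chain_distance:
  assumes ge: "\<And>i. i < N \<Longrightarrow> good_edge C (x i) (x (Suc i))" and n: "n \<le> N"
  shows "d (x 0) (x n) \<le> 2 * sqrt (N * energy N x)"
proof -
  have c0: "0 \<le> chord (x i) (x (Suc i))" if "i < N" for i
    using ge[OF that] zero_le_power2[of "d (x i) (x (Suc i))"] unfolding good_edge_def by linarith
  have "d (x 0) (x m) \<le> (\<Sum>i<m. d (x i) (x (Suc i)))" for m
  proof (induction m)
    case (Suc m)
    then show ?case using d_triangle[of "x 0" "x (Suc m)" "x m"] by simp
  qed (simp add: d_self)
  also have "(\<Sum>i<n. d (x i) (x (Suc i))) \<le> (\<Sum>i<N. d (x i) (x (Suc i)))"
    using n d_nonneg by (intro sum_mono2) auto
  also have "\<dots> \<le> (\<Sum>i<N. 2 * sqrt (chord (x i) (x (Suc i))))"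
  proof (rule sum_mono)
    fix i assume "i \<in> {..<N}"
    then have "(d (x i) (x (Suc i)))\<^sup>2 \<le> 4 * chord (x i) (x (Suc i))" using ge by (simp add: good_edge_def)
    then have "d (x i) (x (Suc i)) \<le> sqrt (4 * chord (x i) (x (Suc i)))" by (rule real_le_rsqrt)
    then show "d (x i) (x (Suc i)) \<le> 2 * sqrt (chord (x i) (x (Suc i)))" by (simp add: real_sqrt_mult)
  qed
  also have "\<dots> = 2 * (\<Sum>i<N. sqrt (chord (x i) (x (Suc i))) * 1)" by (simp add: sum_distrib_left)
  also have "(\<Sum>i<N. sqrt (chord (x i) (x (Suc i))) * 1) \<le> sqrt (N * energy N x)"
  proof (rule real_le_rsqrt)
    have "(\<Sum>i<N. sqrt (chord (x i) (x (Suc i))) * 1)\<^sup>2 \<le> (\<Sum>i<N. (sqrt (chord (x i) (x (Suc i))))\<^sup>2) * (\<Sum>i<N. 1\<^sup>2)"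
      by (rule Cauchy_Schwarz_ineq_sum)
    also have "(\<Sum>i<N. (sqrt (chord (x i) (x (Suc i))))\<^sup>2) = energy N x"
      unfolding energy_def using c0 by (intro sum.cong) auto
    finally show "(\<Sum>i<N. sqrt (chord (x i) (x (Suc i))) * 1)\<^sup>2 \<le> N * energy N x" by (simp add: mult.commute)
  qed
  finally show ?thesis by simp
qed

lemma PL_subdivide:
  assumes "PL p q (real N * h)" "0 \<le> h"
  shows "\<exists>y. y 0 = p \<and> y N = q \<and> (\<forall>i<N. d (y i) (y (Suc i)) \<le> h) \<and> (\<forall>i\<le>N. d p (y i) \<le> real i * h)"
  using assms(1)
proof (induction N arbitrary: q)
  case 0
  then show ?case using d_le[OF 0[simplified]] d_nonneg[of p q] d_zero[of p q] d_self
    by (intro exI[of _ "\<lambda>i. p"]) (auto intro: antisym)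
next
  case (Suc N)
  obtain m where m: "PL p m (real N * h)" "PL m q (real (Suc N) * h - real N * h)"
    using PL_split[OF Suc.prems, of "real N * h"] assms(2) by (auto simp: distrib_right)
  obtain y where y: "y 0 = p" "y N = m" "\<forall>i<N. d (y i) (y (Suc i)) \<le> h" "\<forall>i\<le>N. d p (y i) \<le> real i * h"
    using Suc.IH[OF m(1)] by blast
  have mq: "d m q \<le> h" using d_le[OF m(2)] by (simp add: distrib_right)
  show ?case
  proof (intro exI[of _ "\<lambda>i. if i = Suc N then q else y i"] conjI allI impI)
    show "d (if i = Suc N then q else y i) (if Suc i = Suc N then q else y (Suc i)) \<le> h" if "i < Suc N" for i
      using y mq that by (auto simp: less_Suc_eq)
    show "d p (if i = Suc N then q else y i) \<le> real i * h" if "i \<le> Suc N" for i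
      using y d_le[OF Suc.prems] that by auto
  qed (use y(1) in auto)
qed

text \<open>
  At a maximum the second derivatives along both curves of \<open>node_variation\<close> would be nonpositive, but
  their sum is a positive multiple of the Laplacian.
\<close>

lemma no_max_of_strictly_subharmonic:
  assumes nn: "nonneg_curvature A g" and c: "c \<in> A" "q \<in> chart_dom c"
    and lap: "0 < laplacian (g c) (f \<circ> chart_inv c) (chart_map c q)"
  shows "\<exists>y. f q < f y"
proof (rule ccontr)
  assume "\<nexists>y. f q < f y"
  then have mx: "f y \<le> f q" for y by (meson not_less)
  obtain t where t: "0 < ht t q"
    using avoiding_pole[of "{\<Psi> q}"] \<Psi>_cone[of q] by (auto simp: ht_def)
  obtain \<mu> X X' l l' k k' where X: "X 0 = q" "X' 0 = q" "variation t \<mu> 1 X l k" "variation t \<mu> (\<i> * 1) X' l' k'"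
    "k + k' = (cmod 1)\<^sup>2 * (ht t q)\<^sup>2 * laplacian (g c) (f \<circ> chart_inv c) (chart_map c q)"
    using node_variation[OF nn c t] by blast
  obtain c1 c2 where "has_jet2 (\<lambda>s. f (X s)) c1 k" "has_jet2 (\<lambda>s. f (X' s)) c2 k'"
    using X(3,4) unfolding variation_def by blast
  then have "k \<le> 0" "k' \<le> 0"
    using has_jet2_local_max[of "\<lambda>s. f (X s)"] has_jet2_local_max[of "\<lambda>s. f (X' s)"] mx X(1,2) by auto
  moreover have "0 < k + k'" unfolding X(5) using lap t by simp
  ultimately show False by simp
qed

text \<open>
  Suppose that \<open>f\<close> were larger at \<open>y\<close> than on the disc of radius \<open>2 \<surd>e0\<close>. Among the chains from \<open>p\<close> of
  energy at least \<open>e0\<close>, consider the maximum of \<open>f\<close> at the end point minus \<open>\<epsilon>\<close> times \<open>v\<close> of the energy.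
  For small \<open>\<epsilon>\<close> a chain to \<open>y\<close> has a larger value than any chain of energy \<open>e0\<close>, as such chains end in the
  disc. As \<open>v\<close> is unbounded and \<open>f\<close> is bounded above, the energy at the maximum is less than \<open>Em\<close>, which does
  not depend on \<open>N\<close>. For large \<open>N\<close> all steps are then shorter than allowed, and the maximum is interior.
\<close>

lemma max_principle:
  assumes compl: "complete_surface A g" and nn: "nonneg_curvature A g" and bdd: "bdd_above (range f)"
    and e0: "0 < e0" and core: "\<And>q. d p q \<le> 2 * sqrt e0 \<Longrightarrow> f q \<le> m0"
  shows "f y \<le> m0"
proof (rule ccontr)
  assume "\<not> f y \<le> m0"
  then have fy: "m0 < f y" by simp
  then have far: "2 * sqrt e0 < d p y" using core not_le by blast
  have compact_B: "compact (disc p R)" for R by (rule hopf_rinow[OF compl])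
  obtain Sb where Sb: "\<And>q. f q \<le> Sb" using bdd by (auto simp: bdd_above_def)
  obtain L where L: "PL p y L" using PL_exists by blast
  have L0: "0 \<le> L" by (rule PL_nonneg[OF L])
  obtain r1 C where r1: "0 < r1" "0 < C" "\<And>q q'. d p q \<le> L \<Longrightarrow> d q q' \<le> r1 \<Longrightarrow> good_edge C q q'"
    using uniform_good_edge[OF compact_B[of L]] by auto
  define V where "V = max e0 (C * L\<^sup>2)"
  define v where "v E = ln (1 + ln (E / e0))" for E
  have v_mono: "v E \<le> v E'" if "e0 \<le> E" "E \<le> E'" for E E'
  proof -
    have "ln (E / e0) \<le> ln (E' / e0)" "0 \<le> ln (E / e0)"
      using that e0 by (auto intro!: divide_right_mono)
    then show ?thesis unfolding v_def by simp
  qed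
  have v0: "v e0 = 0" using e0 by (simp add: v_def)
  have vV: "0 \<le> v V" using v_mono[of e0 V] v0 by (simp add: V_def)
  define \<epsilon> where "\<epsilon> = (f y - m0) / (2 * (v V + 1))"
  have \<epsilon>: "0 < \<epsilon>" unfolding \<epsilon>_def using fy vV by (intro divide_pos_pos) auto
  have \<epsilon>V: "m0 < f y - \<epsilon> * v V"
  proof -
    have "\<epsilon> * v V \<le> \<epsilon> * (v V + 1)" using \<epsilon> by simp
    also have "\<dots> = (f y - m0) / 2"
    proof -
      have "v V + 1 \<noteq> 0" using vV by simp
      then show ?thesis by (simp add: \<epsilon>_def divide_simps)
    qed
    finally show ?thesis using fy by (simp add: field_simps)
  qed
  define w where "w = exp ((Sb - m0) / \<epsilon>)"
  have w: "0 < w" by (simp add: w_def)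
  \<comment> \<open>\<open>v Em = ln (1 + w)\<close> exceeds \<open>(Sb - m0) / \<epsilon>\<close>.\<close>
  define Em where "Em = e0 * exp w"
  have Em: "0 < Em" using e0 by (simp add: Em_def)
  have small: "E < Em" if E: "e0 \<le> E" and "m0 < Sb - \<epsilon> * v E" for E
  proof (rule ccontr)
    assume "\<not> E < Em"
    then have "Em \<le> E" by simp
    then have "v Em \<le> v E" using v_mono[of Em E] e0 by (simp add: Em_def w_def)
    moreover have "(Sb - m0) / \<epsilon> \<le> v Em"
    proof -
      have "(Sb - m0) / \<epsilon> = ln w" by (simp add: w_def)
      also have "\<dots> \<le> ln (1 + w)" using w by simp
      also have "\<dots> = v Em" using e0 by (simp add: v_def Em_def)
      finally show ?thesis .
    qed
    ultimately have "Sb - m0 \<le> v E * \<epsilon>" using \<epsilon> by (simp add: pos_divide_le_eq[symmetric])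
    then show False using that(2) by (simp add: mult.commute)
  qed
  \<comment> \<open>The disc contains the subdivided path to \<open>y\<close> and, in its interior, all chains of energy below \<open>Em\<close>.\<close>
  define R where "R = max L (2 * sqrt Em + 1)"
  obtain r0 C' where r0: "0 < r0" "\<And>q q'. d p q \<le> R \<Longrightarrow> d q q' \<le> r0 \<Longrightarrow> good_edge C' q q'"
    using uniform_good_edge[OF compact_B[of R]] by auto
  obtain N where N: "0 < N" "L / r1 \<le> real N" "L / r0 \<le> real N" "4 * Em / r0\<^sup>2 < real N"
  proof -
    obtain n where n: "L / r1 + L / r0 + 4 * Em / r0\<^sup>2 < real n" using reals_Archimedean2 by blast
    have "0 \<le> L / r1" "0 \<le> L / r0" "0 < 4 * Em / r0\<^sup>2" using L0 r1(1) r0(1) Em by auto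
    then have "0 < real n" "L / r1 \<le> real n" "L / r0 \<le> real n" "4 * Em / r0\<^sup>2 < real n" using n by linarith+
    then show ?thesis using that[of n] by simp
  qed
  define h where "h = L / real N"
  have h: "0 \<le> h" "real N * h = L" "h \<le> r1" "h \<le> r0"
    using N L0 r1(1) r0(1) by (auto simp: h_def pos_divide_le_eq mult.commute)
  obtain y0 where y0: "y0 0 = p" "y0 N = y" "\<forall>i<N. d (y0 i) (y0 (Suc i)) \<le> h" "\<forall>i\<le>N. d p (y0 i) \<le> real i * h"
    using PL_subdivide[of p y N h] L h by auto
  define Y where "Y i = (if i \<le> N then y0 i else y)" for i
  have YL: "d p (Y i) \<le> L" for i
  proof (cases "i \<le> N")
    case True
    then have "d p (Y i) \<le> real i * h" using y0(4) by (simp add: Y_def)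
    also have "\<dots> \<le> real N * h" using True h(1) by (intro mult_right_mono) auto
    finally show ?thesis using h(2) by simp
  next
    case False
    then show ?thesis using d_le[OF L] by (simp add: Y_def)
  qed
  have Ystep: "d (Y i) (Y (Suc i)) \<le> h" if "i < N" for i using y0(3) that by (simp add: Y_def)
  have Yge: "good_edge C (Y i) (Y (Suc i))" if "i < N" for i
    using r1(3)[OF YL] Ystep[OF that] h(3) by (meson order_trans)
  have YN: "Y 0 = p" "Y N = y" using y0 by (simp_all add: Y_def)
  have EY: "real N * energy N Y \<le> V"
  proof -
    have "energy N Y \<le> (\<Sum>i<N. C * h\<^sup>2)"
      unfolding energy_def
    proof (rule sum_mono)
      fix i assume i: "i \<in> {..<N}"
      have "chord (Y i) (Y (Suc i)) \<le> C * (d (Y i) (Y (Suc i)))\<^sup>2" using Yge i by (simp add: good_edge_def)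
      also have "\<dots> \<le> C * h\<^sup>2" using Ystep i d_nonneg r1(2) by (intro mult_left_mono power_mono) auto
      finally show "chord (Y i) (Y (Suc i)) \<le> C * h\<^sup>2" .
    qed
    then have "real N * energy N Y \<le> real N * (\<Sum>i<N. C * h\<^sup>2)" by (intro mult_left_mono) auto
    also have "\<dots> = C * (real N * h)\<^sup>2" by (simp add: power2_eq_square mult_ac)
    finally show ?thesis unfolding h(2) V_def by simp
  qed
  have eY: "e0 \<le> real N * energy N Y"
  proof -
    have "d (Y 0) (Y N) \<le> 2 * sqrt (real N * energy N Y)"
      by (rule chain_distance[of N C Y N]) (use Yge in auto)
    then have "sqrt e0 < sqrt (real N * energy N Y)" using far unfolding YN by linarith
    then show ?thesis by simp
  qed
  define Fs where "Fs = {x. (\<forall>i. x i \<in> disc p R) \<and> x 0 = p \<and> (\<forall>i<N. d (x i) (x (Suc i)) \<le> r0) \<and> e0 \<le> real N * energy N x}"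
  define \<Phi> where "\<Phi> x = f (x N) - \<epsilon> * v (real N * energy N x)" for x
  have "closed {x. x 0 = p \<and> (\<forall>i<N. d (x i) (x (Suc i)) \<le> r0) \<and> e0 \<le> real N * energy N x}"
    by (intro closed_Collect_conj closed_Collect_all closed_Collect_imp open_Collect_const closed_Collect_le
        closed_Collect_eq continuous_on_d_nodes continuous_on_energy continuous_on_node continuous_intros)
  from compact_Int_closed[OF compact_chains[OF compact_B[of R]] this]
  have compact_Fs: "compact Fs" by (simp add: Fs_def Int_def)
  have "d p (Y i) \<le> R" for i using YL[of i] by (simp add: R_def)
  then have YF: "Y \<in> Fs" unfolding Fs_def using YN(1) Ystep h(4) eY by (auto intro: order_trans)
  have "continuous_on Fs \<Phi>"
    unfolding \<Phi>_def v_def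
  proof (intro continuous_intros continuous_on_energy continuous_on_compose2[OF continuous_on_f[of UNIV]] continuous_on_node)
    show "\<forall>x\<in>Fs. real N * energy N x / e0 \<noteq> 0" using e0 N(1) by (auto simp: Fs_def)
    have "1 \<le> 1 + ln (real N * energy N x / e0)" if "x \<in> Fs" for x
      using that e0 by (simp add: Fs_def)
    then show "\<forall>x\<in>Fs. 1 + ln (real N * energy N x / e0) \<noteq> 0" by (metis not_one_le_zero)
  qed (use e0 in auto)
  then obtain x where x: "x \<in> Fs" "\<And>x'. x' \<in> Fs \<Longrightarrow> \<Phi> x' \<le> \<Phi> x"
    using continuous_attains_sup[OF compact_Fs] YF by blast
  have xF: "\<And>i. d p (x i) \<le> R" "x 0 = p" "\<And>i. i < N \<Longrightarrow> d (x i) (x (Suc i)) \<le> r0" "e0 \<le> real N * energy N x"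
    using x(1) by (auto simp: Fs_def)
  have xge: "good_edge C' (x i) (x (Suc i))" if "i < N" for i using r0(2)[OF xF(1) xF(3)[OF that]] .
  have "f y - \<epsilon> * v V \<le> \<Phi> Y"
    unfolding \<Phi>_def YN using v_mono[OF eY EY] \<epsilon> by simp
  also have "\<Phi> Y \<le> \<Phi> x" by (rule x(2)[OF YF])
  finally have \<Phi>x: "m0 < \<Phi> x" using \<epsilon>V by simp
  have dist_x: "d p (x i) \<le> 2 * sqrt (real N * energy N x)" if "i \<le> N" for i
    using chain_distance[of N C' x i] xge that xF(2) by simp
  show False
  proof (cases "real N * energy N x = e0")
    case True
    then have "f (x N) \<le> m0" using core dist_x[of N] by simp
    then show False using \<Phi>x True v0 by (simp add: \<Phi>_def)
  next
    case False
    then have big: "e0 < real N * energy N x" using xF(4) by simp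
    have sm: "real N * energy N x < Em"
      using small[OF xF(4)] \<Phi>x Sb[of "x N"] by (simp add: \<Phi>_def)
    have inB: "d p (x i) < R" if "i \<le> N" for i
    proof -
      have "sqrt (real N * energy N x) \<le> sqrt Em" using sm by simp
      then have "d p (x i) < 2 * sqrt Em + 1" using dist_x[OF that] by linarith
      then show ?thesis by (simp add: R_def)
    qed
    have short: "d (x i) (x (Suc i)) < r0" if i: "i < N" for i
    proof -
      have c0: "0 \<le> chord (x j) (x (Suc j))" if "j < N" for j
        using xge[OF that] zero_le_power2[of "d (x j) (x (Suc j))"] unfolding good_edge_def by linarith
      have "(d (x i) (x (Suc i)))\<^sup>2 \<le> 4 * chord (x i) (x (Suc i))" using xge[OF i] by (simp add: good_edge_def)
      also have "chord (x i) (x (Suc i)) \<le> energy N x"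
        unfolding energy_def by (rule member_le_sum) (use i c0 in auto)
      also have "4 * energy N x < r0\<^sup>2"
      proof -
        have "4 * energy N x * real N < 4 * Em" using sm by (simp add: mult_ac)
        also have "\<dots> < r0\<^sup>2 * real N" using N(4) r0(1) by (simp add: pos_divide_less_eq mult.commute)
        finally show ?thesis using N(1) by simp
      qed
      finally have "(d (x i) (x (Suc i)))\<^sup>2 < r0\<^sup>2" by simp
      then show ?thesis using r0(1) by (simp add: power_less_imp_less_base)
    qed
    have a_eq: "v (real N * E) = ln (1 + ln (real N / e0 * E))" for E by (simp add: v_def)
    have lnE: "0 \<le> ln (real N / e0 * energy N x)" using xF(4) e0 by simp
    show False
    proof (rule chain_no_interior_maximum[where N = N and x = x and C = C' and \<epsilon> = \<epsilon> and a = "real N / e0"])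
      show "nonneg_curvature A g" "0 < N" "0 < \<epsilon>" by (rule nn, rule N(1), rule \<epsilon>)
      show "good_edge C' (x i) (x (Suc i))" if "i < N" for i by (rule xge[OF that])
      show "0 < energy N x"
        using big e0 N(1) by (metis less_trans mult_pos_pos zero_less_mult_pos of_nat_0_less_iff)
      show "0 < real N / e0" using N(1) e0 by simp
      show "0 < 1 + ln (real N / e0 * energy N x)" using lnE by simp
      fix Z :: "real \<Rightarrow> nat \<Rightarrow> 'a"
      assume Z: "Z 0 = x" "\<And>s. Z s 0 = x 0" "\<And>s i. N < i \<Longrightarrow> Z s i = x i" "\<And>i. isCont (\<lambda>s. Z s i) 0"
      have dZ: "\<forall>\<^sub>F s in nhds 0. d (Z s i) (Z s j) < r" if "d (x i) (x j) < r" for i j r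
      proof -
        have "isCont (\<lambda>s. d (Z s i) (Z s j)) 0"
          using Z(4)[of i] Z(4)[of j] unfolding isCont_def by (rule tendsto_d)
        from isCont_eventually_mem[OF this open_lessThan[of r]] show ?thesis using that Z(1) by simp
      qed
      have 1: "\<forall>\<^sub>F s in nhds 0. \<forall>i\<in>{..N}. d (Z s 0) (Z s i) < R"
        by (rule eventually_ball_finite) (use dZ inB xF(2) in auto)
      have 2: "\<forall>\<^sub>F s in nhds 0. \<forall>i\<in>{..<N}. d (Z s i) (Z s (Suc i)) < r0"
        by (rule eventually_ball_finite) (use dZ short in auto)
      have 3: "\<forall>\<^sub>F s in nhds 0. e0 < real N * energy N (Z s)"
      proof -
        have "isCont (\<lambda>s. real N * energy N (Z s)) 0"
          by (intro continuous_intros isCont_energy Z(4))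
        from isCont_eventually_mem[OF this open_greaterThan[of e0]] show ?thesis using big Z(1) by simp
      qed
      show "\<forall>\<^sub>F s in nhds 0. f (Z s N) - \<epsilon> * ln (1 + ln (real N / e0 * energy N (Z s)))
        \<le> f (x N) - \<epsilon> * ln (1 + ln (real N / e0 * energy N x))"
        using 1 2 3
      proof eventually_elim
        case (elim s)
        have "d p (Z s i) \<le> R" for i
        proof (cases "i \<le> N")
          case True
          then show ?thesis using elim(1) Z(2) xF(2) by (metis atMost_iff less_imp_le)
        next
          case False
          then show ?thesis using Z(3)[of i s] xF(1) by simp
        qed
        then have "Z s \<in> Fs" using elim(2,3) Z(2) xF(2) by (auto simp: Fs_def less_imp_le)
        from x(2)[OF this] show ?case by (simp only: \<Phi>_def a_eq)
      qed
    qed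
  qed
qed

text \<open>
  The centre is chosen at a point of positive curvature, where \<open>\<Delta> f \<ge> K > 0\<close>, and the radius so small that
  \<open>\<Delta> f\<close> remains positive on the disc. By \<open>max_principle\<close> the maximum of \<open>f\<close> over this disc is a global one.
\<close>

theorem complete_imp_flat:
  assumes compl: "complete_surface A g" and nn: "nonneg_curvature A g" and bdd: "bdd_above (range f)"
  shows "flat_surface A g"
proof (rule ccontr)
  assume "\<not> flat_surface A g"
  then obtain c x where c: "c \<in> A" and x: "x \<in> chart_img c" and K: "gauss_curvature (g c) x \<noteq> 0"
    unfolding flat_surface_def by blast
  let ?F = "\<Psi> \<circ> chart_inv c" and ?f = "f \<circ> chart_inv c"
  interpret P: null_cone_patch ?F "chart_img c" by (rule patch[OF c])
  have "0 < gauss_curvature (g c) x" using K nn c x unfolding nonneg_curvature_def by (metis order_le_less)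
  then have lx: "0 < laplacian (g c) ?f x" using laplacian_f[OF c x] by simp
  have sf: "smooth_on (chart_img c) ?f" using smooth_f c by (simp add: surface_smooth_def)
  have cont: "continuous_on (chart_img c) (laplacian (g c) ?f)"
  proof -
    have "smooth_on (chart_img c) (laplacian P.G ?f)"
      unfolding laplacian_def
      by (intro smooth_on_sum_2 smooth_on_mult smooth_on_diff smooth_on_pdiff sf P.smooth_gi P.smooth_christoffel P.open_S)
    then have "continuous_on (chart_img c) (laplacian P.G ?f)" by (rule smooth_on_continuous)
    then show ?thesis
      by (rule continuous_on_eq) (rule laplacian_cong[OF P.open_S], assumption, rule isometric[OF c], assumption, rule HOL.refl)
  qed
  define p where "p = chart_inv c x"
  have O1: "open (chart_img c \<inter> laplacian (g c) ?f -` {0<..})"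
    by (rule continuous_open_preimage[OF cont P.open_S open_greaterThan])
  define U where "U = chart_dom c \<inter> chart_map c -` (chart_img c \<inter> laplacian (g c) ?f -` {0<..})"
  have "open U" unfolding U_def
    by (rule continuous_open_preimage[OF homeomorphism_cont1[OF chart_homeo[OF c]] open_dom[OF c] O1])
  moreover have "p \<in> U" using inv_dom[OF c x] map_inv[OF c x] x lx by (simp add: U_def p_def)
  ultimately obtain r where r: "r > 0" "M.mball p r \<subseteq> U"
    using M.openin_mtopology[of U] unfolding mtopology_eq by auto
  define e0 where "e0 = (r / 4)\<^sup>2"
  have e0: "0 < e0" "2 * sqrt e0 = r / 2" using r(1) by (simp_all add: e0_def)
  have sub: "q \<in> U" if "d p q \<le> 2 * sqrt e0" for q
    using that r e0(2) by (auto simp: M.mball_def subset_iff)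
  have "p \<in> disc p (2 * sqrt e0)" using e0 r(1) by (simp add: d_self)
  then obtain q where q: "q \<in> disc p (2 * sqrt e0)" "\<And>q'. q' \<in> disc p (2 * sqrt e0) \<Longrightarrow> f q' \<le> f q"
    using continuous_attains_sup[OF hopf_rinow[OF compl, of p "2 * sqrt e0"] _ continuous_on_f] by blast
  have mx: "f y \<le> f q" for y
    by (rule max_principle[OF compl nn bdd e0(1)]) (use q(2) in blast)
  have "q \<in> U" using sub q(1) by blast
  then have "q \<in> chart_dom c" "0 < laplacian (g c) ?f (chart_map c q)" by (auto simp: U_def)
  from no_max_of_strictly_subharmonic[OF nn c this] mx show False by (meson not_less)
qed

end

theorem theorem4p9:
  fixes A :: "('a::{t2_space,second_countable_topology}) chart set"
    and g :: "'a chart \<Rightarrow> real^2 \<Rightarrow> real^2^2"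
  assumes "riemannian_surface A g"
    and "connected (UNIV :: 'a set)"
    and "\<not> flat_surface A g"
    and "nonneg_curvature A g"
  shows "(parabolic_surface A g \<longrightarrow>
           \<not> (\<exists>\<psi> lam. spacelike_immersion A \<psi> \<and> range \<psi> \<subseteq> future_light_cone \<and>
                weakly_trapped A \<psi> \<and>
                surface_smooth A lam \<and> (\<forall>p. 0 < lam p) \<and> bdd_above (range lam) \<and>
                conformal_with_factor A g \<psi> lam)) \<and>
         (complete_surface A g \<longrightarrow>
           \<not> (\<exists>\<psi> lam. spacelike_immersion A \<psi> \<and> range \<psi> \<subseteq> future_light_cone \<and>
                weakly_trapped A \<psi> \<and>
                surface_smooth A lam \<and> (\<forall>p. 0 < lam p) \<and> bdd_above (range lam) \<and>
                conformal_with_factor A g \<psi> lam))"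
proof -
  have "\<not> parabolic_surface A g \<and> \<not> complete_surface A g"
    if H: "spacelike_immersion A \<psi>" "range \<psi> \<subseteq> future_light_cone" "weakly_trapped A \<psi>"
      "surface_smooth A lam" "\<forall>p. 0 < lam p" "bdd_above (range lam)" "conformal_with_factor A g \<psi> lam"
    for \<psi> lam
  proof -
    interpret connected_light_cone_surface A g "\<lambda>p. (1 / lam p) *\<^sub>R \<psi> p" "\<lambda>p. ln (lam p)"
      using trapped_light_cone_surface[OF assms(1) H(1-5,7)] assms(2)
      by (intro connected_light_cone_surface.intro connected_light_cone_surface_axioms.intro)
    obtain M where M: "\<And>p. lam p \<le> M" using H(6) by (auto simp: bdd_above_def)
    have "ln (lam p) \<le> ln M" for p
      using M[of p] H(5) by (meson ln_le_cancel_iff order_less_le_trans)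
    then have "bdd_above (range (\<lambda>p. ln (lam p)))" by (auto intro: bdd_aboveI[of _ "ln M"])
    then show ?thesis
      using parabolic_imp_flat complete_imp_flat assms(3,4) by blast
  qed
  then show ?thesis by blast
qed

end
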